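(* Let $B$ be the commutative ring \[ B = \frac{R\left[b_{i,j} \mid i \in [1,r],\ j \in \mathbb{Z} \right]}{\left(b_{i,j}^2 - \sigma^{-j}((z - \alpha_i)^{n_i}) \mid i \in [1,r],\ j \in \mathbb{Z} \right)} \] associated with $(R,\sigma,f)$ as described in the context. Then $B$ is a coherent Gorenstein ring.
   Context: $\Bbbk$ is an algebraically closed field of characteristic zero. Either (1) $R=\Bbbk[z]$ and $\sigma$ is the automorphism $\sigma(z)=z+1$, or (2) $R=\Bbbk[z,z^{-1}]$ and $\sigma(z)=\xi z$ with $\xi\in\Bbbk^\times$ not a root of unity. $f\in\Bbbk[z]$ is monic with $f(0)\ne0$ in case (2). Put $\sigma_\Bbbk(\lambda)=\lambda-1$ in case (1), $\sigma_\Bbbk(\lambda)=\xi^{-1}\lambda$ in case (2); no two distinct roots of $f$ lie on the same $\sigma_\Bbbk$-orbit. $\alpha_1,\dots,\alpha_r$ are the distinct roots of $f$, with multiplicities $n_1,\dots,n_r$. $[1,r]=\{1,\dots,r\}$. A commutative ring is coherent if every finitely generated ideal is finitely presented. A coherent ring $S$ is Gorenstein (in the sense of Hummel--Marley) if for every maximal ideal $\mathfrak{m}$ of $S$, every finitely generated ideal of $S_{\mathfrak m}$ has finite Gorenstein dimension over $S_{\mathfrak m}$. Here, over a coherent ring $T$, a finitely presented module $M$ has Gorenstein dimension zero (if nonzero) when $M$ is reflexive (i.e. $M\to M^{**}$ is an isomorphism, with $M^*=\operatorname{Hom}_T(M,T)$) and $\operatorname{Ext}^i_T(M,T)=0=\operatorname{Ext}^i_T(M^*,T)$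 for all $i>0$; and $M$ has finite Gorenstein dimension if it has a finite resolution by finitely presented modules that are zero or of Gorenstein dimension zero. *)

theory Defs
  imports
    "HOL-Algebra.Algebra"
    "HOL-Algebra.Algebraic_Closure_Type"
    "HOL-Computational_Algebra.Computational_Algebra"
    "HOL-Library.Poly_Mapping"
begin

section \<open>Modules over a commutative ring\<close>

text \<open>
  A module record extends a ring record; the locale \<^locale>\<open>module\<close> does not use the fields
  \<^const>\<open>monoid.mult\<close> and \<^const>\<open>monoid.one\<close>, which are left unspecified below.
\<close>

definition ring_module :: "('a, 'x) ring_scheme \<Rightarrow> ('a, 'a) module" where
  "ring_module R = \<lparr>carrier = carrier R, monoid.mult = undefined, one = undefined,
     ring.zero = \<zero>\<^bsub>R\<^esub>, add = add R, module.smult = monoid.mult R\<rparr>"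

definition ideal_module :: "('a, 'x) ring_scheme \<Rightarrow> 'a set \<Rightarrow> ('a, 'a) module" where
  "ideal_module R I = (ring_module R)\<lparr>carrier := I\<rparr>"

definition free_module :: "('a, 'x) ring_scheme \<Rightarrow> nat \<Rightarrow> ('a, nat \<Rightarrow> 'a) module" where
  "free_module R n = \<lparr>carrier = {..<n} \<rightarrow>\<^sub>E carrier R, monoid.mult = undefined, one = undefined,
     ring.zero = (\<lambda>i\<in>{..<n}. \<zero>\<^bsub>R\<^esub>),
     add = (\<lambda>v w. \<lambda>i\<in>{..<n}. v i \<oplus>\<^bsub>R\<^esub> w i),
     module.smult = (\<lambda>a v. \<lambda>i\<in>{..<n}. a \<otimes>\<^bsub>R\<^esub> v i)\<rparr>"

definition mod_hom ::
  "('a, 'x) ring_scheme \<Rightarrow> ('a, 'm, 'y) module_scheme \<Rightarrow> ('a, 'n, 'z) module_scheme \<Rightarrow> ('m \<Rightarrow> 'n) set"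
  where
  "mod_hom R M N = {h \<in> carrier M \<rightarrow>\<^sub>E carrier N.
     (\<forall>x\<in>carrier M. \<forall>y\<in>carrier M. h (x \<oplus>\<^bsub>M\<^esub> y) = h x \<oplus>\<^bsub>N\<^esub> h y) \<and>
     (\<forall>a\<in>carrier R. \<forall>x\<in>carrier M. h (a \<odot>\<^bsub>M\<^esub> x) = a \<odot>\<^bsub>N\<^esub> h x)}"

definition hom_module ::
  "('a, 'x) ring_scheme \<Rightarrow> ('a, 'm, 'y) module_scheme \<Rightarrow> ('a, 'n, 'z) module_scheme
     \<Rightarrow> ('a, 'm \<Rightarrow> 'n) module" where
  "hom_module R M N = \<lparr>carrier = mod_hom R M N, monoid.mult = undefined, one = undefined,
     ring.zero = (\<lambda>x\<in>carrier M. \<zero>\<^bsub>N\<^esub>),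
     add = (\<lambda>g h. \<lambda>x\<in>carrier M. g x \<oplus>\<^bsub>N\<^esub> h x),
     module.smult = (\<lambda>a h. \<lambda>x\<in>carrier M. a \<odot>\<^bsub>N\<^esub> h x)\<rparr>"

definition dual_module ::
  "('a, 'x) ring_scheme \<Rightarrow> ('a, 'm, 'y) module_scheme \<Rightarrow> ('a, 'm \<Rightarrow> 'a) module" where
  "dual_module R M = hom_module R M (ring_module R)"

definition exact_at ::
  "('a, 'l, 'x) module_scheme \<Rightarrow> ('l \<Rightarrow> 'm) \<Rightarrow> ('a, 'm, 'y) module_scheme \<Rightarrow> ('m \<Rightarrow> 'n)
     \<Rightarrow> ('a, 'n, 'z) module_scheme \<Rightarrow> bool" where
  "exact_at L g M h N \<longleftrightarrow> g ` carrier L = a_kernel M N h"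

definition finitely_presented ::
  "('a, 'x) ring_scheme \<Rightarrow> ('a, 'm, 'y) module_scheme \<Rightarrow> bool" where
  "finitely_presented R M \<longleftrightarrow> module R M \<and>
     (\<exists>m n d p. d \<in> mod_hom R (free_module R m) (free_module R n) \<and>
        p \<in> mod_hom R (free_module R n) M \<and>
        exact_at (free_module R m) d (free_module R n) p M \<and>
        p ` carrier (free_module R n) = carrier M)"

definition reflexive_module ::
  "('a, 'x) ring_scheme \<Rightarrow> ('a, 'm, 'y) module_scheme \<Rightarrow> bool" where
  "reflexive_module R M \<longleftrightarrow>
     (let ev = (\<lambda>x\<in>carrier M. \<lambda>\<phi>\<in>carrier (dual_module R M). \<phi> x);
          M'' = dual_module R (dual_module R M)
      in ev \<in> mod_hom R M M'' \<and> bij_betw ev (carrier M) (carrier M''))"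


section \<open>Vanishing of Ext\<close>

text \<open>
  \<open>\<dots> \<rightarrow> R^(n 2) \<rightarrow> R^(n 1) \<rightarrow> R^(n 0) \<rightarrow> M \<rightarrow> 0\<close>, where \<open>d k\<close> maps \<open>R^(n (k + 1))\<close> to \<open>R^(n k)\<close> and
  \<open>e\<close> is the augmentation.
\<close>

definition free_resolution ::
  "('a, 'x) ring_scheme \<Rightarrow> ('a, 'm, 'y) module_scheme \<Rightarrow> (nat \<Rightarrow> nat)
     \<Rightarrow> (nat \<Rightarrow> (nat \<Rightarrow> 'a) \<Rightarrow> (nat \<Rightarrow> 'a)) \<Rightarrow> ((nat \<Rightarrow> 'a) \<Rightarrow> 'm) \<Rightarrow> bool" where
  "free_resolution R M n d e \<longleftrightarrow>
     (let F = (\<lambda>k. free_module R (n k)) in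
       (\<forall>k. d k \<in> mod_hom R (F (Suc k)) (F k)) \<and>
       e \<in> mod_hom R (F 0) M \<and>
       (\<forall>k. exact_at (F (Suc (Suc k))) (d (Suc k)) (F (Suc k)) (d k) (F k)) \<and>
       exact_at (F (Suc 0)) (d 0) (F 0) e M \<and>
       e ` carrier (F 0) = carrier M)"

definition ext_cocycles ::
  "('a, 'x) ring_scheme \<Rightarrow> ('a, 'n, 'z) module_scheme \<Rightarrow> (nat \<Rightarrow> nat)
     \<Rightarrow> (nat \<Rightarrow> (nat \<Rightarrow> 'a) \<Rightarrow> (nat \<Rightarrow> 'a)) \<Rightarrow> nat \<Rightarrow> ((nat \<Rightarrow> 'a) \<Rightarrow> 'n) set" where
  "ext_cocycles R N n d i = {\<phi> \<in> mod_hom R (free_module R (n i)) N.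
     \<forall>x\<in>carrier (free_module R (n (Suc i))). \<phi> (d i x) = \<zero>\<^bsub>N\<^esub>}"

definition ext_coboundaries ::
  "('a, 'x) ring_scheme \<Rightarrow> ('a, 'n, 'z) module_scheme \<Rightarrow> (nat \<Rightarrow> nat)
     \<Rightarrow> (nat \<Rightarrow> (nat \<Rightarrow> 'a) \<Rightarrow> (nat \<Rightarrow> 'a)) \<Rightarrow> nat \<Rightarrow> ((nat \<Rightarrow> 'a) \<Rightarrow> 'n) set" where
  "ext_coboundaries R N n d i =
     (case i of
        0 \<Rightarrow> {\<lambda>x\<in>carrier (free_module R (n 0)). \<zero>\<^bsub>N\<^esub>}
      | Suc k \<Rightarrow> (\<lambda>\<psi>. compose (carrier (free_module R (n i))) \<psi> (d k)) `
                   mod_hom R (free_module R (n k)) N)"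

text \<open>The \<open>i\<close>-th cohomology group of the complex obtained by applying \<open>Hom(-, N)\<close> to a resolution.\<close>

definition ext_group ::
  "('a, 'x) ring_scheme \<Rightarrow> ('a, 'n, 'z) module_scheme \<Rightarrow> (nat \<Rightarrow> nat)
     \<Rightarrow> (nat \<Rightarrow> (nat \<Rightarrow> 'a) \<Rightarrow> (nat \<Rightarrow> 'a)) \<Rightarrow> nat \<Rightarrow> ((nat \<Rightarrow> 'a) \<Rightarrow> 'n) set monoid" where
  "ext_group R N n d i =
     (hom_module R (free_module R (n i)) N)\<lparr>carrier := ext_cocycles R N n d i\<rparr>
       A_Mod ext_coboundaries R N n d i"

text \<open>
  \<open>Ext^i(M, N) = 0\<close>, for modules \<open>M\<close> that have a resolution by free modules of finite rank (over a
  coherent ring: all finitely presented modules). As Ext is independent of the resolution up to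
  isomorphism, it makes no difference which resolution is taken; demanding that one exists keeps
  the notion from holding vacuously.
\<close>

definition ext_vanishes ::
  "('a, 'x) ring_scheme \<Rightarrow> ('a, 'm, 'y) module_scheme \<Rightarrow> ('a, 'n, 'z) module_scheme \<Rightarrow> nat \<Rightarrow> bool"
  where
  "ext_vanishes R M N i \<longleftrightarrow>
     (\<exists>n d e. free_resolution R M n d e \<and> trivial_group (ext_group R N n d i))"


section \<open>Gorenstein dimension\<close>

definition gdim_zero :: "('a, 'x) ring_scheme \<Rightarrow> ('a, 'm, 'y) module_scheme \<Rightarrow> bool" where
  "gdim_zero R M \<longleftrightarrow>
     finitely_presented R M \<and> carrier M \<noteq> {\<zero>\<^bsub>M\<^esub>} \<and> reflexive_module R M \<and>
     (\<forall>i>0. ext_vanishes R M (ring_module R) i \<and>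
            ext_vanishes R (dual_module R M) (ring_module R) i)"

text \<open>
  A resolution \<open>0 \<rightarrow> G l \<rightarrow> \<dots> \<rightarrow> G 0 \<rightarrow> M \<rightarrow> 0\<close>, padded by zero modules above \<open>l\<close>. Every finitely
  presented module is isomorphic to a quotient of some \<open>R^n\<close>, whose elements are cosets, that is,
  sets of vectors; hence it is no restriction that the carriers of the \<open>G k\<close> consist of sets of
  vectors.
\<close>

definition finite_gdim :: "('a, 'x) ring_scheme \<Rightarrow> ('a, 'm, 'y) module_scheme \<Rightarrow> bool" where
  "finite_gdim R M \<longleftrightarrow>
     (\<exists>(l :: nat) (G :: nat \<Rightarrow> ('a, (nat \<Rightarrow> 'a) set) module) d e.
        (\<forall>k. finitely_presented R (G k) \<and> (carrier (G k) = {\<zero>\<^bsub>G k\<^esub>} \<or> gdim_zero R (G k))) \<and>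
        (\<forall>k>l. carrier (G k) = {\<zero>\<^bsub>G k\<^esub>}) \<and>
        (\<forall>k. d k \<in> mod_hom R (G (Suc k)) (G k)) \<and>
        e \<in> mod_hom R (G 0) M \<and>
        (\<forall>k. exact_at (G (Suc (Suc k))) (d (Suc k)) (G (Suc k)) (d k) (G k)) \<and>
        exact_at (G (Suc 0)) (d 0) (G 0) e M \<and>
        e ` carrier (G 0) = carrier M)"


section \<open>Localization; coherent Gorenstein rings\<close>

definition frac_rel :: "('a, 'x) ring_scheme \<Rightarrow> 'a set \<Rightarrow> (('a \<times> 'a) \<times> ('a \<times> 'a)) set" where
  "frac_rel R S = {((a, s), (b, t)). a \<in> carrier R \<and> s \<in> S \<and> b \<in> carrier R \<and> t \<in> S \<and>
     (\<exists>u\<in>S. u \<otimes>\<^bsub>R\<^esub> (a \<otimes>\<^bsub>R\<^esub> t) = u \<otimes>\<^bsub>R\<^esub> (b \<otimes>\<^bsub>R\<^esub> s))}"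

definition localization :: "('a, 'x) ring_scheme \<Rightarrow> 'a set \<Rightarrow> ('a \<times> 'a) set ring" where
  "localization R S = \<lparr>
     carrier = (carrier R \<times> S) // frac_rel R S,
     monoid.mult = (\<lambda>U V. \<Union>(a, s)\<in>U. \<Union>(b, t)\<in>V. frac_rel R S `` {(a \<otimes>\<^bsub>R\<^esub> b, s \<otimes>\<^bsub>R\<^esub> t)}),
     one = frac_rel R S `` {(\<one>\<^bsub>R\<^esub>, \<one>\<^bsub>R\<^esub>)},
     ring.zero = frac_rel R S `` {(\<zero>\<^bsub>R\<^esub>, \<one>\<^bsub>R\<^esub>)},
     add = (\<lambda>U V. \<Union>(a, s)\<in>U. \<Union>(b, t)\<in>V.
              frac_rel R S `` {(a \<otimes>\<^bsub>R\<^esub> t \<oplus>\<^bsub>R\<^esub> b \<otimes>\<^bsub>R\<^esub> s, s \<otimes>\<^bsub>R\<^esub> t)})\<rparr>"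

definition fin_gen_ideal :: "('a, 'x) ring_scheme \<Rightarrow> 'a set \<Rightarrow> bool" where
  "fin_gen_ideal R I \<longleftrightarrow> (\<exists>A. finite A \<and> A \<subseteq> carrier R \<and> I = Idl\<^bsub>R\<^esub> A)"

definition coherent_ring :: "('a, 'x) ring_scheme \<Rightarrow> bool" where
  "coherent_ring R \<longleftrightarrow>
     cring R \<and> (\<forall>I. fin_gen_ideal R I \<longrightarrow> finitely_presented R (ideal_module R I))"

definition gorenstein_ring :: "('a, 'x) ring_scheme \<Rightarrow> bool" where
  "gorenstein_ring R \<longleftrightarrow>
     (\<forall>m. maximalideal m R \<longrightarrow>
        (let T = localization R (carrier R - m)
         in \<forall>I. fin_gen_ideal T I \<longrightarrow> finite_gdim T (ideal_module T I)))"


section \<open>The ring \<open>B\<close>\<close>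

text \<open>Integer powers of a bijection.\<close>

definition iter_int :: "('a \<Rightarrow> 'a) \<Rightarrow> int \<Rightarrow> 'a \<Rightarrow> 'a" where
  "iter_int \<sigma> j = (if j \<ge> 0 then \<sigma> ^^ nat j else inv_into UNIV \<sigma> ^^ nat (- j))"

text \<open>
  The polynomial ring over the type \<open>'r\<close> in the variables \<open>V\<close>: finitely supported functions from
  monomials, themselves finitely supported exponent functions, to coefficients.
\<close>

definition mpoly_ring :: "'x set \<Rightarrow> (('x \<Rightarrow>\<^sub>0 nat) \<Rightarrow>\<^sub>0 'r::comm_ring_1) ring" where
  "mpoly_ring V = ring_of_type_algebra
     \<lparr>carrier := {p. \<forall>m\<in>Poly_Mapping.keys p. Poly_Mapping.keys m \<subseteq> V}\<rparr>"

definition mpoly_var :: "'x \<Rightarrow> (('x \<Rightarrow>\<^sub>0 nat) \<Rightarrow>\<^sub>0 'r::comm_ring_1)" where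
  "mpoly_var x = Poly_Mapping.single (Poly_Mapping.single x 1) 1"

definition mpoly_const :: "'r \<Rightarrow> (('x \<Rightarrow>\<^sub>0 nat) \<Rightarrow>\<^sub>0 'r::comm_ring_1)" where
  "mpoly_const c = Poly_Mapping.single 0 c"

text \<open>
  The argument \<open>p i\<close> stands for \<open>(z - \<alpha> i) ^ n i\<close>, an element of \<open>R\<close>, which is here a type.
\<close>

definition B_ring ::
  "nat \<Rightarrow> ('r \<Rightarrow> 'r) \<Rightarrow> (nat \<Rightarrow> 'r) \<Rightarrow> ((nat \<times> int \<Rightarrow>\<^sub>0 nat) \<Rightarrow>\<^sub>0 'r::comm_ring_1) set ring" where
  "B_ring r \<sigma> p =
     (let P = mpoly_ring ({1..r} \<times> (UNIV :: int set))
      in P Quot (Idl\<^bsub>P\<^esub> {mpoly_var (i, j) ^ 2 - mpoly_const (iter_int \<sigma> (- j) (p i)) | i j.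
                          i \<in> {1..r}}))"

definition distinct_root_orbits :: "('k \<Rightarrow> 'k) \<Rightarrow> 'k::field poly \<Rightarrow> bool" where
  "distinct_root_orbits \<tau> f \<longleftrightarrow>
     (\<forall>x y. poly f x = 0 \<and> poly f y = 0 \<and> (\<exists>m. y = iter_int \<tau> m x) \<longrightarrow> x = y)"

definition shift_aut :: "'k::field poly \<Rightarrow> 'k poly" where
  "shift_aut p = pcompose p [:1, 1:]"

text \<open>Laurent polynomials: the group algebra of the integers.\<close>

type_synonym 'k laurent_poly = "int \<Rightarrow>\<^sub>0 'k"

definition laurent_z :: "'k::field laurent_poly" where
  "laurent_z = Poly_Mapping.single 1 1"

definition laurent_const :: "'k::field \<Rightarrow> 'k laurent_poly" where
  "laurent_const c = Poly_Mapping.single 0 c"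

text \<open>The automorphism sending \<open>z\<close> to \<open>\<xi> z\<close>: the coefficient of \<open>z^n\<close> is multiplied by \<open>\<xi>^n\<close>.\<close>

definition scale_aut :: "'k::field \<Rightarrow> 'k laurent_poly \<Rightarrow> 'k laurent_poly" where
  "scale_aut \<xi> p = Poly_Mapping.mapp (\<lambda>n c. \<xi> powi n * c) p"

end

theory Submission
  imports Defs
begin

text \<open>
  Call a commutative ring \<open>T\<close> good if the kernel of every matrix \<open>C\<close> over \<open>T\<close> is the image of a matrix \<open>K\<close> such
  that every row vector vanishing on the kernel of \<open>K\<close> is of the form \<open>v K\<close>. The second condition says that
  every functional on the kernel of \<open>C\<close> extends to the ambient free module, that is, \<open>Ext\<^sup>1(M, T) = 0\<close> for
  every finitely generated submodule \<open>M\<close> of a free module. Over a good ring a finitely generated torsionless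
  module is therefore finitely presented and has a resolution by free modules of finite rank whose dual is
  exact in positive degrees; its dual is again finitely generated torsionless, and reflexivity follows. So every
  nonzero finitely generated ideal has Gorenstein dimension zero.

  Bezout domains are good, because there kernels of matrices are direct summands. If \<open>T\<close> is good, so is
  \<open>T[b] / (b\<^sup>2 - c)\<close>: a functional into \<open>T \<oplus> T b\<close> is determined by its \<open>b\<close>-component, which extends over \<open>T\<close>.
  Goodness passes to unions of chains of such extensions, since they are free, and to localizations. The ring
  \<open>B\<close> arises from \<open>R\<close> by adjoining infinitely many square roots.
\<close>

section \<open>Linear algebra modulo an ideal\<close>

text \<open>Infinitely many roots are adjoined, so no chain condition is used; every notion is
  phrased by finite matrices, which already live in a stage with finitely many variables. The
  delicate point is the extension condition: it quantifies over all functionals, and a larger ring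
  has more of them. Given a matrix \<open>A\<close> whose columns generate the kernel of
  \<open>K\<close>, a functional vanishes on that kernel iff it is a row killed by \<open>A\<close>,
  so the condition follows from exactness of the transposed pair of \<open>A\<close> and
  \<open>K\<close>. Exactness of a pair of matrices does survive free extensions and localizations;
  hence \<open>K\<close> and \<open>A\<close> are transported together. In the square root step a
  functional \<open>\<phi> = f + g b\<close> is recovered from \<open>g\<close> because
  \<open>\<phi>\<close> commutes with multiplication by \<open>b\<close>: the b-component of
  \<open>\<phi> (b y)\<close> is \<open>f y\<close>, so \<open>f y = g (b y)\<close>. This is the
  Frobenius form of \<open>T' = T + T b\<close>. All intermediate rings are subsets of one
  polynomial type compared modulo one ideal, so enlarging the ring alters neither the matrices nor
  the congruence.\<close>

abbreviation dot :: "nat \<Rightarrow> (nat \<Rightarrow> 'a::comm_ring_1) \<Rightarrow> (nat \<Rightarrow> 'a) \<Rightarrow> 'a" where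
  "dot n u v \<equiv> (\<Sum>i<n. u i * v i)"

text \<open>Exactness in the middle of \<open>T^m -> T^n -> T^d\<close>, with \<open>N\<close> first
  and \<open>M\<close> second, for the classes of \<open>T\<close> modulo \<open>J\<close>. Vectors
  are total functions with all values in \<open>T\<close>; this spares index bounds in the
  membership conditions.\<close>

definition exact_mod ::
  "'a::comm_ring_1 set \<Rightarrow> 'a set \<Rightarrow> nat \<Rightarrow> nat \<Rightarrow> nat \<Rightarrow> (nat \<Rightarrow> nat \<Rightarrow> 'a) \<Rightarrow> (nat \<Rightarrow> nat \<Rightarrow> 'a) \<Rightarrow> bool"
  where "exact_mod T J d n m M N \<longleftrightarrow>
    (\<forall>i<d. \<forall>k<m. (\<Sum>j<n. M i j * N j k) \<in> J) \<and>
    (\<forall>x. (\<forall>j. x j \<in> T) \<longrightarrow> (\<forall>i<d. dot n (M i) x \<in> J) \<longrightarrow>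
      (\<exists>y. (\<forall>k. y k \<in> T) \<and> (\<forall>j<n. x j - dot m (N j) y \<in> J)))"

text \<open>A row \<open>\<phi>\<close> that vanishes on the kernel of \<open>K\<close> is a
  functional on the image of \<open>K\<close>, and \<open>v\<close> is an extension of it to all of
  \<open>T^n\<close>.\<close>

definition extension_mod ::
  "'a::comm_ring_1 set \<Rightarrow> 'a set \<Rightarrow> nat \<Rightarrow> nat \<Rightarrow> (nat \<Rightarrow> nat \<Rightarrow> 'a) \<Rightarrow> bool"
  where "extension_mod T J n m K \<longleftrightarrow>
    (\<forall>\<phi>. (\<forall>k. \<phi> k \<in> T) \<longrightarrow>
      (\<forall>y. (\<forall>k. y k \<in> T) \<longrightarrow> (\<forall>j<n. dot m (K j) y \<in> J) \<longrightarrow> dot m \<phi> y \<in> J) \<longrightarrow>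
      (\<exists>v. (\<forall>j. v j \<in> T) \<and> (\<forall>k<m. \<phi> k - (\<Sum>j<n. v j * K j k) \<in> J)))"

text \<open>What the overview calls good, for the ring of classes of \<open>T\<close> modulo
  \<open>J\<close>.\<close>

definition kernel_duality_mod :: "'a::comm_ring_1 set \<Rightarrow> 'a set \<Rightarrow> bool" where
  "kernel_duality_mod T J \<longleftrightarrow>
    (\<forall>d n C. (\<forall>i j. C i j \<in> T) \<longrightarrow>
      (\<exists>m K. (\<forall>j k. K j k \<in> T) \<and> exact_mod T J d n m C K \<and> extension_mod T J n m K))"

definition subring_set :: "'a::comm_ring_1 set \<Rightarrow> bool" where
  "subring_set T \<longleftrightarrow> 0 \<in> T \<and> 1 \<in> T \<and> (\<forall>a\<in>T. \<forall>b\<in>T. a + b \<in> T \<and> a * b \<in> T) \<and> (\<forall>a\<in>T. - a \<in> T)"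

lemma subring_setD:
  assumes "subring_set T"
  shows "0 \<in> T" "1 \<in> T" "\<And>a b. a \<in> T \<Longrightarrow> b \<in> T \<Longrightarrow> a + b \<in> T"
    "\<And>a b. a \<in> T \<Longrightarrow> b \<in> T \<Longrightarrow> a * b \<in> T" "\<And>a. a \<in> T \<Longrightarrow> - a \<in> T"
    "\<And>a b. a \<in> T \<Longrightarrow> b \<in> T \<Longrightarrow> a - b \<in> T"
  using assms unfolding subring_set_def by (auto simp del: add_uminus_conv_diff simp: diff_conv_add_uminus)

lemma sum_lessThan_add: "sum f {..<n + m} = sum f {..<n} + (\<Sum>j<m. f (n + j))" for n m :: nat
  by (induction m) (simp_all add: add.assoc)

text \<open>\<open>J\<close> is an ideal of the whole type, while the rings under study are subsets
  \<open>T\<close> of it. Congruences may therefore be multiplied by elements of any larger ring,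
  and they stay the same relation when \<open>T\<close> grows.\<close>

locale ideal_mod =
  fixes J :: "'a::comm_ring_1 set"
  assumes J0 [simp]: "0 \<in> J"
    and J_add: "a \<in> J \<Longrightarrow> b \<in> J \<Longrightarrow> a + b \<in> J"
    and J_mult: "a \<in> J \<Longrightarrow> r * a \<in> J"
begin

definition cg :: "'a \<Rightarrow> 'a \<Rightarrow> bool" (infix "\<doteq>" 50) where "a \<doteq> b \<longleftrightarrow> a - b \<in> J"

lemma J_uminus: "a \<in> J \<Longrightarrow> - a \<in> J"
  using J_mult[of a "-1"] by simp

lemma cg_refl [simp]: "a \<doteq> a"
  by (simp add: cg_def)

lemma cg_sym: "a \<doteq> b \<Longrightarrow> b \<doteq> a"
  unfolding cg_def using J_uminus by fastforce

lemma cg_trans [trans]: "a \<doteq> b \<Longrightarrow> b \<doteq> c \<Longrightarrow> a \<doteq> c"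
  unfolding cg_def using J_add[of "a - b" "b - c"] by simp

lemma cg_add: "a \<doteq> b \<Longrightarrow> c \<doteq> d \<Longrightarrow> a + c \<doteq> b + d"
  unfolding cg_def using J_add[of "a - b" "c - d"] by (simp add: algebra_simps)

lemma cg_mult_left: "a \<doteq> b \<Longrightarrow> c * a \<doteq> c * b"
  unfolding cg_def using J_mult[of "a - b" c] by (simp add: algebra_simps)

lemma cg_mult_right: "a \<doteq> b \<Longrightarrow> a * c \<doteq> b * c"
  using cg_mult_left[of a b c] by (simp add: mult.commute)

lemma cg_mult: "a \<doteq> b \<Longrightarrow> c \<doteq> d \<Longrightarrow> a * c \<doteq> b * d"
  using cg_mult_left cg_mult_right cg_trans by blast

lemma cg_sum: "(\<And>i. i \<in> I \<Longrightarrow> f i \<doteq> g i) \<Longrightarrow> sum f I \<doteq> sum g I"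
  by (induction I rule: infinite_finite_induct) (auto intro: cg_add)

lemma exact_modI:
  assumes "\<And>i k. i < d \<Longrightarrow> k < m \<Longrightarrow> (\<Sum>j<n. M i j * N j k) \<doteq> 0"
    and "\<And>x. (\<And>j. x j \<in> T) \<Longrightarrow> (\<And>i. i < d \<Longrightarrow> dot n (M i) x \<doteq> 0) \<Longrightarrow>
      \<exists>y. (\<forall>k. y k \<in> T) \<and> (\<forall>j<n. x j \<doteq> dot m (N j) y)"
  shows "exact_mod T J d n m M N"
  using assms unfolding exact_mod_def cg_def by simp

lemma exact_mod_zero:
  assumes "exact_mod T J d n m M N" "i < d" "k < m"
  shows "(\<Sum>j<n. M i j * N j k) \<doteq> 0"
  using assms unfolding exact_mod_def cg_def by simp

lemma exact_mod_lift:
  assumes "exact_mod T J d n m M N" "\<And>j. x j \<in> T" "\<And>i. i < d \<Longrightarrow> dot n (M i) x \<doteq> 0"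
  shows "\<exists>y. (\<forall>k. y k \<in> T) \<and> (\<forall>j<n. x j \<doteq> dot m (N j) y)"
  using assms unfolding exact_mod_def cg_def by simp

lemma extension_modI:
  assumes "\<And>\<phi>. (\<And>k. \<phi> k \<in> T) \<Longrightarrow>
      (\<And>y. (\<And>k. y k \<in> T) \<Longrightarrow> (\<And>j. j < n \<Longrightarrow> dot m (K j) y \<doteq> 0) \<Longrightarrow> dot m \<phi> y \<doteq> 0) \<Longrightarrow>
      \<exists>v. (\<forall>j. v j \<in> T) \<and> (\<forall>k<m. \<phi> k \<doteq> (\<Sum>j<n. v j * K j k))"
  shows "extension_mod T J n m K"
  using assms unfolding extension_mod_def cg_def by simp

lemma extension_modE:
  assumes "extension_mod T J n m K" "\<And>k. \<phi> k \<in> T"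
    "\<And>y. (\<And>k. y k \<in> T) \<Longrightarrow> (\<And>j. j < n \<Longrightarrow> dot m (K j) y \<doteq> 0) \<Longrightarrow> dot m \<phi> y \<doteq> 0"
  shows "\<exists>v. (\<forall>j. v j \<in> T) \<and> (\<forall>k<m. \<phi> k \<doteq> (\<Sum>j<n. v j * K j k))"
  using assms unfolding extension_mod_def cg_def by simp

lemma kernel_duality_modE:
  assumes "kernel_duality_mod T J" "\<And>i j. C i j \<in> T"
  shows "\<exists>m K. (\<forall>j k. K j k \<in> T) \<and> exact_mod T J d n m C K \<and> extension_mod T J n m K"
  using assms unfolding kernel_duality_mod_def by blast

lemma sum_mult_cg_swap:
  assumes "\<And>j. j < n \<Longrightarrow> x j \<doteq> dot m (N j) y"
  shows "dot n r x \<doteq> (\<Sum>k<m. (\<Sum>j<n. r j * N j k) * y k)"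
proof -
  have "dot n r x \<doteq> (\<Sum>j<n. r j * dot m (N j) y)"
    by (intro cg_sum cg_mult_left) (use assms in auto)
  also have "(\<Sum>j<n. r j * dot m (N j) y) = (\<Sum>k<m. (\<Sum>j<n. r j * N j k) * y k)"
    by (simp add: sum_distrib_left sum_distrib_right mult.assoc) (rule sum.swap)
  finally show ?thesis .
qed

text \<open>The second syzygies witness that a functional vanishes on the whole kernel of \<open>K\<close> by finitely many
  equations, which survive base change.\<close>

lemma kernel_duality_mod_syzygies:
  assumes T: "subring_set T" and kd: "kernel_duality_mod T J" and C: "\<And>i j. C i j \<in> T"
  shows "\<exists>m K l A. (\<forall>j k. K j k \<in> T) \<and> (\<forall>j k. A j k \<in> T) \<and> exact_mod T J d n m C K \<and>
    exact_mod T J n m l K A \<and> exact_mod T J l m n (\<lambda>i j. A j i) (\<lambda>i j. K j i)"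
proof -
  note T = subring_setD[OF T]
  obtain m K where K: "\<forall>j k. K j k \<in> T" "exact_mod T J d n m C K" and dual: "extension_mod T J n m K"
    using kernel_duality_modE[OF kd, of C d n, OF C] by blast
  obtain l A where A: "\<forall>j k. A j k \<in> T" "exact_mod T J n m l K A"
    using kernel_duality_modE[OF kd, of K n m, OF K(1)[rule_format]] by blast
  have "exact_mod T J l m n (\<lambda>i j. A j i) (\<lambda>i j. K j i)"
  proof (rule exact_modI)
    fix i k assume "i < l" "k < n"
    then show "(\<Sum>j<m. A j i * K k j) \<doteq> 0"
      using exact_mod_zero[OF A(2), of k i] by (simp add: mult.commute)
  next
    fix \<phi> assume \<phi>: "\<And>j. \<phi> j \<in> T" "\<And>i. i < l \<Longrightarrow> (\<Sum>j<m. A j i * \<phi> j) \<doteq> 0"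
    have "\<exists>v. (\<forall>j. v j \<in> T) \<and> (\<forall>k<m. \<phi> k \<doteq> (\<Sum>j<n. v j * K j k))"
    proof (rule extension_modE[OF dual, of \<phi>, OF \<phi>(1)])
      fix y assume y: "\<And>k. y k \<in> T" "\<And>j. j < n \<Longrightarrow> dot m (K j) y \<doteq> 0"
      obtain w where w: "\<And>k. w k \<in> T" "\<And>j. j < m \<Longrightarrow> y j \<doteq> dot l (A j) w"
        using exact_mod_lift[OF A(2), of y, OF y] by blast
      \<comment> \<open>On the kernel of \<open>K\<close> the vector \<open>y\<close> is congruent
        to \<open>A w\<close>, and the row \<open>\<phi>\<close> is killed by
        \<open>A\<close>.\<close>
      have "dot m \<phi> y \<doteq> (\<Sum>k<l. (\<Sum>j<m. \<phi> j * A j k) * w k)"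
        by (rule sum_mult_cg_swap) (rule w)
      also have "\<dots> \<doteq> (\<Sum>k<l. 0 * w k)"
        by (intro cg_sum cg_mult_right) (use \<phi>(2) in \<open>simp add: mult.commute\<close>)
      finally show "dot m \<phi> y \<doteq> 0" by simp
    qed
    then show "\<exists>y. (\<forall>k. y k \<in> T) \<and> (\<forall>j<m. \<phi> j \<doteq> (\<Sum>k<n. K k j * y k))"
      by (simp add: mult.commute)
  qed
  with K A show ?thesis by blast
qed

text \<open>The way back from exactness to extension: the columns of \<open>A\<close> lie in the
  kernel of \<open>K\<close>, so a functional vanishing there is killed by \<open>A\<close>, and
  exactness of the transposed pair writes it as \<open>v K\<close>.\<close>

lemma extension_modI_syzygies:
  assumes A: "\<And>j k. A j k \<in> T" and KA: "exact_mod T J n m l K A"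
    and dual: "exact_mod T J l m n (\<lambda>i j. A j i) (\<lambda>i j. K j i)"
  shows "extension_mod T J n m K"
proof (rule extension_modI)
  fix \<phi> assume \<phi>: "\<And>k. \<phi> k \<in> T"
    and van: "\<And>y. (\<And>k. y k \<in> T) \<Longrightarrow> (\<And>j. j < n \<Longrightarrow> dot m (K j) y \<doteq> 0) \<Longrightarrow> dot m \<phi> y \<doteq> 0"
  have z: "(\<Sum>j<m. A j i * \<phi> j) \<doteq> 0" if "i < l" for i
    using van[of "\<lambda>j. A j i"] A exact_mod_zero[OF KA _ that] by (simp add: mult.commute)
  obtain v where "\<forall>k. v k \<in> T" "\<forall>j<m. \<phi> j \<doteq> (\<Sum>k<n. K k j * v k)"
    using exact_mod_lift[OF dual, of \<phi>, OF \<phi> z] by blast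
  then show "\<exists>v. (\<forall>j. v j \<in> T) \<and> (\<forall>k<m. \<phi> k \<doteq> (\<Sum>j<n. v j * K j k))" by (auto simp: mult.commute)
qed

end

section \<open>Adjoining one square root\<close>

text \<open>A ring \<open>T'\<close> that is, modulo \<open>J\<close>, free over \<open>T\<close> with basis \<open>1, b\<close>, where \<open>b\<^sup>2 = c\<close>.\<close>

locale square_root_extension = ideal_mod J for J :: "'a::comm_ring_1 set" +
  fixes T T' :: "'a set" and b c :: 'a
  assumes T: "subring_set T" and T': "subring_set T'" and TT': "T \<subseteq> T'"
    and b: "b \<in> T'" and c: "c \<in> T" and bb: "b * b - c \<in> J"
    and decomp: "p \<in> T' \<Longrightarrow> \<exists>u\<in>T. \<exists>v\<in>T. p - (u + v * b) \<in> J"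
    and indep: "u \<in> T \<Longrightarrow> v \<in> T \<Longrightarrow> u + v * b \<in> J \<Longrightarrow> u \<in> J \<and> v \<in> J"
begin

lemma bb': "b * b \<doteq> c"
  using bb by (simp add: cg_def)

lemma indep': 
  assumes "u \<in> T" "v \<in> T" "u + v * b \<doteq> 0" shows "u \<doteq> 0" "v \<doteq> 0"
  using indep[of u v] assms by (simp_all add: cg_def)

lemma decomp_fun:
  assumes "\<And>j. x j \<in> T'"
  shows "\<exists>u v. (\<forall>j. u j \<in> T) \<and> (\<forall>j. v j \<in> T) \<and> (\<forall>j. x j \<doteq> u j + v j * b)"
proof -
  have "\<forall>j. \<exists>u v. u \<in> T \<and> v \<in> T \<and> x j \<doteq> u + v * b"
    using decomp assms unfolding cg_def by blast
  then show ?thesis by metis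
qed

lemma decomp_mat:
  assumes "\<And>i j. x i j \<in> T'"
  shows "\<exists>u v. (\<forall>i j. u i j \<in> T) \<and> (\<forall>i j. v i j \<in> T) \<and> (\<forall>i j. x i j \<doteq> u i j + v i j * b)"
proof -
  have "\<forall>i j. \<exists>u v. u \<in> T \<and> v \<in> T \<and> x i j \<doteq> u + v * b"
    using decomp assms unfolding cg_def by blast
  then show ?thesis by metis
qed

lemma sum_closed: "(\<And>i. i \<in> I \<Longrightarrow> f i \<in> T) \<Longrightarrow> sum f I \<in> T"
  by (induction I rule: infinite_finite_induct) (auto intro: subring_setD[OF T])

lemma mult_cg:
  "(p + q * b) * (u + v * b) \<doteq> (p * u + c * q * v) + (q * u + p * v) * b"
proof -
  have "(p + q * b) * (u + v * b) = p * u + q * v * (b * b) + (q * u + p * v) * b"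
    by (simp add: algebra_simps)
  also have "\<dots> \<doteq> p * u + q * v * c + (q * u + p * v) * b"
    by (intro cg_add cg_mult_left bb' cg_refl)
  finally show ?thesis by (simp add: ac_simps)
qed

lemma sum_mult_cg:
  assumes "\<And>j. j < n \<Longrightarrow> f j \<doteq> p j + q j * b" "\<And>j. j < n \<Longrightarrow> g j \<doteq> u j + v j * b"
  shows "dot n f g \<doteq>
    (dot n p u + (\<Sum>j<n. c * q j * v j)) + (dot n q u + dot n p v) * b"
proof -
  have "dot n f g \<doteq> (\<Sum>j<n. (p j * u j + c * q j * v j) + (q j * u j + p j * v j) * b)"
    by (rule cg_sum, rule cg_trans[OF cg_mult mult_cg]) (use assms in auto)
  also have "\<dots> = (dot n p u + (\<Sum>j<n. c * q j * v j)) + (dot n q u + dot n p v) * b"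
    by (simp add: sum.distrib sum_distrib_left sum_distrib_right algebra_simps)
  finally show ?thesis .
qed

lemma sum_mult_cg':
  assumes "\<And>j. j < n \<Longrightarrow> g j \<doteq> u j + v j * b"
  shows "dot n p g \<doteq> dot n p u + dot n p v * b"
  using sum_mult_cg[of n p p "\<lambda>_. 0" g u v] assms by simp

text \<open>Over \<open>T'\<close> a vector is a pair of vectors over \<open>T\<close>, its
  components at 1 and at \<open>b\<close>. Since the entries of \<open>M\<close> lie in
  \<open>T\<close>, the equations hold for each component separately, and the two lifts can be
  combined.\<close>

lemma exact_mod_extend:
  assumes M: "\<And>i j. M i j \<in> T" and ex: "exact_mod T J d n m M N"
  shows "exact_mod T' J d n m M N"
proof (rule exact_modI)
  fix x assume x: "\<And>j. x j \<in> T'" "\<And>i. i < d \<Longrightarrow> dot n (M i) x \<doteq> 0"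
  obtain u v where uv: "\<And>j. u j \<in> T" "\<And>j. v j \<in> T" "\<And>j. x j \<doteq> u j + v j * b"
    using decomp_fun[of x, OF x(1)] by blast
  have "dot n (M i) u + dot n (M i) v * b \<doteq> 0" if "i < d" for i
    using cg_trans[OF cg_sym[OF sum_mult_cg'[of n x u v "M i"]] x(2)[OF that]] uv(3) by simp
  then have z: "dot n (M i) u \<doteq> 0" "dot n (M i) v \<doteq> 0" if "i < d" for i
    by (rule indep'[rotated 2]; use that M uv in \<open>auto intro!: sum_closed subring_setD(4)[OF T]\<close>)+
  obtain y where y: "\<And>k. y k \<in> T" "\<And>j. j < n \<Longrightarrow> u j \<doteq> dot m (N j) y"
    using exact_mod_lift[OF ex, of u, OF uv(1) z(1)] by blast
  obtain w where w: "\<And>k. w k \<in> T" "\<And>j. j < n \<Longrightarrow> v j \<doteq> dot m (N j) w"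
    using exact_mod_lift[OF ex, of v, OF uv(2) z(2)] by blast
  show "\<exists>y. (\<forall>k. y k \<in> T') \<and> (\<forall>j<n. x j \<doteq> dot m (N j) y)"
  proof (intro exI[of _ "\<lambda>k. y k + w k * b"] conjI allI impI)
    show "y k + w k * b \<in> T'" for k
      using y(1) w(1) TT' b by (intro subring_setD[OF T']) auto
    fix j assume j: "j < n"
    have "x j \<doteq> u j + v j * b" by (rule uv)
    also have "\<dots> \<doteq> dot m (N j) y + dot m (N j) w * b"
      by (intro cg_add cg_mult_right y(2) w(2) j)
    also have "\<dots> = (\<Sum>k<m. N j k * (y k + w k * b))"
      by (simp add: sum.distrib sum_distrib_left sum_distrib_right algebra_simps)
    finally show "x j \<doteq> (\<Sum>k<m. N j k * (y k + w k * b))" .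
  qed
qed (rule exact_mod_zero[OF ex])

text \<open>Restriction of scalars: a \<open>d \<times> n\<close> matrix over \<open>T'\<close> becomes a \<open>2d \<times> 2n\<close> matrix over \<open>T\<close>. A functional
  into \<open>T' = T \<oplus> T b\<close> is determined by its \<open>b\<close>-component, a functional into \<open>T\<close>.\<close>

lemma kernel_duality_mod_extend:
  assumes kd: "kernel_duality_mod T J"
  shows "kernel_duality_mod T' J"
  unfolding kernel_duality_mod_def
proof (intro allI impI)
  note TD = subring_setD[OF T] and TD' = subring_setD[OF T']
  fix d n and C :: "nat \<Rightarrow> nat \<Rightarrow> 'a" assume "\<forall>i j. C i j \<in> T'"
  then have C: "\<And>i j. C i j \<in> T'" by blast
  obtain C0 C1 where CC: "\<And>i j. C0 i j \<in> T" "\<And>i j. C1 i j \<in> T" "\<And>i j. C i j \<doteq> C0 i j + C1 i j * b"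
    using decomp_mat[of C, OF C] by blast
  \<comment> \<open>The matrix of \<open>C0 + C1 b\<close> acting on pairs \<open>(u, v)\<close>
    that stand for \<open>u + v b\<close>: the first block of rows gives
    \<open>C0 u + c C1 v\<close>, the second gives \<open>C1 u + C0 v\<close>.\<close>
  define D where "D i j = (if i < d then (if j < n then C0 i j else c * C1 i (j - n))
     else (if j < n then C1 (i - d) j else C0 (i - d) (j - n)))" for i j
  have D: "D i j \<in> T" for i j
    unfolding D_def using CC c by (auto intro: TD)
  have D1: "dot (n+n) (D i) x = dot n (C0 i) x + (\<Sum>j<n. c * C1 i j * x (n + j))"
    if "i < d" for i x
    using that by (simp add: sum_lessThan_add D_def)
  have D2: "(\<Sum>j<n+n. D (d + i) j * x j) = dot n (C1 i) x + (\<Sum>j<n. C0 i j * x (n + j))" for i x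
    by (simp add: sum_lessThan_add D_def)
  obtain m H where H: "\<And>j k. H j k \<in> T" and ex: "exact_mod T J (d+d) (n+n) m D H"
    and dual: "extension_mod T J (n+n) m H"
    using kernel_duality_modE[OF kd, of D "d + d" "n + n", OF D] by blast
  \<comment> \<open>Each column of \<open>H\<close> is a pair over \<open>T\<close>;
    \<open>K\<close> reads it as a vector over \<open>T'\<close>.\<close>
  define K where "K j k = H j k + H (n + j) k * b" for j k
  have K: "K j k \<in> T'" for j k
    unfolding K_def using H TT' b by (auto intro!: TD')
  have DH1: "(\<Sum>j<n. C0 i j * H j k) + (\<Sum>j<n. c * C1 i j * H (n + j) k) \<doteq> 0" 
    and DH2: "(\<Sum>j<n. C1 i j * H j k) + (\<Sum>j<n. C0 i j * H (n + j) k) \<doteq> 0" if "i < d" "k < m" for i k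
    using exact_mod_zero[OF ex, of i k] exact_mod_zero[OF ex, of "d + i" k] that
      D1[of i "\<lambda>j. H j k"] D2[of i "\<lambda>j. H j k"] by auto
  \<comment> \<open>Exactness of \<open>D\<close> and \<open>H\<close> in terms of the two halves
    \<open>u\<close> and \<open>v\<close>. It is needed twice: for the kernel of \<open>C\<close>,
    and for \<open>b\<close> times a column of \<open>K\<close>.\<close>
  have lift: "\<exists>y. (\<forall>k. y k \<in> T) \<and> (\<forall>j<n. u j \<doteq> dot m (H j) y) \<and> (\<forall>j<n. v j \<doteq> (\<Sum>k<m. H (n+j) k * y k))"
    if uv: "\<And>j. u j \<in> T" "\<And>j. v j \<in> T"
     and z1: "\<And>i. i < d \<Longrightarrow> dot n (C0 i) u + (\<Sum>j<n. c * C1 i j * v j) \<doteq> 0"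
     and z2: "\<And>i. i < d \<Longrightarrow> dot n (C1 i) u + dot n (C0 i) v \<doteq> 0" for u v
  proof -
    define x where "x j = (if j < n then u j else v (j - n))" for j
    have x: "x j \<in> T" for j using uv by (simp add: x_def)
    have "dot (n+n) (D i) x \<doteq> 0" if "i < d + d" for i
    proof (cases "i < d")
      case True
      with z1[OF True] D1[OF True, of x] show ?thesis by (simp add: x_def)
    next
      case False
      with that z2[of "i - d"] D2[of "i - d" x] show ?thesis by (simp add: x_def)
    qed
    then obtain y where y: "\<And>k. y k \<in> T" "\<And>j. j < n + n \<Longrightarrow> x j \<doteq> dot m (H j) y"
      using exact_mod_lift[OF ex, of x, OF x] by blast
    have "u j \<doteq> dot m (H j) y" "v j \<doteq> (\<Sum>k<m. H (n+j) k * y k)" if "j < n" for j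
      using y(2)[of j] y(2)[of "n + j"] that by (simp_all add: x_def)
    with y(1) show ?thesis by blast
  qed
  have exK: "exact_mod T' J d n m C K"
  proof (rule exact_modI)
    fix i k assume ik: "i < d" "k < m"
    have "(\<Sum>j<n. C i j * K j k) \<doteq> ((\<Sum>j<n. C0 i j * H j k) + (\<Sum>j<n. c * C1 i j * H (n+j) k)) +
       ((\<Sum>j<n. C1 i j * H j k) + (\<Sum>j<n. C0 i j * H (n+j) k)) * b"
      by (rule sum_mult_cg) (simp_all add: K_def CC)
    also have "\<dots> \<doteq> 0 + 0 * b"
      by (intro cg_add cg_mult_right DH1 DH2 ik)
    finally show "(\<Sum>j<n. C i j * K j k) \<doteq> 0" by simp
  next
    fix x assume x: "\<And>j. x j \<in> T'" "\<And>i. i < d \<Longrightarrow> dot n (C i) x \<doteq> 0"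
    obtain u v where uv: "\<And>j. u j \<in> T" "\<And>j. v j \<in> T" "\<And>j. x j \<doteq> u j + v j * b"
      using decomp_fun[of x, OF x(1)] by blast
    have "(dot n (C0 i) u + (\<Sum>j<n. c * C1 i j * v j)) + (dot n (C1 i) u + dot n (C0 i) v) * b \<doteq> 0"
      if "i < d" for i
      using cg_trans[OF cg_sym[OF sum_mult_cg[of n "C i" "C0 i" "C1 i" x u v]] x(2)[OF that]] CC(3) uv(3) by simp
    then have z: "dot n (C0 i) u + (\<Sum>j<n. c * C1 i j * v j) \<doteq> 0"
      "dot n (C1 i) u + dot n (C0 i) v \<doteq> 0" if "i < d" for i
      by (rule indep'[rotated 2]; use that CC uv c in \<open>auto intro!: TD sum_closed\<close>)+
    obtain y where y: "\<And>k. y k \<in> T" "\<And>j. j < n \<Longrightarrow> u j \<doteq> dot m (H j) y"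
      "\<And>j. j < n \<Longrightarrow> v j \<doteq> (\<Sum>k<m. H (n+j) k * y k)"
      using lift[of u v, OF uv(1,2) z] by blast
    show "\<exists>y. (\<forall>k. y k \<in> T') \<and> (\<forall>j<n. x j \<doteq> dot m (K j) y)"
    proof (intro exI[of _ y] conjI allI impI)
      fix j assume j: "j < n"
      have "x j \<doteq> u j + v j * b" by (rule uv)
      also have "\<dots> \<doteq> dot m (H j) y + (\<Sum>k<m. H (n+j) k * y k) * b"
        by (intro cg_add cg_mult_right y(2,3) j)
      also have "\<dots> = dot m (K j) y"
        by (simp add: K_def sum.distrib sum_distrib_left sum_distrib_right algebra_simps)
      finally show "x j \<doteq> dot m (K j) y" .
    qed (use y TT' in auto)
  qed
  have "extension_mod T' J n m K"
  proof (rule extension_modI)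
    fix \<phi> assume \<phi>: "\<And>k. \<phi> k \<in> T'"
      and van: "\<And>y. (\<And>k. y k \<in> T') \<Longrightarrow> (\<And>j. j < n \<Longrightarrow> dot m (K j) y \<doteq> 0) \<Longrightarrow> dot m \<phi> y \<doteq> 0"
    obtain f g where fg: "\<And>j. f j \<in> T" "\<And>j. g j \<in> T" "\<And>j. \<phi> j \<doteq> f j + g j * b"
      using decomp_fun[of \<phi>, OF \<phi>] by blast
    have \<phi>y: "dot m \<phi> y \<doteq> dot m f y + dot m g y * b" for y
      using sum_mult_cg[of m \<phi> f g y y "\<lambda>_. 0"] fg by simp
    have Ky: "dot m (K j) y = dot m (H j) y + (\<Sum>k<m. H (n+j) k * y k) * b" for j y
      by (simp add: K_def sum.distrib sum_distrib_left sum_distrib_right algebra_simps)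
    \<comment> \<open>The b-component \<open>g\<close> vanishes on the kernel of \<open>H\<close>
      over \<open>T\<close>: there \<open>K y\<close> is 0, hence so is \<open>\<phi> y\<close>, and
      independence of 1 and \<open>b\<close> gives \<open>g y = 0\<close>.\<close>
    have "\<exists>v. (\<forall>j. v j \<in> T) \<and> (\<forall>k<m. g k \<doteq> (\<Sum>j<n+n. v j * H j k))"
    proof (rule extension_modE[OF dual, of g, OF fg(2)])
      fix y assume y: "\<And>k. y k \<in> T" "\<And>j. j < n+n \<Longrightarrow> dot m (H j) y \<doteq> 0"
      have "dot m (K j) y \<doteq> 0" if "j < n" for j
        using cg_add[OF y(2)[of j] cg_mult_right[OF y(2)[of "n + j"], of b]] that by (simp add: Ky)
      then have "dot m \<phi> y \<doteq> 0"
        using van[of y] y(1) TT' by blast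
      then have "dot m f y + dot m g y * b \<doteq> 0"
        using cg_trans[OF cg_sym[OF \<phi>y]] by blast
      then show "dot m g y \<doteq> 0"
        by (rule indep'(2)[rotated 2]) (auto intro!: TD sum_closed fg y)
    qed
    then obtain v where v: "\<And>j. v j \<in> T" "\<And>k. k < m \<Longrightarrow> g k \<doteq> (\<Sum>j<n+n. v j * H j k)" by blast
    \<comment> \<open>The b-component of \<open>(w0 + w1 b) (u + u' b)\<close> is
      \<open>w1 u + w0 u'\<close>. So the half of \<open>v\<close> that pairs with the upper rows of
      \<open>H\<close> becomes the coefficient of \<open>b\<close>, and the other half the constant
      term.\<close>
    define w where "w j = v (n + j) + v j * b" for j
    have w: "w j \<in> T'" for j
      unfolding w_def using v TT' b by (auto intro!: TD')
    have "\<phi> k \<doteq> (\<Sum>j<n. w j * K j k)" if k: "k < m" for k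
    proof -
      \<comment> \<open>Multiplied by \<open>b\<close>, column \<open>k\<close> of \<open>K\<close>
        has the components \<open>c * H (n + j) k\<close> and \<open>H j k\<close>. It is again in
        the kernel of \<open>C\<close>, hence a combination of the columns with coefficients
        \<open>y\<close> in \<open>T\<close>.\<close>
      have "\<exists>y. (\<forall>k. y k \<in> T) \<and> (\<forall>j<n. c * H (n+j) k \<doteq> dot m (H j) y) \<and> (\<forall>j<n. H j k \<doteq> (\<Sum>l<m. H (n+j) l * y l))"
      proof (rule lift)
        fix i assume i: "i < d"
        show "(\<Sum>j<n. C1 i j * (c * H (n + j) k)) + (\<Sum>j<n. C0 i j * H j k) \<doteq> 0"
          using DH1[OF i k] by (simp add: ac_simps)
        show "(\<Sum>j<n. C0 i j * (c * H (n + j) k)) + (\<Sum>j<n. c * C1 i j * H j k) \<doteq> 0"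
          using cg_mult_left[OF DH2[OF i k], of c] by (simp add: distrib_left sum_distrib_left ac_simps)
      qed (auto intro!: TD c H)
      then obtain y where y: "\<And>k. y k \<in> T" "\<And>j. j < n \<Longrightarrow> c * H (n+j) k \<doteq> dot m (H j) y"
        "\<And>j. j < n \<Longrightarrow> H j k \<doteq> (\<Sum>l<m. H (n+j) l * y l)" by blast
      \<comment> \<open>The vector \<open>b e_k - y\<close>, a relation between the columns of
        \<open>K\<close> over \<open>T'\<close>. Applying \<open>\<phi>\<close> to it expresses that
        \<open>\<phi>\<close> is compatible with multiplication by \<open>b\<close>.\<close>
      define e where "e l = (if l = k then b else 0) - y l" for l
      have e: "e l \<in> T'" for l
        unfolding e_def using y(1) TT' b by (auto intro!: TD' subring_setD(1)[OF T'])
      have se: "dot m h e = h k * b - dot m h y" for h :: "nat \<Rightarrow> 'a"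
      proof -
        have "h l * e l = (if l = k then h k * b else 0) - h l * y l" for l
          by (simp add: e_def right_diff_distrib)
        then show ?thesis using k by (simp add: sum_subtractf)
      qed
      have "dot m (K j) e \<doteq> 0" if j: "j < n" for j
      proof -
        have "K j k * b = H j k * b + H (n+j) k * (b * b)"
          by (simp add: K_def algebra_simps)
        also have "\<dots> \<doteq> H j k * b + H (n+j) k * c"
          by (intro cg_add cg_mult_left bb' cg_refl)
        also have "\<dots> = c * H (n+j) k + H j k * b" by (simp add: ac_simps)
        also have "\<dots> \<doteq> dot m (H j) y + (\<Sum>l<m. H (n+j) l * y l) * b"
          by (intro cg_add cg_mult_right y j)
        also have "\<dots> = dot m (K j) y" by (simp add: Ky)
        finally show ?thesis unfolding se by (simp add: cg_def)
      qed
      then have "dot m \<phi> e \<doteq> 0" using van[of e] e by blast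
      then have 1: "\<phi> k * b \<doteq> dot m \<phi> y" unfolding se by (simp add: cg_def)
      have 2: "\<phi> k * b \<doteq> c * g k + f k * b"
      proof -
        have "\<phi> k * b \<doteq> (f k + g k * b) * b" by (intro cg_mult_right fg)
        also have "\<dots> = g k * (b * b) + f k * b" by (simp add: algebra_simps)
        also have "\<dots> \<doteq> g k * c + f k * b" by (intro cg_add cg_mult_left bb' cg_refl)
        finally show ?thesis by (simp add: mult.commute)
      qed
      have "c * g k + f k * b \<doteq> dot m f y + dot m g y * b"
        by (rule cg_trans[OF cg_sym[OF 2] cg_trans[OF 1 \<phi>y]])
      then have "(c * g k - dot m f y) + (f k - dot m g y) * b \<doteq> 0"
        by (simp add: cg_def algebra_simps)
      \<comment> \<open>Comparison of b-components: the constant term \<open>f k\<close> is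
        \<open>g\<close> applied to \<open>y\<close>, and thus determined by
        \<open>g\<close>.\<close>
      then have "f k - dot m g y \<doteq> 0"
        by (rule indep'(2)[rotated 2]) (auto intro!: TD sum_closed fg c y)
      then have "f k \<doteq> dot m g y" by (simp add: cg_def)
      also have "\<dots> \<doteq> (\<Sum>l<m. (\<Sum>j<n+n. v j * H j l) * y l)"
        by (intro cg_sum cg_mult_right v) simp
      also have "\<dots> = (\<Sum>j<n+n. v j * dot m (H j) y)"
        by (simp add: sum_distrib_left sum_distrib_right mult.assoc) (rule sum.swap)
      also have "\<dots> = (\<Sum>j<n. v j * dot m (H j) y) + (\<Sum>j<n. v (n+j) * (\<Sum>l<m. H (n+j) l * y l))"
        by (rule sum_lessThan_add)
      also have "\<dots> \<doteq> (\<Sum>j<n. v j * (c * H (n+j) k)) + (\<Sum>j<n. v (n+j) * H j k)"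
        by (intro cg_add cg_sum cg_mult_left) (auto intro: cg_sym y)
      finally have fk: "f k \<doteq> (\<Sum>j<n. v (n+j) * H j k) + (\<Sum>j<n. c * v j * H (n+j) k)"
        by (simp add: ac_simps)
      have "\<phi> k \<doteq> f k + g k * b" by (rule fg)
      also have "\<dots> \<doteq> ((\<Sum>j<n. v (n+j) * H j k) + (\<Sum>j<n. c * v j * H (n+j) k)) +
          ((\<Sum>j<n. v j * H j k) + (\<Sum>j<n. v (n+j) * H (n+j) k)) * b"
        using v(2)[OF k] by (intro cg_add[OF fk] cg_mult_right) (simp add: sum_lessThan_add)
      also have "\<dots> \<doteq> (\<Sum>j<n. w j * K j k)"
        by (rule cg_sym, rule sum_mult_cg) (simp_all add: w_def K_def)
      finally show ?thesis .
    qed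
    with w show "\<exists>v. (\<forall>j. v j \<in> T') \<and> (\<forall>k<m. \<phi> k \<doteq> (\<Sum>j<n. v j * K j k))" by blast
  qed
  with K exK show "\<exists>m K. (\<forall>j k. K j k \<in> T') \<and> exact_mod T' J d n m C K \<and> extension_mod T' J n m K"
    by blast
qed

end

section \<open>Bezout domains\<close>

text \<open>A common factor \<open>g\<close> with a unimodular vector of cofactors, rather than a
  gcd: the identity \<open>x y = 1\<close> is what later yields a projection. The alternative
  \<open>g = 0\<close> covers zero families and the empty one.\<close>

definition bezout_families :: "'r::idom itself \<Rightarrow> bool" where
  "bezout_families _ \<longleftrightarrow> (\<forall>n (a :: nat \<Rightarrow> 'r). \<exists>x y g. (\<forall>i<n. a i = g * y i) \<and>
      (g = 0 \<or> dot n x y = 1))"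

text \<open>\<open>P\<close> projects onto the kernel of \<open>C\<close>, which is thereby a direct
  summand. The rows are imposed one at a time: the new row restricted to the old kernel is
  \<open>a = C_d P\<close>, and with \<open>a = g y\<close> a correction of rank one along
  \<open>y\<close> removes it.\<close>

lemma kernel_projection:
  fixes C :: "nat \<Rightarrow> nat \<Rightarrow> 'r::idom"
  assumes bez: "bezout_families TYPE('r)"
  shows "\<exists>P. (\<forall>x. (\<forall>i<d. dot n (C i) x = 0) \<longrightarrow> (\<forall>j<n. dot n (P j) x = x j)) \<and>
    (\<forall>i<d. \<forall>k<n. (\<Sum>j<n. C i j * P j k) = 0)"
proof (induction d)
  case 0
  have "(\<Sum>k<n. (if j = k then 1 else 0) * x k) = x j" if "j < n" for j and x :: "nat \<Rightarrow> 'r"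
    using that by (simp add: if_distrib[of "\<lambda>a. a * _"] cong: if_cong)
  then show ?case by (intro exI[of _ "\<lambda>j k. if j = k then 1 else 0"]) simp
next
  case (Suc d)
  then obtain P where P1: "\<And>x j. (\<forall>i<d. dot n (C i) x = 0) \<Longrightarrow> j < n \<Longrightarrow> dot n (P j) x = x j"
    and P2: "\<And>i k. i < d \<Longrightarrow> k < n \<Longrightarrow> (\<Sum>j<n. C i j * P j k) = 0" by blast
  define a where "a k = (\<Sum>j<n. C d j * P j k)" for k
  obtain x y g where a: "\<And>i. i < n \<Longrightarrow> a i = g * y i" and g: "g = 0 \<or> dot n x y = 1"
    using bez[unfolded bezout_families_def, THEN spec, THEN spec, of n a] by blast
  have swap: "(\<Sum>j<n. C i j * dot n (P j) z) = (\<Sum>k<n. (\<Sum>j<n. C i j * P j k) * z k)" for i z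
    by (simp add: sum_distrib_left sum_distrib_right mult.assoc) (rule sum.swap)
  show ?case
  proof (cases "g = 0")
    case True
    then have "(\<Sum>j<n. C d j * P j k) = 0" if "k < n" for k
      using a[OF that] by (simp add: a_def)
    then show ?thesis
      using P1 P2 by (intro exI[of _ P]) (auto simp: less_Suc_eq)
  next
    case False
    then have xy: "dot n x y = 1" using g by simp
    \<comment> \<open>\<open>w = P x\<close> is killed by the old rows, and the new row takes on it
      the value \<open>g (x y) = g\<close>. Hence subtracting \<open>w y\<close> from
      \<open>P\<close> turns the new row \<open>a\<close> of the product into
      \<open>a - g y = 0\<close>. On the new kernel \<open>g (y z) = 0\<close>, so
      \<open>y z = 0\<close> in a domain and nothing changes.\<close>
    define w where "w j = dot n (P j) x" for j
    define Q where "Q j k = P j k - w j * y k" for j k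
    show ?thesis
    proof (intro exI[of _ Q] conjI allI impI)
      fix z j assume z: "\<forall>i<Suc d. dot n (C i) z = 0" and j: "j < n"
      have Pz: "dot n (P j) z = z j" if "j < n" for j
        by (rule P1) (use z that in auto)
      have "g * dot n y z = dot n a z"
        by (simp add: a sum_distrib_left mult.assoc)
      also have "\<dots> = (\<Sum>j<n. C d j * dot n (P j) z)"
        unfolding a_def swap ..
      also have "\<dots> = 0" using z Pz by simp
      finally have yz: "dot n y z = 0" using False by simp
      have "dot n (Q j) z = dot n (P j) z - w j * dot n y z"
        by (simp add: Q_def left_diff_distrib sum_subtractf sum_distrib_left mult.assoc)
      then show "dot n (Q j) z = z j" using yz Pz[OF j] by simp
    next
      fix i k assume i: "i < Suc d" and k: "k < n"
      have "dot n (C i) w = (\<Sum>l<n. (\<Sum>j<n. C i j * P j l) * x l)"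
        unfolding w_def swap ..
      also have "\<dots> = (if i < d then 0 else g)"
      proof (cases "i < d")
        case False
        with i have "i = d" by simp
        then have "(\<Sum>l<n. (\<Sum>j<n. C i j * P j l) * x l) = (\<Sum>l<n. g * (x l * y l))"
          by (intro sum.cong) (auto simp: a_def[symmetric] a)
        with False xy show ?thesis by (simp add: sum_distrib_left[symmetric])
      qed (simp add: P2)
      finally have "dot n (C i) w = (if i < d then 0 else g)" .
      moreover have "(\<Sum>j<n. C i j * Q j k) = (\<Sum>j<n. C i j * P j k) - dot n (C i) w * y k"
        by (simp add: Q_def right_diff_distrib sum_subtractf sum_distrib_right mult.assoc)
      ultimately show "(\<Sum>j<n. C i j * Q j k) = 0"
        using i k a[OF k] P2[of i k] by (auto simp: less_Suc_eq a_def)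
    qed
  qed
qed

context ideal_mod
begin

text \<open>The hypotheses on \<open>h\<close> make \<open>range h\<close> modulo \<open>J\<close> a
  copy of the domain. The projection \<open>P\<close> serves as kernel matrix, and each functional
  \<open>\<psi>\<close> vanishing on the kernel of \<open>P\<close> is its own extension, because
  \<open>\<psi> = \<psi> P\<close>.\<close>

lemma kernel_duality_mod_bezout:
  fixes h :: "'r::idom \<Rightarrow> 'a"
  assumes bez: "bezout_families TYPE('r)"
    and h0: "h 0 = 0" and hadd: "\<And>a b. h (a + b) = h a + h b" and hmult: "\<And>a b. h (a * b) = h a * h b"
    and hJ: "\<And>a. h a \<in> J \<Longrightarrow> a = 0"
  shows "kernel_duality_mod (range h) J"
  unfolding kernel_duality_mod_def
proof (intro allI impI)
  have hsum: "h (sum f A) = (\<Sum>i\<in>A. h (f i))" for f :: "nat \<Rightarrow> 'r" and A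
    by (induction A rule: infinite_finite_induct) (simp_all add: h0 hadd)
  have hz: "a = 0" if "h a \<doteq> 0" for a using that hJ by (simp add: cg_def)
  fix d n and C' :: "nat \<Rightarrow> nat \<Rightarrow> 'a" assume "\<forall>i j. C' i j \<in> range h"
  then have "\<forall>i j. \<exists>r. C' i j = h r" by auto
  then obtain C where C: "C' = (\<lambda>i j. h (C i j))" by metis
  obtain P where P1: "\<And>x j. (\<And>i. i < d \<Longrightarrow> dot n (C i) x = 0) \<Longrightarrow> j < n \<Longrightarrow> dot n (P j) x = x j"
    and P2: "\<And>i k. i < d \<Longrightarrow> k < n \<Longrightarrow> (\<Sum>j<n. C i j * P j k) = 0"
    using kernel_projection[OF bez, where d = d and n = n and C = C] by blast
  have repr: "\<exists>x'. x = (\<lambda>j. h (x' j))" if "\<And>j. x j \<in> range h" for x :: "nat \<Rightarrow> 'a"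
  proof -
    have "\<forall>j. \<exists>r. x j = h r" using that by auto
    then show ?thesis by metis
  qed
  have "exact_mod (range h) J d n n C' (\<lambda>j k. h (P j k))"
  proof (rule exact_modI)
    show "(\<Sum>j<n. C' i j * h (P j k)) \<doteq> 0" if "i < d" "k < n" for i k
      using P2[OF that] unfolding C by (simp flip: hmult hsum add: h0)
    fix x assume "\<And>j. x j \<in> range h" and z: "\<And>i. i < d \<Longrightarrow> dot n (C' i) x \<doteq> 0"
    then obtain x' where x: "x = (\<lambda>j. h (x' j))" using repr by metis
    have "dot n (C i) x' = 0" if "i < d" for i
      using z[OF that] unfolding C x by (simp flip: hmult hsum add: hz)
    then have "dot n (P j) x' = x' j" if "j < n" for j
      using P1 that by blast
    then show "\<exists>y. (\<forall>k. y k \<in> range h) \<and> (\<forall>j<n. x j \<doteq> (\<Sum>k<n. h (P j k) * y k))"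
      unfolding x by (intro exI[of _ "\<lambda>j. h (x' j)"]) (simp flip: hmult hsum)
  qed
  moreover have "extension_mod (range h) J n n (\<lambda>j k. h (P j k))"
  proof (rule extension_modI)
    fix \<phi> assume \<phi>: "\<And>k. \<phi> k \<in> range h" 
      and van: "\<And>y. (\<And>k. y k \<in> range h) \<Longrightarrow> (\<And>j. j < n \<Longrightarrow> (\<Sum>k<n. h (P j k) * y k) \<doteq> 0) \<Longrightarrow>
        dot n \<phi> y \<doteq> 0"
    then obtain \<psi> where \<psi>: "\<phi> = (\<lambda>j. h (\<psi> j))" using repr by metis
    have "\<psi> k = (\<Sum>j<n. \<psi> j * P j k)" if k: "k < n" for k
    proof -
      \<comment> \<open>Column \<open>k\<close> of the identity minus \<open>P\<close>. The column
        of \<open>P\<close> is in the kernel of \<open>C\<close>, hence fixed by \<open>P\<close>,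
        so \<open>P y = 0\<close> and \<open>\<psi> y = 0\<close>, which is the desired identity at
        \<open>k\<close>.\<close>
      define y where "y l = (if l = k then 1 else 0) - P l k" for l
      have sy: "dot n f y = f k - (\<Sum>l<n. f l * P l k)" for f :: "nat \<Rightarrow> 'r"
      proof -
        have "f l * y l = (if l = k then f k else 0) - f l * P l k" for l
          by (simp add: y_def right_diff_distrib)
        then show ?thesis using k by (simp add: sum_subtractf)
      qed
      have "dot n (P j) y = 0" if j: "j < n" for j
        unfolding sy using P1[of "\<lambda>l. P l k" j] P2 k j by simp
      then have "(\<Sum>l<n. \<phi> l * h (y l)) \<doteq> 0"
        by (intro van) (simp_all flip: hmult hsum add: h0)
      then have "dot n \<psi> y = 0"
        unfolding \<psi> by (simp flip: hmult hsum add: hz)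
      then show ?thesis unfolding sy by simp
    qed
    then show "\<exists>v. (\<forall>j. v j \<in> range h) \<and> (\<forall>k<n. \<phi> k \<doteq> (\<Sum>j<n. v j * h (P j k)))"
      unfolding \<psi> by (intro exI[of _ "\<lambda>j. h (\<psi> j)"]) (simp flip: hmult hsum)
  qed
  ultimately show "\<exists>m K. (\<forall>j k. K j k \<in> range h) \<and> exact_mod (range h) J d n m C' K \<and> extension_mod (range h) J n m K"
    by (intro exI[of _ n] exI[of _ "\<lambda>j k. h (P j k)"] conjI allI rangeI)
qed

end

section \<open>Directed unions\<close>

text \<open>The prescribed member \<open>W\<close> takes care of an empty \<open>A\<close> and
  allows the enclosing member to be chosen above a ring fixed earlier.\<close>

lemma finite_subset_directed_Union:
  assumes dir: "\<And>U Y. U \<in> S \<Longrightarrow> Y \<in> S \<Longrightarrow> \<exists>Z\<in>S. U \<union> Y \<subseteq> Z" and "finite A" "A \<subseteq> \<Union>S" "W \<in> S"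
  shows "\<exists>Z\<in>S. W \<subseteq> Z \<and> A \<subseteq> Z"
  using assms(2,3)
proof (induction A rule: finite_induct)
  case empty then show ?case using assms(4) by blast
next
  case (insert a A)
  then obtain Z U where "Z \<in> S" "W \<subseteq> Z" "A \<subseteq> Z" "U \<in> S" "a \<in> U" by auto
  then show ?case using dir[of Z U] by blast
qed

context ideal_mod
begin

lemma exact_mod_cong:
  assumes "\<And>i j. i < d \<Longrightarrow> j < n \<Longrightarrow> M i j = M' i j"
  shows "exact_mod T J d n m M N \<longleftrightarrow> exact_mod T J d n m M' N"
proof -
  have "dot n (M i) x = dot n (M' i) x" if "i < d" for i x
    by (intro sum.cong) (use assms that in auto)
  then show ?thesis unfolding exact_mod_def by (auto simp del: split_paired_All)
qed

text \<open>Only the entries of a vector below \<open>n\<close> count, and these finitely many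
  elements lie in a single member above \<open>U\<close>, where exactness is given.\<close>

lemma exact_mod_directed_Union:
  assumes dir: "\<And>U Y. U \<in> S \<Longrightarrow> Y \<in> S \<Longrightarrow> \<exists>Z\<in>S. U \<union> Y \<subseteq> Z"
    and zero: "\<And>U. U \<in> S \<Longrightarrow> 0 \<in> U"
    and ext: "\<And>Y. Y \<in> S \<Longrightarrow> U \<subseteq> Y \<Longrightarrow> exact_mod Y J d n m M N" and U: "U \<in> S"
  shows "exact_mod (\<Union>S) J d n m M N"
proof (rule exact_modI)
  show "(\<Sum>j<n. M i j * N j k) \<doteq> 0" if "i < d" "k < m" for i k
    using exact_mod_zero[OF ext[OF U order_refl] that] .
  fix x assume x: "\<And>j. x j \<in> \<Union>S" and z: "\<And>i. i < d \<Longrightarrow> dot n (M i) x \<doteq> 0"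
  have "x ` {..<n} \<subseteq> \<Union>S" using x by blast
  then obtain Z where Z: "Z \<in> S" "U \<subseteq> Z" "x ` {..<n} \<subseteq> Z"
    using finite_subset_directed_Union[of S "x ` {..<n}" U] dir U by auto
  \<comment> \<open>The entries from \<open>n\<close> on may lie outside \<open>Z\<close>, but
    \<open>exact_mod\<close> asks for all of them; they are replaced by 0.\<close>
  define x' where "x' j = (if j < n then x j else 0)" for j
  have x': "x' j \<in> Z" for j using Z zero by (auto simp: x'_def)
  have z': "dot n (M i) x' \<doteq> 0" if "i < d" for i
    using z[OF that] by (simp add: x'_def)
  show "\<exists>y. (\<forall>k. y k \<in> \<Union>S) \<and> (\<forall>j<n. x j \<doteq> dot m (N j) y)"
    using exact_mod_lift[OF ext[OF Z(1,2)], of x', OF x' z'] Z(1) by (auto simp: x'_def)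
qed

text \<open>The matrix \<open>C\<close> lives in one member \<open>U\<close>. The kernel matrix and
  second syzygies found over \<open>U\<close> serve for the whole union, because the three exactness
  statements pass to every larger member; the extension condition is rebuilt from them at the
  end.\<close>

lemma kernel_duality_mod_directed_Union:
  assumes dir: "\<And>U Y. U \<in> S \<Longrightarrow> Y \<in> S \<Longrightarrow> \<exists>Z\<in>S. U \<union> Y \<subseteq> Z" and ne: "S \<noteq> {}"
    and ring: "\<And>U. U \<in> S \<Longrightarrow> subring_set U"
    and kd: "\<And>U. U \<in> S \<Longrightarrow> kernel_duality_mod U J"
    and ext: "\<And>U Y d n m M N. U \<in> S \<Longrightarrow> Y \<in> S \<Longrightarrow> U \<subseteq> Y \<Longrightarrow> (\<And>i j. M i j \<in> U) \<Longrightarrow>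
       exact_mod U J d n m M N \<Longrightarrow> exact_mod Y J d n m M N"
  shows "kernel_duality_mod (\<Union>S) J"
  unfolding kernel_duality_mod_def
proof (intro allI impI)
  fix d n and C :: "nat \<Rightarrow> nat \<Rightarrow> 'a" assume C: "\<forall>i j. C i j \<in> \<Union>S"
  obtain W where "W \<in> S" using ne by blast
  moreover have "(\<lambda>(i, j). C i j) ` ({..<d} \<times> {..<n}) \<subseteq> \<Union>S" using C by (simp add: image_subset_iff)
  ultimately obtain U where U: "U \<in> S" "(\<lambda>(i, j). C i j) ` ({..<d} \<times> {..<n}) \<subseteq> U"
    using finite_subset_directed_Union[of S "(\<lambda>(i, j). C i j) ` ({..<d} \<times> {..<n})" W] dir by auto
  have zero: "0 \<in> U" if "U \<in> S" for U using subring_setD(1)[OF ring[OF that]] .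
  \<comment> \<open>Entries of \<open>C\<close> outside the \<open>d \<times> n\<close> block need
    not lie in \<open>U\<close>.\<close>
  define D where "D i j = (if i < d \<and> j < n then C i j else 0)" for i j
  have D: "D i j \<in> U" for i j
    using U(2) zero[OF U(1)] by (auto simp: D_def)
  obtain m K l A where KA: "\<forall>j k. K j k \<in> U" "\<forall>j k. A j k \<in> U" and exD: "exact_mod U J d n m D K"
    and exK: "exact_mod U J n m l K A" and exA: "exact_mod U J l m n (\<lambda>i j. A j i) (\<lambda>i j. K j i)"
    using kernel_duality_mod_syzygies[OF ring[OF U(1)] kd[OF U(1)], of D d n, OF D] by (elim exE conjE)
  then have K: "\<And>j k. K j k \<in> U" and A: "\<And>j k. A j k \<in> U" by simp_all
  have 1: "exact_mod (\<Union>S) J d n m D K"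
    by (rule exact_mod_directed_Union[of S U]; (rule dir zero U(1) | rule ext[OF U(1) _ _ _ exD]); (assumption | rule D))
  have 2: "exact_mod (\<Union>S) J n m l K A"
    by (rule exact_mod_directed_Union[of S U]; (rule dir zero U(1) | rule ext[OF U(1) _ _ _ exK]); (assumption | rule K))
  have 3: "exact_mod (\<Union>S) J l m n (\<lambda>i j. A j i) (\<lambda>i j. K j i)"
    by (rule exact_mod_directed_Union[of S U]; (rule dir zero U(1) | rule ext[OF U(1) _ _ _ exA]); (assumption | rule A))
  have "exact_mod (\<Union>S) J d n m C K"
    using 1 exact_mod_cong[of d n C D] by (simp add: D_def)
  moreover have "extension_mod (\<Union>S) J n m K"
    by (rule extension_modI_syzygies[OF _ 2 3]) (use A U in blast)
  ultimately show "\<exists>m K. (\<forall>j k. K j k \<in> \<Union>S) \<and> exact_mod (\<Union>S) J d n m C K \<and> extension_mod (\<Union>S) J n m K"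
    using K U(1) by blast
qed

end

section \<open>Polynomials modulo square root relations\<close>

definition odd_part :: "('x \<Rightarrow>\<^sub>0 nat) \<Rightarrow> 'x set" where
  "odd_part m = {x. odd (Poly_Mapping.lookup m x)}"

text \<open>The scalar that a monomial leaves behind when it is reduced to the squarefree monomial
  on its odd part.\<close>

definition square_weight :: "('x \<Rightarrow> 'r::comm_ring_1) \<Rightarrow> ('x \<Rightarrow>\<^sub>0 nat) \<Rightarrow> 'r" where
  "square_weight c m = (\<Prod>x\<in>Poly_Mapping.keys m. c x ^ (Poly_Mapping.lookup m x div 2))"

text \<open>The coefficient of the squarefree monomial with support \<open>S\<close> after replacing each \<open>x\<^sup>2\<close> by \<open>c x\<close>.\<close>

definition nf_coeff :: "('x \<Rightarrow> 'r::comm_ring_1) \<Rightarrow> (('x \<Rightarrow>\<^sub>0 nat) \<Rightarrow>\<^sub>0 'r) \<Rightarrow> 'x set \<Rightarrow> 'r" where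
  "nf_coeff c p S = (\<Sum>m\<in>Poly_Mapping.keys p.
     if odd_part m = S then Poly_Mapping.lookup p m * square_weight c m else 0)"

text \<open>The kernel of the normal form map instead of a generated ideal: membership can be read
  off coefficients, and one ideal serves all sets of variables. Inside each
  \<open>polys_in V\<close> it is identified with the generated ideal in
  \<open>genideal_square_relations\<close>.\<close>

definition nf_ideal :: "('x \<Rightarrow> 'r::comm_ring_1) \<Rightarrow> (('x \<Rightarrow>\<^sub>0 nat) \<Rightarrow>\<^sub>0 'r) set" where
  "nf_ideal c = {p. \<forall>S. nf_coeff c p S = 0}"

definition polys_in :: "'x set \<Rightarrow> (('x \<Rightarrow>\<^sub>0 nat) \<Rightarrow>\<^sub>0 'r::comm_ring_1) set" where
  "polys_in V = {p. \<forall>m\<in>Poly_Mapping.keys p. Poly_Mapping.keys m \<subseteq> V}"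

lemma finite_odd_part [simp]: "finite (odd_part m)"
  by (rule finite_subset[OF _ finite_keys[of m]]) (auto simp: odd_part_def in_keys_iff intro: odd_pos)

lemma odd_part_subset_keys: "odd_part m \<subseteq> Poly_Mapping.keys m"
  by (auto simp: odd_part_def in_keys_iff intro: odd_pos)

lemma odd_part_0 [simp]: "odd_part 0 = {}"
  by (simp add: odd_part_def)

lemma odd_part_add: "odd_part (m + m') = (odd_part m - odd_part m') \<union> (odd_part m' - odd_part m)"
  by (auto simp: odd_part_def lookup_add)

lemma square_weight_superset:
  assumes "finite K" "Poly_Mapping.keys m \<subseteq> K"
  shows "square_weight c m = (\<Prod>x\<in>K. c x ^ (Poly_Mapping.lookup m x div 2))"
  unfolding square_weight_def
  by (rule prod.mono_neutral_left) (use assms in \<open>auto simp: in_keys_iff\<close>)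

lemma square_weight_0 [simp]: "square_weight c 0 = 1"
  by (simp add: square_weight_def)

text \<open>Two odd exponents of the same variable combine to one further square. The extra factor
  is thus the multiplication rule for squarefree monomials: a shared variable \<open>x\<close> turns
  into \<open>c x\<close>.\<close>

lemma square_weight_add:
  "square_weight c (m + m') = square_weight c m * square_weight c m' * prod c (odd_part m \<inter> odd_part m')"
proof -
  define K where "K = Poly_Mapping.keys m \<union> Poly_Mapping.keys m'"
  have K: "finite K" "Poly_Mapping.keys m \<subseteq> K" "Poly_Mapping.keys m' \<subseteq> K"
    "Poly_Mapping.keys (m + m') \<subseteq> K"
    using keys_add[of m m'] by (auto simp: K_def)
  have half: "(a + b) div 2 = a div 2 + b div 2 + (if odd a \<and> odd b then 1 else 0)" for a b :: nat
    by (auto elim!: oddE evenE)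
  have common: "prod c (odd_part m \<inter> odd_part m') =
      (\<Prod>x\<in>K. if x \<in> odd_part m \<inter> odd_part m' then c x else 1)"
    using K odd_part_subset_keys[of m] by (subst prod.inter_restrict[symmetric]) (auto intro!: prod.cong)
  show ?thesis
    unfolding square_weight_superset[OF K(1,2)] square_weight_superset[OF K(1,3)]
      square_weight_superset[OF K(1,4)] common prod.distrib[symmetric]
    by (intro prod.cong) (auto simp: lookup_add half power_add odd_part_def)
qed

lemma square_weight_single: "square_weight c (Poly_Mapping.single x k) = c x ^ (k div 2)"
  by (simp add: square_weight_def)

lemma odd_part_single: "odd_part (Poly_Mapping.single x k) = (if odd k then {x} else {})"
  by (auto simp: odd_part_def lookup_single when_def)

lemma poly_mapping_sum_single:
  "p = (\<Sum>m\<in>Poly_Mapping.keys p. Poly_Mapping.single m (Poly_Mapping.lookup p m))"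
proof (rule poly_mapping_eqI)
  fix k
  have "(\<Sum>m\<in>Poly_Mapping.keys p. Poly_Mapping.lookup p m when m = k) =
    (\<Sum>m\<in>Poly_Mapping.keys p. if m = k then Poly_Mapping.lookup p k else 0)"
    by (intro sum.cong) (auto simp: when_def)
  also have "\<dots> = Poly_Mapping.lookup p k"
    by (auto simp: in_keys_iff)
  finally show "Poly_Mapping.lookup p k =
      Poly_Mapping.lookup (\<Sum>m\<in>Poly_Mapping.keys p. Poly_Mapping.single m (Poly_Mapping.lookup p m)) k"
    by (simp add: lookup_sum lookup_single)
qed

lemma poly_mapping_additive_induct [case_names zero single add]:
  assumes "Q 0" "\<And>m r. Q (Poly_Mapping.single m r)" "\<And>p q. Q p \<Longrightarrow> Q q \<Longrightarrow> Q (p + q)"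
  shows "Q (p :: 'a \<Rightarrow>\<^sub>0 'b::comm_monoid_add)"
proof -
  have "Q (sum f A)" if "\<And>m. Q (f m)" for f :: "'a \<Rightarrow> 'a \<Rightarrow>\<^sub>0 'b" and A
    using that by (induction A rule: infinite_finite_induct) (auto intro: assms)
  then show ?thesis using poly_mapping_sum_single[of p] assms(2) by metis
qed

section \<open>The ideal of polynomials with vanishing normal form\<close>

lemma nf_coeff_superset:
  assumes "finite K" "Poly_Mapping.keys p \<subseteq> K"
  shows "nf_coeff c p S = (\<Sum>m\<in>K. if odd_part m = S then Poly_Mapping.lookup p m * square_weight c m else 0)"
  unfolding nf_coeff_def
  by (rule sum.mono_neutral_left) (use assms in \<open>auto simp: in_keys_iff\<close>)

lemma nf_coeff_0 [simp]: "nf_coeff c 0 S = 0"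
  by (simp add: nf_coeff_def)

lemma nf_coeff_add: "nf_coeff c (p + q) S = nf_coeff c p S + nf_coeff c q S"
proof -
  define K where "K = Poly_Mapping.keys p \<union> Poly_Mapping.keys q"
  have K: "finite K" "Poly_Mapping.keys p \<subseteq> K" "Poly_Mapping.keys q \<subseteq> K"
    "Poly_Mapping.keys (p + q) \<subseteq> K"
    using keys_add[of p q] by (auto simp: K_def)
  show ?thesis
    unfolding nf_coeff_superset[OF K(1,2)] nf_coeff_superset[OF K(1,3)] nf_coeff_superset[OF K(1,4)]
      sum.distrib[symmetric]
    by (intro sum.cong) (auto simp: lookup_add distrib_right)
qed

lemma nf_coeff_single:
  "nf_coeff c (Poly_Mapping.single m r) S = (if odd_part m = S then r * square_weight c m else 0)"
  by (subst nf_coeff_superset[of "{m}"]) auto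

lemma nf_coeff_uminus: "nf_coeff c (- p) S = - nf_coeff c p S"
  using nf_coeff_add[of c p "- p" S] by (simp add: eq_neg_iff_add_eq_0 add.commute)

lemma nf_coeff_diff: "nf_coeff c (p - q) S = nf_coeff c p S - nf_coeff c q S"
  using nf_coeff_add[of c p "- q" S] by (simp add: nf_coeff_uminus)

text \<open>Multiplication by a monomial moves the class of a set to its symmetric difference with
  the odd part, so exactly one class contributes to \<open>S\<close>. The variables shared with that
  class are \<open>odd_part m - S\<close>. This makes \<open>nf_ideal\<close> an ideal and gives the
  independence of 1 and a new variable.\<close>

lemma nf_coeff_single_mult:
  "nf_coeff c (Poly_Mapping.single m r * p) S =
     r * square_weight c m * prod c (odd_part m - S) *
       nf_coeff c p ((odd_part m - S) \<union> (S - odd_part m))"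
proof (induction p rule: poly_mapping_additive_induct)
  case (single m' r')
  show ?case
  proof (cases "odd_part (m + m') = S")
    case True
    then have "odd_part m' = (odd_part m - S) \<union> (S - odd_part m)" "odd_part m \<inter> odd_part m' = odd_part m - S"
      unfolding odd_part_add by blast+
    with True show ?thesis
      by (simp add: mult_single nf_coeff_single square_weight_add ac_simps)
  next
    case False
    then have "odd_part m' \<noteq> (odd_part m - S) \<union> (S - odd_part m)"
      unfolding odd_part_add by blast
    with False show ?thesis by (simp add: mult_single nf_coeff_single)
  qed
qed (simp_all add: nf_coeff_add distrib_left)

lemma ideal_mod_nf_ideal: "ideal_mod (nf_ideal c)"
proof
  fix q p assume p: "p \<in> nf_ideal c"
  show "q * p \<in> nf_ideal c"
    by (induction q rule: poly_mapping_additive_induct)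
      (use p in \<open>simp_all add: nf_ideal_def nf_coeff_single_mult nf_coeff_add distrib_right\<close>)
qed (simp_all add: nf_ideal_def nf_coeff_add)

lemma mpoly_var_power2: "mpoly_var x ^ 2 = Poly_Mapping.single (Poly_Mapping.single x 2) 1"
  by (simp add: mpoly_var_def power2_eq_square mult_single numeral_2_eq_2 flip: single_add)

lemma square_relation_in_nf_ideal: "mpoly_var x ^ 2 - mpoly_const (c x) \<in> nf_ideal c"
  by (simp add: nf_ideal_def nf_coeff_diff mpoly_var_power2 mpoly_const_def nf_coeff_single odd_part_single
      square_weight_single)

lemma mpoly_const_in_nf_ideal: "mpoly_const r \<in> nf_ideal c \<Longrightarrow> r = 0"
  by (auto simp: nf_ideal_def mpoly_const_def nf_coeff_single dest!: spec[of _ "{}"])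

section \<open>Subrings of polynomials in given variables\<close>

lemma polys_in_0: "0 \<in> polys_in V"
  by (simp add: polys_in_def)

lemma polys_in_add: "p \<in> polys_in V \<Longrightarrow> q \<in> polys_in V \<Longrightarrow> p + q \<in> polys_in V"
  using keys_add[of p q] by (fastforce simp: polys_in_def)

lemma polys_in_mult: "p \<in> polys_in V \<Longrightarrow> q \<in> polys_in V \<Longrightarrow> p * q \<in> polys_in V"
proof -
  assume pq: "p \<in> polys_in V" "q \<in> polys_in V"
  have "Poly_Mapping.keys m \<subseteq> V" if "m \<in> Poly_Mapping.keys (p * q)" for m
  proof -
    from that keys_mult[of p q] obtain a b where "m = a + b" "a \<in> Poly_Mapping.keys p" "b \<in> Poly_Mapping.keys q"
      by blast
    with pq show ?thesis using keys_add[of a b] by (fastforce simp: polys_in_def)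
  qed
  then show ?thesis by (simp add: polys_in_def)
qed

lemma polys_in_single: "Poly_Mapping.keys m \<subseteq> V \<Longrightarrow> Poly_Mapping.single m r \<in> polys_in V"
  by (simp add: polys_in_def)

lemma subring_set_polys_in: "subring_set (polys_in V)"
  unfolding subring_set_def
proof (intro conjI ballI)
  show "- p \<in> polys_in V" if "p \<in> polys_in V" for p :: "('a \<Rightarrow>\<^sub>0 nat) \<Rightarrow>\<^sub>0 'b"
    using that by (auto simp: polys_in_def in_keys_iff)
qed (auto simp: polys_in_0 polys_in_add polys_in_mult, simp add: polys_in_def)

lemma polys_in_mono: "V \<subseteq> W \<Longrightarrow> polys_in V \<subseteq> polys_in W"
  by (auto simp: polys_in_def)

lemma polys_in_empty: "polys_in {} = range mpoly_const"
proof (intro equalityI subsetI)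
  fix p :: "('a \<Rightarrow>\<^sub>0 nat) \<Rightarrow>\<^sub>0 'b" assume "p \<in> polys_in {}"
  then have "Poly_Mapping.keys p \<subseteq> {0}" by (auto simp: polys_in_def)
  then have "p = mpoly_const (Poly_Mapping.lookup p 0)"
    by (intro poly_mapping_eqI) (auto simp: mpoly_const_def lookup_single when_def in_keys_iff)
  then show "p \<in> range mpoly_const" by blast
qed (auto simp: polys_in_def mpoly_const_def split: if_splits)

lemma polys_in_induct [consumes 1, case_names single add]:
  assumes p: "p \<in> polys_in V"
    and single: "\<And>m r. Poly_Mapping.keys m \<subseteq> V \<Longrightarrow> Q (Poly_Mapping.single m r)"
    and add: "\<And>p q. Q p \<Longrightarrow> Q q \<Longrightarrow> Q (p + q)"
  shows "Q p"
proof -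
  have "Q (\<Sum>m\<in>A. Poly_Mapping.single m (Poly_Mapping.lookup p m))" if "finite A" "A \<subseteq> Poly_Mapping.keys p" for A
    using that
  proof (induction A rule: finite_induct)
    case empty then show ?case using single[of 0 0] by simp
  next
    case (insert m A)
    then show ?case using p by (auto intro!: add single simp: polys_in_def)
  qed
  then show ?thesis using poly_mapping_sum_single[of p] by (metis finite_keys order_refl)
qed

lemma nf_coeff_polys_in: "p \<in> polys_in V \<Longrightarrow> \<not> S \<subseteq> V \<Longrightarrow> nf_coeff c p S = 0"
  unfolding nf_coeff_def polys_in_def using odd_part_subset_keys by (intro sum.neutral) fastforce

text \<open>The parity of the exponent of \<open>x\<close> splits a polynomial into its components
  at 1 and at \<open>x\<close>. They are independent because normal forms over \<open>F\<close>
  involve no set containing \<open>x\<close>, whereas multiplication by \<open>x\<close> moves each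
  of them to such a set.\<close>

lemma square_root_extension_polys_in:
  fixes c :: "'x \<Rightarrow> 'r::comm_ring_1"
  assumes x: "x \<notin> F"
  shows "square_root_extension (nf_ideal c) (polys_in F) (polys_in (insert x F)) (mpoly_var x) (mpoly_const (c x))"
proof -
  interpret ideal_mod "nf_ideal c" by (rule ideal_mod_nf_ideal)
  show ?thesis
  proof
    show "mpoly_var x * mpoly_var x - mpoly_const (c x) \<in> nf_ideal c"
      using square_relation_in_nf_ideal[of x c] by (simp add: power2_eq_square)
    show "mpoly_var x \<in> polys_in (insert x F)"
      by (auto simp: mpoly_var_def polys_in_def)
    show "mpoly_const (c x) \<in> polys_in F"
      by (auto simp: mpoly_const_def polys_in_def)
    fix p :: "('x \<Rightarrow>\<^sub>0 nat) \<Rightarrow>\<^sub>0 'r" assume "p \<in> polys_in (insert x F)"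
    then show "\<exists>u\<in>polys_in F. \<exists>v\<in>polys_in F. p - (u + v * mpoly_var x) \<in> nf_ideal c"
    proof (induction rule: polys_in_induct)
      case (single m r)
      define k where "k = Poly_Mapping.lookup m x"
      define m' where "m' = m - Poly_Mapping.single x k"
      have look: "Poly_Mapping.lookup m' y = (if y = x then 0 else Poly_Mapping.lookup m y)" for y
        by (simp add: m'_def k_def lookup_minus lookup_single when_def)
      have m: "m = m' + Poly_Mapping.single x k"
        by (rule poly_mapping_eqI) (simp add: lookup_add look lookup_single when_def k_def)
      have m'F: "Poly_Mapping.keys m' \<subseteq> F"
      proof
        fix y assume "y \<in> Poly_Mapping.keys m'"
        then have "y \<noteq> x" "y \<in> Poly_Mapping.keys m"
          by (auto simp: in_keys_iff look split: if_splits)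
        then show "y \<in> F" using single by blast
      qed
      have xm': "x \<notin> odd_part m'" by (simp add: odd_part_def look)
      \<comment> \<open>The exponent \<open>k\<close> of \<open>x\<close> is split into
        \<open>k div 2\<close> squares, each replaced by \<open>c x\<close>, and a remaining factor
        \<open>x\<close> iff \<open>k\<close> is odd.\<close>
      define q where "q = Poly_Mapping.single m' (r * c x ^ (k div 2))"
      have q: "q \<in> polys_in F" unfolding q_def using m'F by (rule polys_in_single)
      show ?case
      proof (cases "even k")
        case True
        have "Poly_Mapping.single m r - (q + 0 * mpoly_var x) \<in> nf_ideal c"
          unfolding nf_ideal_def m q_def
          using True xm' by (auto simp: nf_coeff_diff nf_coeff_single odd_part_add odd_part_single
              square_weight_add square_weight_single)
        then show ?thesis using q polys_in_0 by blast
      next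
        case False
        have "Poly_Mapping.single m r - (0 + q * mpoly_var x) \<in> nf_ideal c"
          unfolding nf_ideal_def m q_def mpoly_var_def
          using False xm' by (auto simp: nf_coeff_diff nf_coeff_single odd_part_add odd_part_single
              square_weight_add square_weight_single mult_single)
        then show ?thesis using q polys_in_0 by blast
      qed
    next
      case (add p q)
      then obtain u v u' v' where u: "u \<in> polys_in F" "v \<in> polys_in F" "p - (u + v * mpoly_var x) \<in> nf_ideal c"
        "u' \<in> polys_in F" "v' \<in> polys_in F" "q - (u' + v' * mpoly_var x) \<in> nf_ideal c" by blast
      have "p + q - ((u + u') + (v + v') * mpoly_var x) \<in> nf_ideal c"
        using J_add[OF u(3,6)] by (simp add: algebra_simps)
      then show ?case using u polys_in_add by blast
    qed
  next
    fix u v :: "('x \<Rightarrow>\<^sub>0 nat) \<Rightarrow>\<^sub>0 'r" assume uv: "u \<in> polys_in F" "v \<in> polys_in F" and z: "u + v * mpoly_var x \<in> nf_ideal c"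
    \<comment> \<open>Read at a set without \<open>x\<close>, this isolates the coefficients of
      \<open>u\<close>; read at \<open>insert x S\<close>, it isolates those of
      \<open>v\<close>.\<close>
    have z': "nf_coeff c u S + prod c ({x} - S) * nf_coeff c v (({x} - S) \<union> (S - {x})) = 0" for S
    proof -
      have "u + v * mpoly_var x = u + Poly_Mapping.single (Poly_Mapping.single x 1) 1 * v"
        by (simp add: mpoly_var_def mult.commute)
      with z show ?thesis
        by (simp add: nf_ideal_def nf_coeff_add nf_coeff_single_mult odd_part_single square_weight_single)
    qed
    have "nf_coeff c u S = 0" for S
    proof (cases "x \<in> S")
      case True
      then show ?thesis by (intro nf_coeff_polys_in[OF uv(1)]) (use x True in auto)
    next
      case False
      then have "nf_coeff c v (({x} - S) \<union> (S - {x})) = 0"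
        by (intro nf_coeff_polys_in[OF uv(2)]) (use x False in auto)
      then show ?thesis using z'[of S] by simp
    qed
    moreover have "nf_coeff c v S = 0" for S
    proof (cases "x \<in> S")
      case True
      then show ?thesis by (intro nf_coeff_polys_in[OF uv(2)]) (use x True in auto)
    next
      case False
      have "nf_coeff c u (insert x S) = 0"
        by (intro nf_coeff_polys_in[OF uv(1)]) (use x False in auto)
      moreover have "({x} - insert x S) \<union> (insert x S - {x}) = S" "{x} - insert x S = {}"
        using False by auto
      ultimately show ?thesis using z'[of "insert x S"] by simp
    qed
    ultimately show "u \<in> nf_ideal c \<and> v \<in> nf_ideal c" by (simp add: nf_ideal_def)
  qed (auto simp: subring_set_polys_in intro: polys_in_mono[THEN subsetD])
qed

text \<open>Finite sets of variables are reached by one square root at a time, starting from the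
  constants; arbitrary \<open>V\<close> is the directed union of its finite subsets, and between two
  finite stages exactness passes by the same steps.\<close>

lemma kernel_duality_mod_polys_in:
  fixes c :: "'x \<Rightarrow> 'r::idom"
  assumes bez: "bezout_families TYPE('r)"
  shows "kernel_duality_mod (polys_in V) (nf_ideal c)"
proof -
  interpret ideal_mod "nf_ideal c" by (rule ideal_mod_nf_ideal)
  have kd: "kernel_duality_mod (polys_in F) (nf_ideal c)" if "finite F" for F
    using that
  proof (induction F rule: finite_induct)
    case empty
    show ?case unfolding polys_in_empty
      by (rule kernel_duality_mod_bezout[OF bez])
        (simp_all add: mpoly_const_in_nf_ideal, simp_all add: mpoly_const_def single_add mult_single)
  next
    case (insert x F)
    then show ?case
      by (intro square_root_extension.kernel_duality_mod_extend[OF square_root_extension_polys_in])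
  qed
  have ext: "exact_mod (polys_in F) (nf_ideal c) d n m M N \<Longrightarrow>
      exact_mod (polys_in (F \<union> G)) (nf_ideal c) d n m M N"
    if "finite G" and M: "\<And>i j. M i j \<in> polys_in F" for F G d n m M N
    using that(1)
  proof (induction G rule: finite_induct)
    case empty then show ?case by simp
  next
    case (insert x G)
    show ?case
    proof (cases "x \<in> F \<union> G")
      case True with insert show ?thesis by (simp add: insert_absorb)
    next
      case False
      show ?thesis unfolding Un_insert_right
        by (rule square_root_extension.exact_mod_extend[OF square_root_extension_polys_in[OF False]])
          (use M insert polys_in_mono[of F "F \<union> G"] in auto)
    qed
  qed
  define S :: "(('x \<Rightarrow>\<^sub>0 nat) \<Rightarrow>\<^sub>0 'r) set set" where "S = polys_in ` {F. finite F \<and> F \<subseteq> V}"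
  have "polys_in V = \<Union>S"
  proof (intro equalityI subsetI)
    fix p :: "('x \<Rightarrow>\<^sub>0 nat) \<Rightarrow>\<^sub>0 'r" assume "p \<in> polys_in V"
    then have "p \<in> polys_in (\<Union>m\<in>Poly_Mapping.keys p. Poly_Mapping.keys m)"
      "(\<Union>m\<in>Poly_Mapping.keys p. Poly_Mapping.keys m) \<subseteq> V"
      by (auto simp: polys_in_def)
    then show "p \<in> \<Union>S" unfolding S_def
      by (intro UnionI[of "polys_in (\<Union>m\<in>Poly_Mapping.keys p. Poly_Mapping.keys m)"] imageI CollectI) auto
  qed (use polys_in_mono in \<open>auto simp: S_def\<close>)
  moreover have "kernel_duality_mod (\<Union>S) (nf_ideal c)"
  proof (rule kernel_duality_mod_directed_Union)
    fix U Y assume "U \<in> S" "Y \<in> S"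
    then obtain F G where FG: "finite F" "F \<subseteq> V" "U = polys_in F" "finite G" "G \<subseteq> V" "Y = polys_in G"
      by (auto simp: S_def)
    then have "polys_in (F \<union> G) \<in> S" by (auto simp: S_def)
    then show "\<exists>Z\<in>S. U \<union> Y \<subseteq> Z"
      using FG polys_in_mono[of F "F \<union> G"] polys_in_mono[of G "F \<union> G"] by blast
    show "exact_mod Y (nf_ideal c) d n m M N"
      if sub: "U \<subseteq> Y" and M: "\<And>i j. M i j \<in> U" and e: "exact_mod U (nf_ideal c) d n m M N" for d n m M N
    proof -
      \<comment> \<open>The union lemma only knows the inclusion of rings. The variables themselves,
        as elements of \<open>U\<close>, recover the inclusion of the index sets.\<close>
      have "F \<subseteq> G"
      proof
        fix x assume "x \<in> F"
        then have "mpoly_var x \<in> U" using FG by (auto simp: mpoly_var_def polys_in_def)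
        then have "mpoly_var x \<in> (polys_in G :: (('x \<Rightarrow>\<^sub>0 nat) \<Rightarrow>\<^sub>0 'r) set)" using sub FG by blast
        then show "x \<in> G" by (simp add: mpoly_var_def polys_in_def)
      qed
      then have "F \<union> G = G" by blast
      then show ?thesis using ext[of G M F d n m N] FG M e by simp
    qed
  next
    show "S \<noteq> {}" by (auto simp: S_def)
  qed (auto simp: S_def kd subring_set_polys_in)
  ultimately show ?thesis by simp
qed

section \<open>Polynomials and Laurent polynomials over a field\<close>

text \<open>\<open>h\<close> is a nonzero element of least Euclidean size in the ideal generated by
  \<open>a\<close> and \<open>b\<close>. Remainders modulo \<open>h\<close> stay in that ideal, so
  they vanish; cancelling \<open>h\<close> in \<open>h = s a + t b\<close> gives the unimodular
  cofactors.\<close>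

lemma bezout_pair:
  fixes a b :: "'a::euclidean_ring"
  shows "\<exists>h s t a' b'. a = h * a' \<and> b = h * b' \<and> (h = 0 \<or> s * a' + t * b' = 1)"
proof (cases "a = 0 \<and> b = 0")
  case True
  then show ?thesis by (intro exI[of _ 0]) simp
next
  case False
  define I where "I = {s * a + t * b | s t. True}"
  have "a \<in> I" unfolding I_def by (intro CollectI exI[of _ 1] exI[of _ 0]) simp
  moreover have "b \<in> I" unfolding I_def by (intro CollectI exI[of _ 0] exI[of _ 1]) simp
  ultimately have "\<exists>x. x \<in> I \<and> x \<noteq> 0" using False by blast
  then obtain h where h: "h \<in> I" "h \<noteq> 0" and min: "\<And>x. x \<in> I \<Longrightarrow> x \<noteq> 0 \<Longrightarrow> euclidean_size h \<le> euclidean_size x"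
    using ex_has_least_nat[of "\<lambda>x. x \<in> I \<and> x \<noteq> 0" _ euclidean_size] by metis
  obtain s t where st: "h = s * a + t * b" using h(1) by (auto simp: I_def)
  have "h dvd x" if xI: "x \<in> I" for x
  proof -
    obtain s' t' where x: "x = s' * a + t' * b" using xI by (auto simp: I_def)
    have "x mod h = x - h * (x div h)" by (simp add: minus_mult_div_eq_mod)
    also have "\<dots> = (s' - s * (x div h)) * a + (t' - t * (x div h)) * b"
      by (subst x, subst st) (simp add: algebra_simps)
    finally have "x mod h \<in> I" unfolding I_def by blast
    then have "x mod h = 0" using min[of "x mod h"] mod_size_less[OF h(2), of x] by auto
    then show ?thesis by blast
  qed
  then have "h dvd a" "h dvd b" using \<open>a \<in> I\<close> \<open>b \<in> I\<close> by simp_all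
  then obtain a' b' where ab: "a = h * a'" "b = h * b'" unfolding dvd_def by blast
  have "h * (s * a' + t * b') = s * (h * a') + t * (h * b')" by (simp add: algebra_simps)
  also have "\<dots> = h * 1" unfolding ab[symmetric] st[symmetric] by simp
  finally have "s * a' + t * b' = 1" using h(2) mult_left_cancel by blast
  with ab show ?thesis by blast
qed

lemma bezout_families_euclidean_ring: "bezout_families TYPE('a::euclidean_ring)"
  unfolding bezout_families_def
proof (intro allI)
  fix n and a :: "nat \<Rightarrow> 'a"
  show "\<exists>x y g. (\<forall>i<n. a i = g * y i) \<and> (g = 0 \<or> dot n x y = 1)"
  proof (induction n)
    case 0 then show ?case by (intro exI[of _ "\<lambda>_. 0"] exI[of _ 0]) simp
  next
    case (Suc n)
    then obtain x y g where xyg: "\<And>i. i < n \<Longrightarrow> a i = g * y i" "g = 0 \<or> dot n x y = 1" by blast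
    obtain h s t g' b where h: "g = h * g'" "a n = h * b" "h = 0 \<or> s * g' + t * b = 1"
      using bezout_pair[of g "a n"] by blast
    define y' where "y' i = (if i = n then b else g' * y i)" for i
    define x' where "x' i = (if i = n then t else s * x i)" for i
    have "a i = h * y' i" if "i < Suc n" for i
      using that xyg(1)[of i] h by (auto simp: y'_def less_Suc_eq mult.assoc)
    moreover have "dot (Suc n) x' y' = 1" if "h \<noteq> 0"
    proof -
      have "dot n x' y' = s * g' * dot n x y"
        unfolding sum_distrib_left by (intro sum.cong) (auto simp: x'_def y'_def ac_simps)
      \<comment> \<open>If \<open>g = 0\<close>, then \<open>g' = 0\<close> because \<open>h\<close>
        is nonzero, and both sides vanish; otherwise the old family is unimodular.\<close>
      also have "\<dots> = s * g'" using xyg(2) h(1) that by auto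
      finally show ?thesis using h(3) that by (simp add: x'_def y'_def)
    qed
    ultimately show ?case by blast
  qed
qed

section \<open>Laurent polynomials\<close>

definition laurent_of_poly :: "'k::field poly \<Rightarrow> 'k laurent_poly" where
  "laurent_of_poly q = poly (map_poly laurent_const q) laurent_z"

lemma laurent_const_0 [simp]: "laurent_const 0 = 0"
  by (simp add: laurent_const_def)

lemma laurent_of_poly_0 [simp]: "laurent_of_poly 0 = 0"
  by (simp add: laurent_of_poly_def)

lemma laurent_of_poly_pCons: "laurent_of_poly (pCons a q) = laurent_const a + laurent_z * laurent_of_poly q"
  by (simp add: laurent_of_poly_def map_poly_pCons)

lemma laurent_of_poly_add: "laurent_of_poly (p + q) = laurent_of_poly p + laurent_of_poly q"
  by (induction p q rule: poly_induct2)
    (simp_all add: laurent_of_poly_pCons laurent_const_def single_add algebra_simps)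

lemma laurent_of_poly_smult: "laurent_of_poly (Polynomial.smult a q) = laurent_const a * laurent_of_poly q"
  by (induction q) (simp_all add: laurent_of_poly_pCons laurent_const_def mult_single algebra_simps)

lemma laurent_of_poly_mult: "laurent_of_poly (p * q) = laurent_of_poly p * laurent_of_poly q"
  by (induction p) (simp_all add: laurent_of_poly_pCons laurent_of_poly_add laurent_of_poly_smult algebra_simps)

lemma laurent_of_poly_1 [simp]: "laurent_of_poly 1 = 1"
  by (simp add: one_pCons laurent_of_poly_pCons) (simp add: laurent_const_def)

lemma laurent_of_poly_sum: "laurent_of_poly (sum f A) = (\<Sum>i\<in>A. laurent_of_poly (f i))"
  by (induction A rule: infinite_finite_induct) (simp_all add: laurent_of_poly_add)

lemma laurent_of_poly_monom: "laurent_of_poly (monom a n) = Poly_Mapping.single (int n) a"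
  by (induction n) (simp_all add: monom_0 monom_Suc laurent_of_poly_pCons,
      simp_all add: laurent_const_def laurent_z_def mult_single)

text \<open>The bound is stated for all \<open>M\<close> above \<open>N\<close> so that finitely
  many Laurent polynomials can share one exponent.\<close>

lemma laurent_clear_denominator:
  fixes a :: "'k::field laurent_poly"
  shows "\<exists>N. \<forall>M\<ge>N. \<exists>q. Poly_Mapping.single (int M) 1 * a = laurent_of_poly q"
proof (induction a rule: poly_mapping_additive_induct)
  case zero
  have "Poly_Mapping.single (int M) (1 :: 'k) * 0 = laurent_of_poly 0" for M by simp
  then show ?case by blast
next
  case (single m r)
  have "Poly_Mapping.single (int M) 1 * Poly_Mapping.single m r = laurent_of_poly (monom r (nat (int M + m)))"
    if M: "M \<ge> nat (- m)" for M
  proof -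
    have "0 \<le> int M + m" using M by linarith
    then show ?thesis by (simp add: laurent_of_poly_monom mult_single)
  qed
  then show ?case by blast
next
  case (add a b)
  then obtain N1 N2 where N: "\<And>M. M \<ge> N1 \<Longrightarrow> \<exists>q. Poly_Mapping.single (int M) 1 * a = laurent_of_poly q"
    "\<And>M. M \<ge> N2 \<Longrightarrow> \<exists>q. Poly_Mapping.single (int M) 1 * b = laurent_of_poly q" by blast
  have "\<exists>q. Poly_Mapping.single (int M) 1 * (a + b) = laurent_of_poly q" if "M \<ge> max N1 N2" for M
  proof -
    from that N[of M] obtain p q where "Poly_Mapping.single (int M) 1 * a = laurent_of_poly p"
      "Poly_Mapping.single (int M) 1 * b = laurent_of_poly q" by auto
    then have "Poly_Mapping.single (int M) 1 * (a + b) = laurent_of_poly (p + q)"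
      by (simp add: distrib_left laurent_of_poly_add)
    then show ?thesis by blast
  qed
  then show ?case by blast
qed

text \<open>A power of \<open>z\<close> is a unit, so the family can be moved into polynomials,
  treated there, and moved back by absorbing the inverse power into the common factor.\<close>

lemma bezout_families_laurent: "bezout_families TYPE('k::field laurent_poly)"
  unfolding bezout_families_def
proof (intro allI)
  fix n and a :: "nat \<Rightarrow> 'k laurent_poly"
  have "\<exists>N. \<forall>M\<ge>N. \<forall>i<n. \<exists>q. Poly_Mapping.single (int M) 1 * a i = laurent_of_poly q"
  proof (induction n)
    case (Suc n)
    then obtain N1 where N1: "\<And>M i. M \<ge> N1 \<Longrightarrow> i < n \<Longrightarrow> \<exists>q. Poly_Mapping.single (int M) 1 * a i = laurent_of_poly q"
      by blast
    obtain N2 where N2: "\<And>M. M \<ge> N2 \<Longrightarrow> \<exists>q. Poly_Mapping.single (int M) 1 * a n = laurent_of_poly q"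
      using laurent_clear_denominator[of "a n"] by blast
    show ?case
      by (intro exI[of _ "max N1 N2"]) (auto simp: less_Suc_eq intro: N1 N2)
  qed simp
  then obtain M where M: "\<And>i. i < n \<Longrightarrow> \<exists>q. Poly_Mapping.single (int M) 1 * a i = laurent_of_poly q"
    by blast
  define z :: "'k laurent_poly" where "z = Poly_Mapping.single (int M) 1"
  define w :: "'k laurent_poly" where "w = Poly_Mapping.single (- int M) 1"
  have wz: "w * z = 1" by (simp add: w_def z_def mult_single)
  have "\<forall>i. \<exists>q. i < n \<longrightarrow> z * a i = laurent_of_poly q" using M unfolding z_def by blast
  then obtain p where p: "\<And>i. i < n \<Longrightarrow> z * a i = laurent_of_poly (p i)" by metis
  obtain x y g where xyg: "\<forall>i<n. p i = g * y i" "g = 0 \<or> dot n x y = 1"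
    using bezout_families_euclidean_ring[where 'a = "'k poly", unfolded bezout_families_def,
        THEN spec, THEN spec, of n p] by blast
  have "a i = w * laurent_of_poly g * laurent_of_poly (y i)" if "i < n" for i
  proof -
    have "a i = w * (z * a i)" using wz by (simp flip: mult.assoc)
    also have "\<dots> = w * laurent_of_poly (g * y i)" using p xyg(1) that by simp
    finally show ?thesis by (simp add: laurent_of_poly_mult mult.assoc)
  qed
  moreover have "w * laurent_of_poly g = 0 \<or> (\<Sum>i<n. laurent_of_poly (x i) * laurent_of_poly (y i)) = 1"
    using xyg(2) laurent_of_poly_sum[of "\<lambda>i. x i * y i" "{..<n}"] by (auto simp: laurent_of_poly_mult)
  ultimately show "\<exists>x y g. (\<forall>i<n. a i = g * y i) \<and> (g = 0 \<or> dot n x y = 1)"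
    by (intro exI[of _ "\<lambda>i. laurent_of_poly (x i)"] exI[of _ "\<lambda>i. laurent_of_poly (y i)"]
        exI[of _ "w * laurent_of_poly g"]) simp
qed

section \<open>Matrices over a commutative ring\<close>

text \<open>A recursion that unfolds without closure conditions and applies to rings and to module
  records alike.\<close>

primrec nsum :: "('a, 'x) ring_scheme \<Rightarrow> (nat \<Rightarrow> 'a) \<Rightarrow> nat \<Rightarrow> 'a" where
  "nsum R f 0 = \<zero>\<^bsub>R\<^esub>"
| "nsum R f (Suc n) = nsum R f n \<oplus>\<^bsub>R\<^esub> f n"

abbreviation rdot :: "('a, 'x) ring_scheme \<Rightarrow> nat \<Rightarrow> (nat \<Rightarrow> 'a) \<Rightarrow> (nat \<Rightarrow> 'a) \<Rightarrow> 'a" where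
  "rdot R n u v \<equiv> nsum R (\<lambda>i. u i \<otimes>\<^bsub>R\<^esub> v i) n"

abbreviation vecs :: "('a, 'x) ring_scheme \<Rightarrow> nat \<Rightarrow> (nat \<Rightarrow> 'a) set" where
  "vecs R n \<equiv> carrier (free_module R n)"

abbreviation functionals :: "('a, 'x) ring_scheme \<Rightarrow> ('a, 'm, 'y) module_scheme \<Rightarrow> ('m \<Rightarrow> 'a) set" where
  "functionals R M \<equiv> mod_hom R M (ring_module R)"

lemma nsum_cong: "(\<And>i. i < n \<Longrightarrow> f i = g i) \<Longrightarrow> nsum R f n = nsum R g n"
  by (induction n) simp_all

context abelian_monoid
begin

lemma nsum_closed [simp, intro]: "(\<And>i. i < n \<Longrightarrow> f i \<in> carrier G) \<Longrightarrow> nsum G f n \<in> carrier G"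
  by (induction n) simp_all

lemma nsum_zero: "(\<And>i. i < n \<Longrightarrow> f i = \<zero>) \<Longrightarrow> nsum G f n = \<zero>"
  by (induction n) simp_all

lemma nsum_add:
  assumes "\<And>i. i < n \<Longrightarrow> f i \<in> carrier G" "\<And>i. i < n \<Longrightarrow> g i \<in> carrier G"
  shows "nsum G (\<lambda>i. f i \<oplus> g i) n = nsum G f n \<oplus> nsum G g n"
  using assms
proof (induction n)
  case (Suc n)
  have "nsum G f n \<in> carrier G" "nsum G g n \<in> carrier G" using Suc.prems by simp_all
  with Suc show ?case by (simp add: a_ac)
qed simp

lemma nsum_swap:
  assumes "\<And>i j. i < n \<Longrightarrow> j < m \<Longrightarrow> f i j \<in> carrier G"
  shows "nsum G (\<lambda>i. nsum G (f i) m) n = nsum G (\<lambda>j. nsum G (\<lambda>i. f i j) n) m"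
  using assms
proof (induction n)
  case 0 then show ?case by (simp add: nsum_zero)
next
  case (Suc n)
  then have "nsum G (\<lambda>i. nsum G (f i) m) (Suc n) = nsum G (\<lambda>j. nsum G (\<lambda>i. f i j) n) m \<oplus> nsum G (f n) m"
    by simp
  also have "\<dots> = nsum G (\<lambda>j. nsum G (\<lambda>i. f i j) n \<oplus> f n j) m"
    using Suc.prems by (subst nsum_add) auto
  finally show ?case by simp
qed

lemma nsum_delta:
  assumes "k < n" "f k \<in> carrier G" "\<And>i. i < n \<Longrightarrow> i \<noteq> k \<Longrightarrow> f i = \<zero>"
  shows "nsum G f n = f k"
  using assms
proof (induction n)
  case (Suc n)
  show ?case
  proof (cases "k = n")
    case True
    then have "nsum G f n = \<zero>" using Suc.prems by (intro nsum_zero) auto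
    with True Suc.prems show ?thesis by simp
  next
    case False
    with Suc show ?thesis by simp
  qed
qed simp

end

context cring
begin

lemma nsum_rdistr:
  assumes "a \<in> carrier R" "\<And>i. i < n \<Longrightarrow> f i \<in> carrier R"
  shows "a \<otimes> nsum R f n = nsum R (\<lambda>i. a \<otimes> f i) n"
  using assms by (induction n) (simp_all add: r_distr)

lemma nsum_ldistr:
  assumes "a \<in> carrier R" "\<And>i. i < n \<Longrightarrow> f i \<in> carrier R"
  shows "nsum R f n \<otimes> a = nsum R (\<lambda>i. f i \<otimes> a) n"
  using assms by (induction n) (simp_all add: l_distr)

lemma nsum_matrix_assoc:
  assumes "\<And>j. j < n \<Longrightarrow> c j \<in> carrier R" "\<And>k. k < m \<Longrightarrow> y k \<in> carrier R"
    "\<And>j k. j < n \<Longrightarrow> k < m \<Longrightarrow> N j k \<in> carrier R"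
  shows "nsum R (\<lambda>j. c j \<otimes> rdot R m (N j) y) n =
    nsum R (\<lambda>k. nsum R (\<lambda>j. c j \<otimes> N j k) n \<otimes> y k) m"
proof -
  have "nsum R (\<lambda>j. c j \<otimes> rdot R m (N j) y) n =
      nsum R (\<lambda>j. nsum R (\<lambda>k. c j \<otimes> N j k \<otimes> y k) m) n"
  proof (rule nsum_cong)
    fix j assume "j < n"
    then show "c j \<otimes> rdot R m (N j) y = nsum R (\<lambda>k. c j \<otimes> N j k \<otimes> y k) m"
      using assms by (subst nsum_rdistr) (auto intro!: nsum_cong simp: m_assoc)
  qed
  also have "\<dots> = nsum R (\<lambda>k. nsum R (\<lambda>j. c j \<otimes> N j k \<otimes> y k) n) m"
    by (rule nsum_swap) (use assms in auto)
  also have "\<dots> = nsum R (\<lambda>k. nsum R (\<lambda>j. c j \<otimes> N j k) n \<otimes> y k) m"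
    by (rule nsum_cong, subst nsum_ldistr) (use assms in auto)
  finally show ?thesis .
qed

end

text \<open>The counterpart of \<open>exact_mod\<close> for ring records, as needed for quotients
  and localizations. Here elements of the carrier are compared by equality, and only the entries
  below the bounds are constrained.\<close>

definition exact_mat ::
  "('a, 'x) ring_scheme \<Rightarrow> nat \<Rightarrow> nat \<Rightarrow> nat \<Rightarrow> (nat \<Rightarrow> nat \<Rightarrow> 'a) \<Rightarrow> (nat \<Rightarrow> nat \<Rightarrow> 'a) \<Rightarrow> bool"
  where "exact_mat R d n m C K \<longleftrightarrow>
    (\<forall>x. (\<forall>j<n. x j \<in> carrier R) \<longrightarrow>
      (\<forall>i<d. rdot R n (C i) x = \<zero>\<^bsub>R\<^esub>) =
      (\<exists>y. (\<forall>k<m. y k \<in> carrier R) \<and> (\<forall>j<n. x j = rdot R m (K j) y)))"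

lemma exact_matD:
  assumes "exact_mat R d n m C K" "\<forall>j<n. x j \<in> carrier R"
  shows "(\<forall>i<d. rdot R n (C i) x = \<zero>\<^bsub>R\<^esub>) \<longleftrightarrow>
    (\<exists>y. (\<forall>k<m. y k \<in> carrier R) \<and> (\<forall>j<n. x j = rdot R m (K j) y))"
  using assms unfolding exact_mat_def by simp

definition extension_mat :: "('a, 'x) ring_scheme \<Rightarrow> nat \<Rightarrow> nat \<Rightarrow> (nat \<Rightarrow> nat \<Rightarrow> 'a) \<Rightarrow> bool"
  where "extension_mat R n m K \<longleftrightarrow>
    (\<forall>\<phi>. (\<forall>k<m. \<phi> k \<in> carrier R) \<longrightarrow>
      (\<forall>y. (\<forall>k<m. y k \<in> carrier R) \<longrightarrow> (\<forall>j<n. rdot R m (K j) y = \<zero>\<^bsub>R\<^esub>) \<longrightarrow>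
         rdot R m \<phi> y = \<zero>\<^bsub>R\<^esub>) \<longrightarrow>
      (\<exists>v. (\<forall>j<n. v j \<in> carrier R) \<and> (\<forall>k<m. \<phi> k = nsum R (\<lambda>j. v j \<otimes>\<^bsub>R\<^esub> K j k) n)))"

definition kernel_duality :: "('a, 'x) ring_scheme \<Rightarrow> bool" where
  "kernel_duality R \<longleftrightarrow>
    (\<forall>d n C. (\<forall>i<d. \<forall>j<n. C i j \<in> carrier R) \<longrightarrow>
      (\<exists>m K. (\<forall>j<n. \<forall>k<m. K j k \<in> carrier R) \<and> exact_mat R d n m C K \<and> extension_mat R n m K))"

section \<open>Free modules and homomorphisms\<close>

definition unit_vec :: "('a, 'x) ring_scheme \<Rightarrow> nat \<Rightarrow> nat \<Rightarrow> nat \<Rightarrow> 'a" where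
  "unit_vec R n j = (\<lambda>i\<in>{..<n}. if i = j then \<one>\<^bsub>R\<^esub> else \<zero>\<^bsub>R\<^esub>)"

definition mat_hom ::
  "('a, 'x) ring_scheme \<Rightarrow> nat \<Rightarrow> nat \<Rightarrow> (nat \<Rightarrow> nat \<Rightarrow> 'a) \<Rightarrow> (nat \<Rightarrow> 'a) \<Rightarrow> (nat \<Rightarrow> 'a)" where
  "mat_hom R n m K = (\<lambda>x\<in>vecs R m. \<lambda>j\<in>{..<n}. rdot R m (K j) x)"

lemma mod_homI:
  assumes "\<And>x. x \<in> carrier M \<Longrightarrow> h x \<in> carrier N" "h \<in> extensional (carrier M)"
    "\<And>x y. x \<in> carrier M \<Longrightarrow> y \<in> carrier M \<Longrightarrow> h (x \<oplus>\<^bsub>M\<^esub> y) = h x \<oplus>\<^bsub>N\<^esub> h y"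
    "\<And>a x. a \<in> carrier R \<Longrightarrow> x \<in> carrier M \<Longrightarrow> h (a \<odot>\<^bsub>M\<^esub> x) = a \<odot>\<^bsub>N\<^esub> h x"
  shows "h \<in> mod_hom R M N"
  using assms unfolding mod_hom_def by (auto simp: PiE_def)

lemma mod_homD:
  assumes "h \<in> mod_hom R M N"
  shows "\<And>x. x \<in> carrier M \<Longrightarrow> h x \<in> carrier N" "h \<in> extensional (carrier M)"
    "\<And>x y. x \<in> carrier M \<Longrightarrow> y \<in> carrier M \<Longrightarrow> h (x \<oplus>\<^bsub>M\<^esub> y) = h x \<oplus>\<^bsub>N\<^esub> h y"
    "\<And>a x. a \<in> carrier R \<Longrightarrow> x \<in> carrier M \<Longrightarrow> h (a \<odot>\<^bsub>M\<^esub> x) = a \<odot>\<^bsub>N\<^esub> h x"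
  using assms unfolding mod_hom_def by (auto simp: PiE_def Pi_def)

lemma mod_hom_compose:
  assumes g: "g \<in> mod_hom R L M" and h: "h \<in> mod_hom R M N"
    and clo: "\<And>x y. x \<in> carrier L \<Longrightarrow> y \<in> carrier L \<Longrightarrow> x \<oplus>\<^bsub>L\<^esub> y \<in> carrier L"
    "\<And>a x. a \<in> carrier R \<Longrightarrow> x \<in> carrier L \<Longrightarrow> a \<odot>\<^bsub>L\<^esub> x \<in> carrier L"
  shows "compose (carrier L) h g \<in> mod_hom R L N"
  by (rule mod_homI)
    (simp_all add: compose_eq mod_homD[OF g] mod_homD[OF h] clo)

lemma ring_module_simps [simp]:
  "carrier (ring_module R) = carrier R" "add (ring_module R) = add R" "\<zero>\<^bsub>ring_module R\<^esub> = \<zero>\<^bsub>R\<^esub>"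
  "module.smult (ring_module R) = monoid.mult R"
  by (simp_all add: ring_module_def)

lemma nsum_ring_module [simp]: "nsum (ring_module R) f n = nsum R f n"
  by (induction n) simp_all

lemma dual_module_simps:
  "carrier (dual_module R M) = functionals R M"
  "\<zero>\<^bsub>dual_module R M\<^esub> = (\<lambda>x\<in>carrier M. \<zero>\<^bsub>R\<^esub>)"
  "add (dual_module R M) = (\<lambda>g h. \<lambda>x\<in>carrier M. g x \<oplus>\<^bsub>R\<^esub> h x)"
  "module.smult (dual_module R M) = (\<lambda>a h. \<lambda>x\<in>carrier M. a \<otimes>\<^bsub>R\<^esub> h x)"
  by (simp_all add: dual_module_def hom_module_def)

lemma free_module_simps:
  "vecs R n = {..<n} \<rightarrow>\<^sub>E carrier R"
  "\<zero>\<^bsub>free_module R n\<^esub> = (\<lambda>i\<in>{..<n}. \<zero>\<^bsub>R\<^esub>)"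
  "add (free_module R n) = (\<lambda>v w. \<lambda>i\<in>{..<n}. v i \<oplus>\<^bsub>R\<^esub> w i)"
  "module.smult (free_module R n) = (\<lambda>a v. \<lambda>i\<in>{..<n}. a \<otimes>\<^bsub>R\<^esub> v i)"
  by (simp_all add: free_module_def)

lemma free_moduleD: "x \<in> vecs R n \<Longrightarrow> i < n \<Longrightarrow> x i \<in> carrier R"
  by (auto simp: free_module_simps)

lemma restrict_in_free_module [simp, intro]:
  "(\<And>i. i < n \<Longrightarrow> x i \<in> carrier R) \<Longrightarrow> restrict x {..<n} \<in> vecs R n"
  by (auto simp: free_module_simps)

lemma free_module_eqI:
  assumes "x \<in> vecs R n" "y \<in> vecs R n" "\<And>i. i < n \<Longrightarrow> x i = y i"
  shows "x = y"
  using assms by (auto simp: free_module_simps intro: PiE_ext)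

context cring
begin

lemma free_module_closed:
  "x \<in> vecs R n \<Longrightarrow> y \<in> vecs R n \<Longrightarrow> x \<oplus>\<^bsub>free_module R n\<^esub> y \<in> vecs R n"
  "a \<in> carrier R \<Longrightarrow> x \<in> vecs R n \<Longrightarrow> a \<odot>\<^bsub>free_module R n\<^esub> x \<in> vecs R n"
  "\<zero>\<^bsub>free_module R n\<^esub> \<in> vecs R n"
  by (auto simp: free_module_simps)

lemma unit_vec_closed [simp, intro]: "unit_vec R n j \<in> vecs R n"
  unfolding unit_vec_def by (rule restrict_in_free_module) simp

lemma module_ring_module: "module R (ring_module R)"
proof (rule moduleI)
  show "abelian_group (ring_module R)"
    by (rule abelian_groupI) (auto simp: a_ac intro: l_neg)
qed (auto simp: l_distr r_distr m_assoc cring_axioms)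

lemma mat_hom_closed:
  assumes K: "\<And>j k. j < n \<Longrightarrow> k < m \<Longrightarrow> K j k \<in> carrier R"
  shows "mat_hom R n m K \<in> mod_hom R (free_module R m) (free_module R n)"
proof (rule mod_homI)
  fix x assume x: "x \<in> vecs R m"
  then show "mat_hom R n m K x \<in> vecs R n"
    using K free_moduleD[OF x] by (auto simp: mat_hom_def)
  fix y assume y: "y \<in> vecs R m"
  show "mat_hom R n m K (x \<oplus>\<^bsub>free_module R m\<^esub> y) = mat_hom R n m K x \<oplus>\<^bsub>free_module R n\<^esub> mat_hom R n m K y"
    using x y free_module_closed(1)[OF x y]
    by (auto simp: mat_hom_def free_module_simps(3) K r_distr free_moduleD nsum_add[symmetric]
        intro!: restrict_ext nsum_cong)
next
  fix a x assume a: "a \<in> carrier R" and x: "x \<in> vecs R m"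
  show "mat_hom R n m K (a \<odot>\<^bsub>free_module R m\<^esub> x) = a \<odot>\<^bsub>free_module R n\<^esub> mat_hom R n m K x"
    using a x free_module_closed(2)[OF a x]
    by (auto simp: mat_hom_def free_module_simps(4) K m_lcomm free_moduleD nsum_rdistr
        intro!: restrict_ext nsum_cong)
qed (simp add: mat_hom_def)

lemma mod_hom_zero:
  assumes M: "module R M" and N: "module R N" and h: "h \<in> mod_hom R M N"
  shows "h \<zero>\<^bsub>M\<^esub> = \<zero>\<^bsub>N\<^esub>"
proof -
  interpret M: module R M by (rule M)
  interpret N: module R N by (rule N)
  have "h (\<zero> \<odot>\<^bsub>M\<^esub> \<zero>\<^bsub>M\<^esub>) = \<zero> \<odot>\<^bsub>N\<^esub> h \<zero>\<^bsub>M\<^esub>"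
    by (rule mod_homD(4)[OF h]) auto
  then show ?thesis using mod_homD(1)[OF h] by (simp add: M.smult_l_null N.smult_l_null)
qed

lemma mod_hom_free_expand:
  assumes N: "module R N" and h: "h \<in> mod_hom R (free_module R n) N" and x: "x \<in> vecs R n"
  shows "h x = nsum N (\<lambda>i. x i \<odot>\<^bsub>N\<^esub> h (unit_vec R n i)) n"
proof -
  interpret N: module R N by (rule N)
  \<comment> \<open>The truncations of \<open>x\<close> to its first \<open>k\<close> coordinates;
    consecutive ones differ by a multiple of one unit vector.\<close>
  define t where "t k = (\<lambda>i\<in>{..<n}. if i < k then x i else \<zero>)" for k
  have t: "t k \<in> vecs R n" for k
    unfolding t_def using free_moduleD[OF x] by auto
  have "k \<le> n \<Longrightarrow> h (t k) = nsum N (\<lambda>i. x i \<odot>\<^bsub>N\<^esub> h (unit_vec R n i)) k" for k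
  proof (induction k)
    case 0
    have "t 0 = \<zero> \<odot>\<^bsub>free_module R n\<^esub> x"
      by (rule ext) (auto simp: t_def free_module_simps(4) free_moduleD[OF x])
    then show ?case using mod_homD(4)[OF h zero_closed x] mod_homD(1)[OF h x] by (simp add: N.smult_l_null)
  next
    case (Suc k)
    then have k: "k < n" by simp
    then have xk: "x k \<in> carrier R" using free_moduleD[OF x] by blast
    have "t (Suc k) = t k \<oplus>\<^bsub>free_module R n\<^esub> (x k \<odot>\<^bsub>free_module R n\<^esub> unit_vec R n k)"
      by (rule ext) (use xk k free_moduleD[OF x] in \<open>auto simp: t_def free_module_simps(3,4) unit_vec_def less_Suc_eq\<close>)
    then have "h (t (Suc k)) = h (t k) \<oplus>\<^bsub>N\<^esub> (x k \<odot>\<^bsub>N\<^esub> h (unit_vec R n k))"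
      using mod_homD(3)[OF h t free_module_closed(2)[OF xk unit_vec_closed]] mod_homD(4)[OF h xk unit_vec_closed]
      by simp
    then show ?case using Suc by simp
  qed
  moreover have "t n = x" by (rule free_module_eqI[OF t x]) (simp add: t_def)
  ultimately show ?thesis by force
qed

lemma mod_hom_free_ring_expand:
  assumes h: "h \<in> functionals R (free_module R n)" and x: "x \<in> vecs R n"
  shows "h x = nsum R (\<lambda>i. x i \<otimes> h (unit_vec R n i)) n"
  using mod_hom_free_expand[OF module_ring_module h x] by simp

text \<open>The map \<open>h\<close> is only known through its kernel, which \<open>C\<close> cuts
  out. The lemma thus serves both for matrix maps between free modules and for an augmentation onto
  a module that is merely embedded into a free one.\<close>

lemma exact_mat_exact_at:
  assumes ex: "exact_mat R d n m C K" and K: "\<And>j k. j < n \<Longrightarrow> k < m \<Longrightarrow> K j k \<in> carrier R"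
    and ker: "\<And>x. x \<in> vecs R n \<Longrightarrow>
       h x = \<zero>\<^bsub>N\<^esub> \<longleftrightarrow> (\<forall>i<d. rdot R n (C i) x = \<zero>)"
  shows "exact_at (free_module R m) (mat_hom R n m K) (free_module R n) h N"
  unfolding exact_at_def a_kernel_def'
proof (intro equalityI subsetI)
  fix x assume "x \<in> mat_hom R n m K ` vecs R m"
  then obtain y where y: "y \<in> vecs R m" "x = mat_hom R n m K y" by blast
  have x: "x \<in> vecs R n"
    using mod_homD(1)[OF mat_hom_closed[OF K] y(1)] y(2) by simp
  have "\<forall>i<d. rdot R n (C i) x = \<zero>"
  proof -
    have "\<forall>j<n. x j = rdot R m (K j) y" using y by (simp add: mat_hom_def)
    moreover have "\<forall>k<m. y k \<in> carrier R" "\<forall>j<n. x j \<in> carrier R"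
      using free_moduleD[OF x] free_moduleD[OF y(1)] by blast+
    ultimately show ?thesis using exact_matD[OF ex] by blast
  qed
  then show "x \<in> {x \<in> vecs R n. h x = \<zero>\<^bsub>N\<^esub>}" using ker x by blast
next
  fix x assume "x \<in> {x \<in> vecs R n. h x = \<zero>\<^bsub>N\<^esub>}"
  then have x: "x \<in> vecs R n" "\<forall>i<d. rdot R n (C i) x = \<zero>"
    using ker by blast+
  have "\<forall>j<n. x j \<in> carrier R" using free_moduleD[OF x(1)] by blast
  then obtain y where y: "\<forall>k<m. y k \<in> carrier R" "\<forall>j<n. x j = rdot R m (K j) y"
    using exact_matD[OF ex] x(2) by blast
  have y': "restrict y {..<m} \<in> vecs R m" using y by auto
  have "x = mat_hom R n m K (restrict y {..<m})"
    by (rule free_module_eqI[OF x(1) mod_homD(1)[OF mat_hom_closed[OF K] y']])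
      (use y y' in \<open>auto simp: mat_hom_def intro!: nsum_cong\<close>)
  with y' show "x \<in> mat_hom R n m K ` vecs R m" by blast
qed

lemma mat_hom_eq_zero_iff:
  assumes "x \<in> vecs R n"
  shows "mat_hom R d n C x = \<zero>\<^bsub>free_module R d\<^esub> \<longleftrightarrow> (\<forall>i<d. rdot R n (C i) x = \<zero>)"
  using assms by (auto simp: mat_hom_def free_module_simps(2) fun_eq_iff restrict_def)

end

section \<open>Functionals and the vanishing of Ext\<close>

text \<open>One argument for free modules, duals and groups of cocycles: their carriers are sets of
  functions on \<open>A\<close> closed under pointwise operations with values in
  \<open>N\<close>.\<close>

lemma abelian_group_pointwise:
  assumes N: "abelian_group N"
    and Z: "\<And>h. h \<in> carrier G \<Longrightarrow> h \<in> A \<rightarrow>\<^sub>E carrier N"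
    and zero: "\<zero>\<^bsub>G\<^esub> = (\<lambda>x\<in>A. \<zero>\<^bsub>N\<^esub>)" "\<zero>\<^bsub>G\<^esub> \<in> carrier G"
    and add: "add G = (\<lambda>g h. \<lambda>x\<in>A. g x \<oplus>\<^bsub>N\<^esub> h x)"
    and clo: "\<And>g h. g \<in> carrier G \<Longrightarrow> h \<in> carrier G \<Longrightarrow> g \<oplus>\<^bsub>G\<^esub> h \<in> carrier G"
    and neg: "\<And>h. h \<in> carrier G \<Longrightarrow> (\<lambda>x\<in>A. \<ominus>\<^bsub>N\<^esub> h x) \<in> carrier G"
  shows "abelian_group G"
proof (rule abelian_groupI)
  interpret N: abelian_group N by (rule N)
  have val: "h x \<in> carrier N" if "h \<in> carrier G" "x \<in> A" for h x using Z[OF that(1)] that(2) by blast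
  have eqI: "g = h" if "g \<in> carrier G" "h \<in> carrier G" "\<And>x. x \<in> A \<Longrightarrow> g x = h x" for g h
    using Z[OF that(1)] Z[OF that(2)] that(3) by (rule PiE_ext)
  show "x \<oplus>\<^bsub>G\<^esub> y \<in> carrier G" if "x \<in> carrier G" "y \<in> carrier G" for x y using clo that .
  show "\<zero>\<^bsub>G\<^esub> \<in> carrier G" by (rule zero)
  show "x \<oplus>\<^bsub>G\<^esub> y \<oplus>\<^bsub>G\<^esub> z = x \<oplus>\<^bsub>G\<^esub> (y \<oplus>\<^bsub>G\<^esub> z)" if "x \<in> carrier G" "y \<in> carrier G" "z \<in> carrier G" for x y z
    by (rule eqI) (use that in \<open>auto simp: clo\<close>, auto simp: add val N.a_assoc)
  show "x \<oplus>\<^bsub>G\<^esub> y = y \<oplus>\<^bsub>G\<^esub> x" if "x \<in> carrier G" "y \<in> carrier G" for x y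
    by (rule eqI) (use that in \<open>auto simp: clo\<close>, auto simp: add val N.a_comm)
  show "\<zero>\<^bsub>G\<^esub> \<oplus>\<^bsub>G\<^esub> x = x" if "x \<in> carrier G" for x
    by (rule eqI) (use that zero(2) in \<open>auto simp: clo\<close>, auto simp: add zero(1) val)
  show "\<exists>y\<in>carrier G. y \<oplus>\<^bsub>G\<^esub> x = \<zero>\<^bsub>G\<^esub>" if x: "x \<in> carrier G" for x
  proof (rule bexI[OF _ neg[OF x]])
    show "(\<lambda>z\<in>A. \<ominus>\<^bsub>N\<^esub> x z) \<oplus>\<^bsub>G\<^esub> x = \<zero>\<^bsub>G\<^esub>"
      unfolding add zero(1) by (rule restrict_ext) (simp add: val[OF x] N.l_neg)
  qed
qed

context cring
begin

lemma module_free_module: "module R (free_module R n)"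
proof (rule moduleI)
  show "abelian_group (free_module R n)"
    by (rule abelian_group_pointwise[of R _ "{..<n}"])
      (auto simp: free_module_simps is_abelian_group)
qed (auto simp: free_module_simps cring_axioms l_distr r_distr m_assoc fun_eq_iff PiE_def extensional_def Pi_iff)

lemma functional_add:
  assumes M: "module R M" and g: "g \<in> functionals R M" and h: "h \<in> functionals R M"
  shows "(\<lambda>x\<in>carrier M. g x \<oplus> h x) \<in> functionals R M"
proof -
  interpret M: module R M by (rule M)
  note g = mod_homD[OF g, simplified] and h = mod_homD[OF h, simplified]
  show ?thesis by (rule mod_homI) (simp_all add: g h a_ac r_distr)
qed

lemma functional_smult:
  assumes M: "module R M" and a: "a \<in> carrier R" and h: "h \<in> functionals R M"
  shows "(\<lambda>x\<in>carrier M. a \<otimes> h x) \<in> functionals R M"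
proof -
  interpret M: module R M by (rule M)
  note h = mod_homD[OF h, simplified]
  show ?thesis by (rule mod_homI) (simp_all add: a h m_lcomm r_distr)
qed

lemma functional_uminus:
  assumes M: "module R M" and h: "h \<in> functionals R M"
  shows "(\<lambda>x\<in>carrier M. \<ominus> h x) \<in> functionals R M"
proof -
  have "(\<lambda>x\<in>carrier M. \<ominus> h x) = (\<lambda>x\<in>carrier M. \<ominus> \<one> \<otimes> h x)"
    using mod_homD(1)[OF h] by (intro restrict_ext) (simp add: l_minus)
  then show ?thesis using functional_smult[OF M _ h, of "\<ominus> \<one>"] by simp
qed

lemma functional_zero:
  assumes M: "module R M"
  shows "(\<lambda>x\<in>carrier M. \<zero>) \<in> functionals R M"
proof -
  interpret M: module R M by (rule M)
  show ?thesis by (rule mod_homI) simp_all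
qed

lemma module_dual_module:
  assumes M: "module R M"
  shows "module R (dual_module R M)"
proof -
  have val: "h \<in> functionals R M \<Longrightarrow> x \<in> carrier M \<Longrightarrow> h x \<in> carrier R" for h x
    using mod_homD(1) by fastforce
  have ext: "h \<in> functionals R M \<Longrightarrow> (\<lambda>x\<in>carrier M. h x) = h" for h
    using mod_homD(2) by (metis extensional_restrict)
  show ?thesis
  proof (rule moduleI)
    show "abelian_group (dual_module R M)"
      by (rule abelian_group_pointwise[of R _ "carrier M"])
        (simp_all add: dual_module_simps is_abelian_group functional_zero[OF M] functional_add[OF M]
          functional_uminus[OF M], simp add: mod_hom_def)
    show "\<one> \<odot>\<^bsub>dual_module R M\<^esub> h = h" if "h \<in> carrier (dual_module R M)" for h
    proof -
      have "(\<lambda>x\<in>carrier M. \<one> \<otimes> h x) = (\<lambda>x\<in>carrier M. h x)"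
        using that by (intro restrict_ext) (simp add: dual_module_simps val)
      then show ?thesis using that ext by (simp add: dual_module_simps)
    qed
  qed (auto simp: dual_module_simps cring_axioms val functional_smult[OF M] l_distr r_distr m_assoc
      intro!: restrict_ext)
qed

text \<open>If the coboundaries exhaust the cocycles, the quotient is \<open>Z / Z\<close>. What has
  to be checked is that the cocycles form an abelian group, so that the quotient record is a group
  at all.\<close>

lemma trivial_ext_group:
  assumes eq: "ext_coboundaries R (ring_module R) n d i = ext_cocycles R (ring_module R) n d i"
    and d: "d i \<in> mod_hom R (free_module R (n (Suc i))) (free_module R (n i))"
  shows "trivial_group (ext_group R (ring_module R) n d i)"
proof -
  define F where "F = free_module R (n i)"
  define Z where "Z = ext_cocycles R (ring_module R) n d i"
  define G where "G = (hom_module R F (ring_module R))\<lparr>carrier := Z\<rparr>"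
  have F: "module R F" unfolding F_def by (rule module_free_module)
  have dF: "x \<in> vecs R (n (Suc i)) \<Longrightarrow> d i x \<in> carrier F" for x
    using mod_homD(1)[OF d] by (simp add: F_def)
  have Z: "h \<in> Z \<longleftrightarrow> h \<in> functionals R F \<and> (\<forall>x\<in>vecs R (n (Suc i)). h (d i x) = \<zero>)" for h
    by (simp add: Z_def ext_cocycles_def F_def)
  have "abelian_group G"
    by (rule abelian_group_pointwise[of R _ "carrier F"])
      (simp_all add: G_def hom_module_def is_abelian_group Z functional_zero[OF F] functional_add[OF F]
        functional_uminus[OF F] dF, simp add: mod_hom_def)
  then interpret G: abelian_group G .
  have cG: "carrier G = Z" by (simp add: G_def)
  have grp: "group (add_monoid G)" by (rule G.a_group)
  have "Z \<lhd> add_monoid G" using group.normal_self[OF grp] by (simp add: cG)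
  then have "group (add_monoid G Mod Z)" by (rule normal.factorgroup_is_group)
  moreover have "carrier (add_monoid G Mod Z) = {\<one>\<^bsub>add_monoid G Mod Z\<^esub>}"
  proof -
    have "Z #>\<^bsub>add_monoid G\<^esub> x = Z" if "x \<in> Z" for x
      using group.coset_join2[OF grp, of x Z] group.subgroup_self[OF grp] that by (simp add: cG)
    moreover have "Z \<noteq> {}" using G.zero_closed cG by blast
    ultimately show ?thesis unfolding FactGroup_def RCOSETS_def by (auto simp: cG)
  qed
  ultimately show ?thesis
    unfolding trivial_group_def ext_group_def eq A_FactGroup_def G_def F_def Z_def by simp
qed

end

section \<open>Finitely generated torsionless modules\<close>

lemma extension_matD:
  assumes "extension_mat R n m K" "\<forall>k<m. \<phi> k \<in> carrier R"
    "\<And>y. \<forall>k<m. y k \<in> carrier R \<Longrightarrow> \<forall>j<n. rdot R m (K j) y = \<zero>\<^bsub>R\<^esub> \<Longrightarrow>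
       rdot R m \<phi> y = \<zero>\<^bsub>R\<^esub>"
  shows "\<exists>v. (\<forall>j<n. v j \<in> carrier R) \<and> (\<forall>k<m. \<phi> k = nsum R (\<lambda>j. v j \<otimes>\<^bsub>R\<^esub> K j k) n)"
  using assms unfolding extension_mat_def by blast

lemma kernel_dualityD:
  assumes "kernel_duality R" "\<forall>i<d. \<forall>j<n. C i j \<in> carrier R"
  shows "\<exists>m K. (\<forall>j<n. \<forall>k<m. K j k \<in> carrier R) \<and> exact_mat R d n m C K \<and> extension_mat R n m K"
  using assms unfolding kernel_duality_def by blast

text \<open>\<open>M\<close> is generated by the images of the unit vectors under \<open>p\<close> and embedded into \<open>R\<^sup>d\<close> by the
  functionals \<open>\<iota> 0, \<dots>, \<iota> (d - 1)\<close>.\<close>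

locale torsionless_module = cring R for R (structure) +
  fixes M :: "('a, 'm, 'y) module_scheme" and n d :: nat and p :: "(nat \<Rightarrow> 'a) \<Rightarrow> 'm"
    and \<iota> :: "nat \<Rightarrow> 'm \<Rightarrow> 'a"
  assumes kd: "kernel_duality R" and M: "module R M"
    and p: "p \<in> mod_hom R (free_module R n) M"
    and p_onto: "p ` vecs R n = carrier M"
    and \<iota>: "i < d \<Longrightarrow> \<iota> i \<in> functionals R M"
    and \<iota>_inj: "x \<in> carrier M \<Longrightarrow> y \<in> carrier M \<Longrightarrow> (\<And>i. i < d \<Longrightarrow> \<iota> i x = \<iota> i y) \<Longrightarrow> x = y"
begin

text \<open>The matrix of the composite \<open>R^n -> M -> R^d\<close>. As the second map is
  injective, the kernel of this matrix is the kernel of \<open>p\<close>.\<close>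

definition relmat :: "nat \<Rightarrow> nat \<Rightarrow> 'a" where
  "relmat i j = \<iota> i (p (unit_vec R n j))"

lemma relmat_closed: "i < d \<Longrightarrow> relmat i j \<in> carrier R"
  using mod_homD(1)[OF \<iota>] mod_homD(1)[OF p unit_vec_closed] by (fastforce simp: relmat_def)

lemma functional_p:
  assumes f: "f \<in> functionals R M" and x: "x \<in> vecs R n"
  shows "f (p x) = nsum R (\<lambda>j. f (p (unit_vec R n j)) \<otimes> x j) n"
proof -
  have "compose (vecs R n) f p \<in> functionals R (free_module R n)"
    by (rule mod_hom_compose[OF p f]) (rule free_module_closed; assumption)+
  from mod_hom_free_ring_expand[OF this x] have "f (p x) = nsum R (\<lambda>j. x j \<otimes> f (p (unit_vec R n j))) n"
    using x by (simp add: compose_eq)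
  also have "\<dots> = nsum R (\<lambda>j. f (p (unit_vec R n j)) \<otimes> x j) n"
    using mod_homD(1)[OF f] mod_homD(1)[OF p unit_vec_closed]
    by (intro nsum_cong m_comm free_moduleD[OF x]) auto
  finally show ?thesis .
qed

lemma p_zero_iff:
  assumes x: "x \<in> vecs R n"
  shows "p x = \<zero>\<^bsub>M\<^esub> \<longleftrightarrow> (\<forall>i<d. rdot R n (relmat i) x = \<zero>)"
proof -
  interpret M: module R M by (rule M)
  have z: "\<iota> i \<zero>\<^bsub>M\<^esub> = \<zero>" if "i < d" for i
    using mod_hom_zero[OF M module_ring_module \<iota>[OF that]] by simp
  have "p x = \<zero>\<^bsub>M\<^esub> \<longleftrightarrow> (\<forall>i<d. \<iota> i (p x) = \<zero>)"
    using z \<iota>_inj[OF mod_homD(1)[OF p x] M.zero_closed] by metis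
  then show ?thesis using functional_p[OF \<iota> x] by (simp add: relmat_def)
qed

lemma presentation_matrix:
  obtains m K where "\<forall>j<n. \<forall>k<m. K j k \<in> carrier R" "exact_mat R d n m relmat K" "extension_mat R n m K"
    "exact_at (free_module R m) (mat_hom R n m K) (free_module R n) p M"
proof -
  have "\<forall>i<d. \<forall>j<n. relmat i j \<in> carrier R" using relmat_closed by blast
  from kernel_dualityD[OF kd this] obtain m K where K: "\<forall>j<n. \<forall>k<m. K j k \<in> carrier R"
    "exact_mat R d n m relmat K" "extension_mat R n m K" by (elim exE conjE)
  moreover have "exact_at (free_module R m) (mat_hom R n m K) (free_module R n) p M"
    using exact_mat_exact_at[OF K(2) _ p_zero_iff] K(1) by blast
  ultimately show ?thesis using that by blast
qed

lemma finitely_presented: "finitely_presented R M"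
proof -
  obtain m K where K: "\<forall>j<n. \<forall>k<m. K j k \<in> carrier R"
    "exact_at (free_module R m) (mat_hom R n m K) (free_module R n) p M"
    by (rule presentation_matrix)
  have "mat_hom R n m K \<in> mod_hom R (free_module R m) (free_module R n)"
    by (rule mat_hom_closed) (use K(1) in blast)
  then show ?thesis unfolding finitely_presented_def using M p p_onto K(2) by blast
qed

text \<open>A resolution in which every matrix is the kernel matrix of its predecessor, starting from \<open>relmat\<close>.\<close>

lemma ext_vanishes:
  assumes i: "i > 0"
  shows "ext_vanishes R M (ring_module R) i"
proof -
  \<comment> \<open>A state consists of the number of rows, the number of columns and the matrix.
    \<open>Q\<close> says that the next state holds a kernel matrix of the present one, together
    with its extension property.\<close>
  define P where "P t s \<longleftrightarrow> (\<forall>i<fst s. \<forall>j<fst (snd s). snd (snd s) i j \<in> carrier R) \<and>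
      (t = (0::nat) \<longrightarrow> s = (d, n, relmat))" for t and s :: "nat \<times> nat \<times> (nat \<Rightarrow> nat \<Rightarrow> 'a)"
  define Q where "Q t s u \<longleftrightarrow> fst u = fst (snd s) \<and>
      exact_mat R (fst s) (fst u) (fst (snd u)) (snd (snd s)) (snd (snd u)) \<and>
      extension_mat R (fst u) (fst (snd u)) (snd (snd u))" for t :: nat and s u :: "nat \<times> nat \<times> (nat \<Rightarrow> nat \<Rightarrow> 'a)"
  have "\<exists>s. \<forall>t. P t (s t) \<and> Q t (s t) (s (Suc t))"
  proof (rule dependent_nat_choice)
    show "\<exists>s. P 0 s" using relmat_closed by (intro exI[of _ "(d, n, relmat)"]) (simp add: P_def)
    fix s t assume P: "P t s"
    obtain d' n' C where s: "s = (d', n', C)" by (cases s)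
    have "\<forall>i<d'. \<forall>j<n'. C i j \<in> carrier R" using P by (simp add: P_def s)
    from kernel_dualityD[OF kd this] obtain m K where "\<forall>j<n'. \<forall>k<m. K j k \<in> carrier R"
      "exact_mat R d' n' m C K" "extension_mat R n' m K" by (elim exE conjE)
    then show "\<exists>u. P (Suc t) u \<and> Q t s u"
      by (intro exI[of _ "(n', m, K)"]) (simp add: P_def Q_def s)
  qed
  then obtain s where s: "\<And>t. P t (s t)" "\<And>t. Q t (s t) (s (Suc t))" by blast
  define nn where "nn t = fst (snd (s t))" for t
  define B where "B t = snd (snd (s t))" for t
  \<comment> \<open>The index is shifted because \<open>B 0 = relmat\<close> maps to
    \<open>R^d\<close> and is not part of the resolution of \<open>M\<close>; its place is taken by
    \<open>p\<close>. The first differential is the kernel matrix of \<open>relmat\<close>.\<close>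
  define D where "D t = mat_hom R (nn t) (nn (Suc t)) (B (Suc t))" for t
  have s0: "nn 0 = n" "B 0 = relmat" "fst (s 0) = d" using s(1)[of 0] by (auto simp: P_def nn_def B_def)
  have fs: "fst (s (Suc t)) = nn t" for t using s(2)[of t] by (simp add: Q_def nn_def)
  have B: "B (Suc t) j k \<in> carrier R" if "j < nn t" "k < nn (Suc t)" for t j k
    using s(1)[of "Suc t"] that fs[of t] by (simp add: P_def nn_def B_def)
  have ex0: "exact_mat R d n (nn (Suc 0)) relmat (B (Suc 0))"
    using s(2)[of 0] s0 fs[of 0] by (simp add: Q_def nn_def B_def)
  have ex: "exact_mat R (nn t) (nn (Suc t)) (nn (Suc (Suc t))) (B (Suc t)) (B (Suc (Suc t)))" for t
    using s(2)[of "Suc t"] fs[of t] fs[of "Suc t"] by (simp add: Q_def nn_def B_def)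
  have extn: "extension_mat R (nn t) (nn (Suc t)) (B (Suc t))" for t
    using s(2)[of t] fs[of t] by (simp add: Q_def nn_def B_def)
  have D: "D t \<in> mod_hom R (free_module R (nn (Suc t))) (free_module R (nn t))" for t
    unfolding D_def by (rule mat_hom_closed) (rule B)
  have exD: "exact_at (free_module R (nn (Suc (Suc t)))) (D (Suc t)) (free_module R (nn (Suc t))) (D t) (free_module R (nn t))" for t
    unfolding D_def by (rule exact_mat_exact_at[OF ex B]) (simp_all add: mat_hom_eq_zero_iff)
  have res: "free_resolution R M nn D p"
    unfolding free_resolution_def Let_def
  proof (intro conjI allI)
    show "exact_at (free_module R (nn (Suc 0))) (D 0) (free_module R (nn 0)) p M"
      unfolding D_def s0 by (rule exact_mat_exact_at[OF ex0]) (use B[of _ 0] s0 p_zero_iff in auto)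
  qed (use D exD p p_onto s0 in simp_all)
  obtain k where k: "i = Suc k" using i by (cases i) auto
  have DD: "D k (D (Suc k) x) = \<zero>\<^bsub>free_module R (nn k)\<^esub>" if "x \<in> vecs R (nn (Suc (Suc k)))" for x
    using exD[of k] that unfolding exact_at_def a_kernel_def' by blast
  have "ext_coboundaries R (ring_module R) nn D i = ext_cocycles R (ring_module R) nn D i"
  proof (intro equalityI subsetI)
    fix \<phi> assume "\<phi> \<in> ext_coboundaries R (ring_module R) nn D i"
    then obtain \<psi> where \<psi>: "\<psi> \<in> functionals R (free_module R (nn k))"
      "\<phi> = compose (vecs R (nn (Suc k))) \<psi> (D k)"
      by (auto simp: ext_coboundaries_def k)
    have "\<phi> \<in> functionals R (free_module R (nn (Suc k)))"
      unfolding \<psi>(2) by (rule mod_hom_compose[OF D \<psi>(1)]) (rule free_module_closed; assumption)+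
    moreover have "\<phi> (D (Suc k) x) = \<zero>" if x: "x \<in> vecs R (nn (Suc (Suc k)))" for x
      using mod_homD(1)[OF D x] DD[OF x] mod_hom_zero[OF module_free_module module_ring_module \<psi>(1)]
      by (simp add: \<psi>(2) compose_eq)
    ultimately show "\<phi> \<in> ext_cocycles R (ring_module R) nn D i" by (simp add: ext_cocycles_def k)
  next
    fix \<phi> assume "\<phi> \<in> ext_cocycles R (ring_module R) nn D i"
    then have \<phi>: "\<phi> \<in> functionals R (free_module R (nn (Suc k)))"
      "\<And>x. x \<in> vecs R (nn (Suc (Suc k))) \<Longrightarrow> \<phi> (D (Suc k) x) = \<zero>"
      by (auto simp: ext_cocycles_def k)
    define c where "c l = \<phi> (unit_vec R (nn (Suc k)) l)" for l
    have c: "c l \<in> carrier R" for l using mod_homD(1)[OF \<phi>(1)] by (simp add: c_def)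
    have \<phi>x: "\<phi> x = rdot R (nn (Suc k)) c x" if x: "x \<in> vecs R (nn (Suc k))" for x
      unfolding mod_hom_free_ring_expand[OF \<phi>(1) x] c_def[symmetric]
      by (rule nsum_cong) (use c free_moduleD[OF x] m_comm in auto)
    \<comment> \<open>A cocycle vanishes on the image of \<open>D (Suc k)\<close>, which is the
      kernel of \<open>B (Suc k)\<close>. The extension property of that matrix writes its
      coordinates as \<open>v B (Suc k)\<close>, and \<open>v\<close> is the cochain whose
      coboundary it is.\<close>
    have "\<exists>v. (\<forall>j<nn k. v j \<in> carrier R) \<and> (\<forall>l<nn (Suc k). c l = nsum R (\<lambda>j. v j \<otimes> B (Suc k) j l) (nn k))"
    proof (rule extension_matD[OF extn])
      fix y assume y: "\<forall>l<nn (Suc k). y l \<in> carrier R"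
        and z: "\<forall>j<nn k. nsum R (\<lambda>l. B (Suc k) j l \<otimes> y l) (nn (Suc k)) = \<zero>"
      define x where "x = restrict y {..<nn (Suc k)}"
      have x: "x \<in> vecs R (nn (Suc k))" unfolding x_def using y by auto
      have "nsum R (\<lambda>l. B (Suc k) j l \<otimes> x l) (nn (Suc k)) = nsum R (\<lambda>l. B (Suc k) j l \<otimes> y l) (nn (Suc k))" for j
        by (rule nsum_cong) (simp add: x_def)
      then have "D k x = \<zero>\<^bsub>free_module R (nn k)\<^esub>"
        unfolding D_def mat_hom_eq_zero_iff[OF x] using z by simp
      then obtain w where "w \<in> vecs R (nn (Suc (Suc k)))" "x = D (Suc k) w"
        using exD[of k] x unfolding exact_at_def a_kernel_def' by blast
      then have "\<phi> x = \<zero>" using \<phi>(2) by simp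
      moreover have "rdot R (nn (Suc k)) c x = rdot R (nn (Suc k)) c y"
        by (rule nsum_cong) (simp add: x_def)
      ultimately show "rdot R (nn (Suc k)) c y = \<zero>" using \<phi>x[OF x] by simp
    qed (use c in simp)
    then obtain v where v: "\<forall>j<nn k. v j \<in> carrier R"
      "\<forall>l<nn (Suc k). c l = nsum R (\<lambda>j. v j \<otimes> B (Suc k) j l) (nn k)" by blast
    \<comment> \<open>The functional with coordinates \<open>v\<close>, taken as the single
      coordinate of a map into \<open>R^1\<close>, so that linearity comes from
      \<open>mat_hom_closed\<close>.\<close>
    define \<psi> where "\<psi> x = mat_hom R 1 (nn k) (\<lambda>_. v) x 0" for x
    define \<psi>' where "\<psi>' = restrict \<psi> (vecs R (nn k))"
    have \<psi>x: "\<psi>' x = rdot R (nn k) v x" if "x \<in> vecs R (nn k)" for x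
      using that by (simp add: \<psi>'_def \<psi>_def mat_hom_def)
    have mh: "mat_hom R 1 (nn k) (\<lambda>_. v) \<in> mod_hom R (free_module R (nn k)) (free_module R 1)"
      by (rule mat_hom_closed) (use v in blast)
    have "\<psi>' \<in> functionals R (free_module R (nn k))"
    proof (rule mod_homI)
      fix x assume x: "x \<in> vecs R (nn k)"
      show "\<psi>' x \<in> carrier (ring_module R)"
        using free_moduleD[OF mod_homD(1)[OF mh x], of 0] x by (simp add: \<psi>'_def \<psi>_def)
      show "\<psi>' (x \<oplus>\<^bsub>free_module R (nn k)\<^esub> y) = \<psi>' x \<oplus>\<^bsub>ring_module R\<^esub> \<psi>' y"
        if y: "y \<in> vecs R (nn k)" for y
        using x y free_module_closed(1)[OF x y] mod_homD(3)[OF mh x y]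
        by (simp add: \<psi>'_def \<psi>_def free_module_simps(3)[of R "Suc 0"])
    next
      fix a x assume a: "a \<in> carrier R" and x: "x \<in> vecs R (nn k)"
      show "\<psi>' (a \<odot>\<^bsub>free_module R (nn k)\<^esub> x) = a \<odot>\<^bsub>ring_module R\<^esub> \<psi>' x"
        using x free_module_closed(2)[OF a x] mod_homD(4)[OF mh a x]
        by (simp add: \<psi>'_def \<psi>_def free_module_simps(4)[of R "Suc 0"])
    qed (simp add: \<psi>'_def)
    moreover have "\<phi> = compose (vecs R (nn (Suc k))) \<psi>' (D k)"
    proof (rule extensionalityI[of _ "vecs R (nn (Suc k))"])
      fix x assume x: "x \<in> vecs R (nn (Suc k))"
      have "\<psi>' (D k x) = rdot R (nn k) v (D k x)"
        by (rule \<psi>x) (rule mod_homD(1)[OF D x])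
      also have "\<dots> = nsum R (\<lambda>j. v j \<otimes> nsum R (\<lambda>l. B (Suc k) j l \<otimes> x l) (nn (Suc k))) (nn k)"
        by (rule nsum_cong) (simp add: D_def mat_hom_def x)
      also have "\<dots> = nsum R (\<lambda>l. nsum R (\<lambda>j. v j \<otimes> B (Suc k) j l) (nn k) \<otimes> x l) (nn (Suc k))"
        by (rule nsum_matrix_assoc) (use v B free_moduleD[OF x] in auto)
      also have "\<dots> = \<phi> x" unfolding \<phi>x[OF x] by (rule nsum_cong) (use v in simp)
      finally show "\<phi> x = compose (vecs R (nn (Suc k))) \<psi>' (D k) x"
        using x by (simp add: compose_eq)
    qed (use mod_homD(2)[OF \<phi>(1)] in auto)
    ultimately show "\<phi> \<in> ext_coboundaries R (ring_module R) nn D i"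
      by (auto simp: ext_coboundaries_def k)
  qed
  then have "trivial_group (ext_group R (ring_module R) nn D i)"
    by (rule trivial_ext_group) (rule D)
  with res show ?thesis unfolding ext_vanishes_def by blast
qed

section \<open>The dual and reflexivity\<close>

text \<open>Independent of the chosen preimages only if the functional with coordinates \<open>w\<close> vanishes on the kernel of \<open>p\<close>.\<close>

definition induced :: "(nat \<Rightarrow> 'a) \<Rightarrow> 'm \<Rightarrow> 'a" where
  "induced w = (\<lambda>a\<in>carrier M. nsum R (\<lambda>j. w j \<otimes> (SOME x. x \<in> vecs R n \<and> p x = a) j) n)"

context
  fixes w :: "nat \<Rightarrow> 'a"
  assumes w: "\<forall>j<n. w j \<in> carrier R"
    and kill: "\<And>x. x \<in> vecs R n \<Longrightarrow> p x = \<zero>\<^bsub>M\<^esub> \<Longrightarrow> rdot R n w x = \<zero>"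
begin

lemma induced_p:
  assumes x: "x \<in> vecs R n"
  shows "induced w (p x) = rdot R n w x"
proof -
  interpret M: module R M by (rule M)
  define s where "s = (SOME s. s \<in> vecs R n \<and> p s = p x)"
  have s: "s \<in> vecs R n" "p s = p x"
    using someI[of "\<lambda>s. s \<in> vecs R n \<and> p s = p x" x] x by (auto simp: s_def)
  define y where "y = (\<lambda>i\<in>{..<n}. s i \<ominus> x i)"
  note sR = free_moduleD[OF s(1)] and xR = free_moduleD[OF x]
  have y: "y \<in> vecs R n" unfolding y_def using sR xR by auto
  have yx: "y \<oplus>\<^bsub>free_module R n\<^esub> x = s"
    by (rule free_module_eqI[OF free_module_closed(1)[OF y x] s(1)])
      (use sR xR in \<open>auto simp: y_def free_module_simps(3) minus_eq a_assoc l_neg\<close>)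
  have "p y \<oplus>\<^bsub>M\<^esub> p x = p x" using mod_homD(3)[OF p y x] yx s(2) by simp
  then have py: "p y = \<zero>\<^bsub>M\<^esub>"
    using M.add.right_cancel[of "p x" "p y" "\<zero>\<^bsub>M\<^esub>"] mod_homD(1)[OF p x] mod_homD(1)[OF p y] by simp
  have "induced w (p x) = rdot R n w s"
    using mod_homD(1)[OF p x] by (simp add: induced_def s_def)
  also have "\<dots> = nsum R (\<lambda>j. w j \<otimes> y j \<oplus> w j \<otimes> x j) n"
    using w sR xR free_moduleD[OF y]
    by (intro nsum_cong) (simp add: yx[symmetric] free_module_simps(3) r_distr)
  also have "\<dots> = rdot R n w y \<oplus> rdot R n w x"
    by (rule nsum_add) (use w xR free_moduleD[OF y] in auto)
  also have "\<dots> = rdot R n w x"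
    using kill[OF y py] w xR by simp
  finally show ?thesis .
qed

lemma induced_functional: "induced w \<in> functionals R M"
proof (rule mod_homI)
  fix a assume "a \<in> carrier M"
  then obtain x where x: "x \<in> vecs R n" "a = p x" using p_onto by blast
  note xR = free_moduleD[OF x(1)]
  show "induced w a \<in> carrier (ring_module R)"
    unfolding x(2) induced_p[OF x(1)] using w xR by simp
  show "induced w (a \<oplus>\<^bsub>M\<^esub> b) = induced w a \<oplus>\<^bsub>ring_module R\<^esub> induced w b" if "b \<in> carrier M" for b
  proof -
    obtain y where y: "y \<in> vecs R n" "b = p y" using \<open>b \<in> carrier M\<close> p_onto by blast
    note yR = free_moduleD[OF y(1)]
    have "induced w (a \<oplus>\<^bsub>M\<^esub> b) = nsum R (\<lambda>j. w j \<otimes> (x \<oplus>\<^bsub>free_module R n\<^esub> y) j) n"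
      unfolding x(2) y(2) mod_homD(3)[OF p x(1) y(1), symmetric]
      by (rule induced_p) (rule free_module_closed x y)+
    also have "\<dots> = nsum R (\<lambda>j. w j \<otimes> x j \<oplus> w j \<otimes> y j) n"
      by (rule nsum_cong) (use w xR yR in \<open>simp add: free_module_simps(3) r_distr\<close>)
    also have "\<dots> = rdot R n w x \<oplus> rdot R n w y"
      by (rule nsum_add) (use w xR yR in auto)
    finally show ?thesis by (simp add: x(2) y(2) induced_p x(1) y(1))
  qed
  show "induced w (r \<odot>\<^bsub>M\<^esub> a) = r \<odot>\<^bsub>ring_module R\<^esub> induced w a" if r: "r \<in> carrier R" for r
  proof -
    have "induced w (r \<odot>\<^bsub>M\<^esub> a) = nsum R (\<lambda>j. w j \<otimes> (r \<odot>\<^bsub>free_module R n\<^esub> x) j) n"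
      unfolding x(2) mod_homD(4)[OF p r x(1), symmetric]
      by (rule induced_p) (rule free_module_closed x r)+
    also have "\<dots> = nsum R (\<lambda>j. r \<otimes> (w j \<otimes> x j)) n"
      by (rule nsum_cong) (use w xR r in \<open>simp add: free_module_simps(4) m_lcomm\<close>)
    also have "\<dots> = r \<otimes> rdot R n w x"
      by (subst nsum_rdistr) (use w xR r in auto)
    finally show ?thesis by (simp add: x(2) induced_p x(1))
  qed
qed (simp add: induced_def)

end

lemma functional_eqI:
  assumes f: "f \<in> functionals R M" and g: "g \<in> functionals R M"
    and eq: "\<And>j. j < n \<Longrightarrow> f (p (unit_vec R n j)) = g (p (unit_vec R n j))"
  shows "f = g"
proof (rule extensionalityI[OF mod_homD(2)[OF f] mod_homD(2)[OF g]])
  fix a assume "a \<in> carrier M"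
  then obtain x where x: "x \<in> vecs R n" "a = p x" using p_onto by blast
  show "f a = g a"
    unfolding x(2) functional_p[OF f x(1)] functional_p[OF g x(1)] by (rule nsum_cong) (simp add: eq)
qed

text \<open>The dual consists of the functionals \<open>induced w\<close>, where \<open>w\<close> runs over the kernel of the transposed
  presentation matrix; \<open>E\<close> is the matrix generating that kernel.\<close>

lemma dual_presentation:
  obtains q E p' where "\<forall>j<n. \<forall>k<q. E j k \<in> carrier R" "extension_mat R n q E"
    "torsionless_module R (dual_module R M) q n p' (\<lambda>i. \<lambda>\<phi>\<in>carrier (dual_module R M). \<phi> (p (unit_vec R n i)))"
    "\<forall>y\<in>vecs R q. \<forall>x\<in>vecs R n.
       p' y (p x) = nsum R (\<lambda>j. rdot R q (E j) y \<otimes> x j) n"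
proof -
  obtain m K where K: "\<forall>j<n. \<forall>k<m. K j k \<in> carrier R"
    and ex: "exact_at (free_module R m) (mat_hom R n m K) (free_module R n) p M"
    by (rule presentation_matrix)
  \<comment> \<open>A functional on \<open>M\<close> amounts to a row \<open>w\<close> with
    \<open>w K = 0\<close>, that is, to an element of the kernel of the transposed matrix.\<close>
  have "\<forall>k<m. \<forall>j<n. K j k \<in> carrier R" using K by blast
  from kernel_dualityD[OF kd, of m n "\<lambda>k j. K j k", OF this]
  obtain q E where E: "\<forall>j<n. \<forall>k<q. E j k \<in> carrier R"
    and exE: "exact_mat R m n q (\<lambda>k j. K j k) E" and extE: "extension_mat R n q E" by (elim exE conjE)
  define p' where "p' = (\<lambda>y\<in>vecs R q. induced (\<lambda>j. rdot R q (E j) y))"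
  have Ey: "rdot R q (E j) y \<in> carrier R" if "y \<in> vecs R q" "j < n" for y j
    using that E free_moduleD[OF that(1)] by auto
  have kill: "nsum R (\<lambda>j. rdot R q (E j) y \<otimes> x j) n = \<zero>"
    if y: "y \<in> vecs R q" and x: "x \<in> vecs R n" "p x = \<zero>\<^bsub>M\<^esub>" for x y
  proof -
    define w where "w j = rdot R q (E j) y" for j
    have w: "\<forall>j<n. w j \<in> carrier R" using Ey[OF y] by (simp add: w_def)
    have "x \<in> mat_hom R n m K ` vecs R m"
      using ex x unfolding exact_at_def a_kernel_def' by blast
    then obtain z where z: "z \<in> vecs R m" "x = mat_hom R n m K z" by blast
    have "\<exists>y. (\<forall>k<q. y k \<in> carrier R) \<and> (\<forall>j<n. w j = rdot R q (E j) y)"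
      using free_moduleD[OF y] by (intro exI[of _ y]) (simp add: w_def)
    then have Kw: "\<forall>k<m. nsum R (\<lambda>j. K j k \<otimes> w j) n = \<zero>"
      using exact_matD[OF exE w] by blast
    have "rdot R n w x = nsum R (\<lambda>j. w j \<otimes> rdot R m (K j) z) n"
      by (rule nsum_cong) (simp add: z mat_hom_def)
    also have "\<dots> = nsum R (\<lambda>k. nsum R (\<lambda>j. w j \<otimes> K j k) n \<otimes> z k) m"
      by (rule nsum_matrix_assoc) (use w K free_moduleD[OF z(1)] in auto)
    also have "\<dots> = \<zero>"
    proof (rule nsum_zero)
      fix k assume k: "k < m"
      have "nsum R (\<lambda>j. w j \<otimes> K j k) n = nsum R (\<lambda>j. K j k \<otimes> w j) n"
        by (rule nsum_cong) (use w K k m_comm in auto)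
      then show "nsum R (\<lambda>j. w j \<otimes> K j k) n \<otimes> z k = \<zero>" using Kw k free_moduleD[OF z(1)] by simp
    qed
    finally show ?thesis by (simp add: w_def)
  qed
  have Ey': "\<forall>j<n. rdot R q (E j) y \<in> carrier R" if "y \<in> vecs R q" for y
    using Ey[OF that] by blast
  have p'_eq: "p' y = induced (\<lambda>j. rdot R q (E j) y)" if "y \<in> vecs R q" for y
    using that by (simp add: p'_def)
  have val: "p' y (p x) = nsum R (\<lambda>j. rdot R q (E j) y \<otimes> x j) n"
    if y: "y \<in> vecs R q" and x: "x \<in> vecs R n" for x y
    unfolding p'_eq[OF y] by (rule induced_p[OF Ey'[OF y] _ x]) (rule kill[OF y])
  have p'd: "p' y \<in> functionals R M" if y: "y \<in> vecs R q" for y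
    unfolding p'_eq[OF y] by (rule induced_functional[OF Ey'[OF y]]) (rule kill[OF y])
  have pe: "p (unit_vec R n j) \<in> carrier M" for j by (rule mod_homD(1)[OF p unit_vec_closed])
  have pu: "p' y (p (unit_vec R n j)) = rdot R q (E j) y"
    if y: "y \<in> vecs R q" and j: "j < n" for y j
  proof -
    have "p' y (p (unit_vec R n j)) = nsum R (\<lambda>l. rdot R q (E l) y \<otimes> unit_vec R n j l) n"
      by (rule val[OF y unit_vec_closed])
    also have "\<dots> = rdot R q (E j) y \<otimes> unit_vec R n j j"
      by (rule nsum_delta[OF j]) (use Ey[OF y] j in \<open>auto simp: unit_vec_def\<close>)
    finally show ?thesis using Ey[OF y j] j by (simp add: unit_vec_def)
  qed
  have "torsionless_module R (dual_module R M) q n p' (\<lambda>i. \<lambda>\<phi>\<in>carrier (dual_module R M). \<phi> (p (unit_vec R n i)))"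
  proof (intro torsionless_module.intro torsionless_module_axioms.intro)
    show "p' \<in> mod_hom R (free_module R q) (dual_module R M)"
    proof (rule mod_homI)
      fix y assume y: "y \<in> vecs R q"
      then show "p' y \<in> carrier (dual_module R M)" using p'd by (simp add: dual_module_simps)
      fix z assume z: "z \<in> vecs R q"
      show "p' (y \<oplus>\<^bsub>free_module R q\<^esub> z) = p' y \<oplus>\<^bsub>dual_module R M\<^esub> p' z"
        unfolding dual_module_simps
      proof (rule functional_eqI)
        fix j assume j: "j < n"
        show "p' (y \<oplus>\<^bsub>free_module R q\<^esub> z) (p (unit_vec R n j)) =
            (\<lambda>x\<in>carrier M. p' y x \<oplus> p' z x) (p (unit_vec R n j))"
          using pe pu[OF y j] pu[OF z j] pu[OF free_module_closed(1)[OF y z] j] E j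
            free_moduleD[OF y] free_moduleD[OF z]
          by (auto simp: free_module_simps(3) r_distr nsum_add[symmetric] intro!: nsum_cong)
      qed (auto intro!: p'd functional_add M y z free_module_closed)
    next
      fix a y assume a: "a \<in> carrier R" and y: "y \<in> vecs R q"
      show "p' (a \<odot>\<^bsub>free_module R q\<^esub> y) = a \<odot>\<^bsub>dual_module R M\<^esub> p' y"
        unfolding dual_module_simps
      proof (rule functional_eqI)
        fix j assume j: "j < n"
        show "p' (a \<odot>\<^bsub>free_module R q\<^esub> y) (p (unit_vec R n j)) =
            (\<lambda>x\<in>carrier M. a \<otimes> p' y x) (p (unit_vec R n j))"
          using pe pu[OF y j] pu[OF free_module_closed(2)[OF a y] j] E j a free_moduleD[OF y]
          by (auto simp: free_module_simps(4) m_lcomm nsum_rdistr intro!: nsum_cong)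
      qed (auto intro!: p'd functional_smult M y a free_module_closed)
    qed (simp add: p'_def)
    show "p' ` vecs R q = carrier (dual_module R M)"
    proof (intro equalityI subsetI)
      fix \<phi> assume "\<phi> \<in> carrier (dual_module R M)"
      then have \<phi>: "\<phi> \<in> functionals R M" by (simp add: dual_module_simps)
      define w where "w j = \<phi> (p (unit_vec R n j))" for j
      have w: "w j \<in> carrier R" for j using mod_homD(1)[OF \<phi> pe] by (simp add: w_def)
      have "nsum R (\<lambda>j. K j k \<otimes> w j) n = \<zero>" if k: "k < m" for k
      proof -
        \<comment> \<open>Column \<open>k\<close> of the presentation matrix. It is killed by
          \<open>p\<close>, so the coordinates of \<open>\<phi>\<close> satisfy the corresponding
          equation.\<close>
        define x where "x = mat_hom R n m K (unit_vec R m k)"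
        have "mat_hom R n m K \<in> mod_hom R (free_module R m) (free_module R n)"
          by (rule mat_hom_closed) (use K in blast)
        then have x: "x \<in> vecs R n"
          unfolding x_def by (rule mod_homD(1)) (rule unit_vec_closed)
        have xj: "x j = K j k" if j: "j < n" for j
        proof -
          have "x j = rdot R m (K j) (unit_vec R m k)"
            using j by (simp add: x_def mat_hom_def)
          also have "\<dots> = K j k \<otimes> unit_vec R m k k"
            by (rule nsum_delta[OF k]) (use K j k in \<open>auto simp: unit_vec_def\<close>)
          finally show ?thesis using K j k by (simp add: unit_vec_def)
        qed
        have "p x = \<zero>\<^bsub>M\<^esub>"
          using ex unfolding exact_at_def a_kernel_def' x_def by (blast intro: unit_vec_closed)
        then have "\<phi> (p x) = \<zero>" using mod_hom_zero[OF M module_ring_module \<phi>] by simp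
        then have "rdot R n w x = \<zero>"
          using functional_p[OF \<phi> x] by (simp add: w_def)
        moreover have "rdot R n w x = nsum R (\<lambda>j. K j k \<otimes> w j) n"
          by (rule nsum_cong) (use xj w K k m_comm in auto)
        ultimately show ?thesis by simp
      qed
      then obtain y where y: "\<forall>k<q. y k \<in> carrier R" "\<forall>j<n. w j = rdot R q (E j) y"
        using exact_matD[OF exE, of w] w by blast
      define y' where "y' = restrict y {..<q}"
      have y': "y' \<in> vecs R q" using y by (auto simp: y'_def)
      have "\<phi> = p' y'"
      proof (rule functional_eqI[OF \<phi> p'd[OF y']])
        fix j assume j: "j < n"
        have "rdot R q (E j) y' = rdot R q (E j) y"
          by (rule nsum_cong) (simp add: y'_def)
        then show "\<phi> (p (unit_vec R n j)) = p' y' (p (unit_vec R n j))"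
          using pu[OF y' j] y(2) j by (simp add: w_def)
      qed
      then show "\<phi> \<in> p' ` vecs R q" using y' by blast
    qed (auto simp: dual_module_simps p'd)
    \<comment> \<open>The evaluations at the generators \<open>p e_i\<close> embed the dual into
      \<open>R^n\<close>; the dual is therefore torsionless as well, and the locale can be applied
      to it again.\<close>
    show "(\<lambda>\<phi>\<in>carrier (dual_module R M). \<phi> (p (unit_vec R n i))) \<in> mod_hom R (dual_module R M) (ring_module R)" for i
    proof -
      have "\<phi> (p (unit_vec R n i)) \<in> carrier R" if "\<phi> \<in> functionals R M" for \<phi>
        using mod_homD(1)[OF that pe[of i]] by simp
      then show ?thesis
        by (intro mod_homI) (simp_all add: dual_module_simps functional_add[OF M] functional_smult[OF M] pe)
    qed
    show "\<phi> = \<psi>" if "\<phi> \<in> carrier (dual_module R M)" "\<psi> \<in> carrier (dual_module R M)"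
      "\<And>i. i < n \<Longrightarrow> (\<lambda>\<phi>\<in>carrier (dual_module R M). \<phi> (p (unit_vec R n i))) \<phi> = (\<lambda>\<phi>\<in>carrier (dual_module R M). \<phi> (p (unit_vec R n i))) \<psi>"
      for \<phi> \<psi>
      using that by (intro functional_eqI) (simp_all add: dual_module_simps)
  qed (use cring_axioms kd module_dual_module[OF M] in auto)
  with E extE val show ?thesis using that by blast
qed

text \<open>Injectivity of evaluation is the embedding by the functionals \<open>\<iota> i\<close>.
  For surjectivity, a functional \<open>g\<close> on the dual gives a row \<open>w\<close> on
  \<open>R^q\<close> that vanishes on the kernel of \<open>E\<close>, since \<open>E y = 0\<close>
  forces \<open>p' y = 0\<close>. The extension property of \<open>E\<close> writes
  \<open>w = v E\<close>, and \<open>g\<close> is evaluation at \<open>p v\<close>.\<close>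

lemma reflexive_module: "reflexive_module R M"
proof -
  define D where "D = dual_module R M"
  obtain q E p' where E: "\<forall>j<n. \<forall>k<q. E j k \<in> carrier R" and extE: "extension_mat R n q E"
    and T: "torsionless_module R D q n p' (\<lambda>i. \<lambda>\<phi>\<in>carrier D. \<phi> (p (unit_vec R n i)))"
    and val': "\<forall>y\<in>vecs R q. \<forall>x\<in>vecs R n.
       p' y (p x) = nsum R (\<lambda>j. rdot R q (E j) y \<otimes> x j) n"
    unfolding D_def by (rule dual_presentation)
  note val = val'[rule_format]
  interpret T: torsionless_module R D q n p' "\<lambda>i. \<lambda>\<phi>\<in>carrier D. \<phi> (p (unit_vec R n i))" by (rule T)
  interpret M: module R M by (rule M)
  have D: "\<phi> \<in> carrier D \<longleftrightarrow> \<phi> \<in> functionals R M" for \<phi>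
    by (simp add: D_def dual_module_simps)
  have D_add: "\<phi> \<oplus>\<^bsub>D\<^esub> \<psi> = (\<lambda>x\<in>carrier M. \<phi> x \<oplus> \<psi> x)" for \<phi> \<psi>
    by (simp add: D_def dual_module_simps)
  have D_smult: "a \<odot>\<^bsub>D\<^esub> \<phi> = (\<lambda>x\<in>carrier M. a \<otimes> \<phi> x)" for a \<phi>
    by (simp add: D_def dual_module_simps)
  have Dval: "\<phi> x \<in> carrier R" if "\<phi> \<in> carrier D" "x \<in> carrier M" for \<phi> x
    using mod_homD(1)[OF that(1)[unfolded D] that(2)] by simp
  define ev where "ev = (\<lambda>x\<in>carrier M. \<lambda>\<phi>\<in>carrier D. \<phi> x)"
  have ev: "ev x \<in> functionals R D" if x: "x \<in> carrier M" for x
    by (rule mod_homI) (use x Dval in \<open>simp_all add: ev_def D D_add D_smult functional_add[OF M] functional_smult[OF M]\<close>)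
  have "ev \<in> mod_hom R M (dual_module R D)"
  proof (rule mod_homI)
    fix x assume x: "x \<in> carrier M"
    show "ev x \<in> carrier (dual_module R D)" using ev[OF x] by (simp add: dual_module_simps)
    show "ev (x \<oplus>\<^bsub>M\<^esub> y) = ev x \<oplus>\<^bsub>dual_module R D\<^esub> ev y" if y: "y \<in> carrier M" for y
      using x y by (auto simp: ev_def dual_module_simps(3) mod_homD(3)[OF D[THEN iffD1]] intro!: restrict_ext)
    show "ev (a \<odot>\<^bsub>M\<^esub> x) = a \<odot>\<^bsub>dual_module R D\<^esub> ev x" if a: "a \<in> carrier R" for a
      using x a by (auto simp: ev_def dual_module_simps(4) mod_homD(4)[OF D[THEN iffD1]] intro!: restrict_ext)
  qed (simp add: ev_def)
  moreover have "bij_betw ev (carrier M) (carrier (dual_module R D))"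
  proof (rule bij_betw_imageI)
    show "inj_on ev (carrier M)"
    proof (rule inj_onI)
      fix x y assume x: "x \<in> carrier M" and y: "y \<in> carrier M" and eq: "ev x = ev y"
      show "x = y"
      proof (rule \<iota>_inj[OF x y])
        fix i assume "i < d"
        then have i: "\<iota> i \<in> carrier D" using \<iota> by (simp add: D)
        then show "\<iota> i x = \<iota> i y" using fun_cong[OF eq, of "\<iota> i"] x y by (simp add: ev_def)
      qed
    qed
    show "ev ` carrier M = carrier (dual_module R D)"
    proof (intro equalityI subsetI)
      fix g assume "g \<in> carrier (dual_module R D)"
      then have g: "g \<in> functionals R D" by (simp add: dual_module_simps)
      define w where "w k = g (p' (unit_vec R q k))" for k
      have w: "\<forall>k<q. w k \<in> carrier R"
        using mod_homD(1)[OF g mod_homD(1)[OF T.p unit_vec_closed]] by (simp add: w_def)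
      have gp: "g (p' y) = rdot R q w y" if "y \<in> vecs R q" for y
        using T.functional_p[OF g that] by (simp add: w_def)
      have "\<exists>v. (\<forall>j<n. v j \<in> carrier R) \<and> (\<forall>k<q. w k = nsum R (\<lambda>j. v j \<otimes> E j k) n)"
      proof (rule extension_matD[OF extE w])
        fix y assume y: "\<forall>k<q. y k \<in> carrier R" and z: "\<forall>j<n. rdot R q (E j) y = \<zero>"
        define y' where "y' = restrict y {..<q}"
        have y': "y' \<in> vecs R q" using y by (auto simp: y'_def)
        have sy: "rdot R q h y' = rdot R q h y" for h
          by (rule nsum_cong) (simp add: y'_def)
        have "p' y' = (\<lambda>x\<in>carrier M. \<zero>)"
        proof (rule functional_eqI)
          show "p' y' \<in> functionals R M" using mod_homD(1)[OF T.p y'] by (simp add: D)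
          fix j assume "j < n"
          have "p' y' (p (unit_vec R n j)) = nsum R (\<lambda>l. rdot R q (E l) y \<otimes> unit_vec R n j l) n"
            unfolding val[OF y' unit_vec_closed] sy ..
          also have "\<dots> = \<zero>"
            by (rule nsum_zero) (use z in \<open>simp add: free_moduleD[OF unit_vec_closed]\<close>)
          finally show "p' y' (p (unit_vec R n j)) = (\<lambda>x\<in>carrier M. \<zero>) (p (unit_vec R n j))"
            using mod_homD(1)[OF p unit_vec_closed] by simp
        qed (rule functional_zero[OF M])
        also have "\<dots> = \<zero>\<^bsub>D\<^esub>" by (simp add: D_def dual_module_simps)
        finally show "rdot R q w y = \<zero>"
          using gp[OF y'] mod_hom_zero[OF T.M module_ring_module g] by (simp add: sy)
      qed
      then obtain v where v: "\<forall>j<n. v j \<in> carrier R" "\<forall>k<q. w k = nsum R (\<lambda>j. v j \<otimes> E j k) n" by blast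
      define x where "x = restrict v {..<n}"
      have x: "x \<in> vecs R n" using v by (auto simp: x_def)
      have px: "p x \<in> carrier M" by (rule mod_homD(1)[OF p x])
      have "g = ev (p x)"
      proof (rule extensionalityI[OF mod_homD(2)[OF g] mod_homD(2)[OF ev[OF px]]])
        fix \<phi> assume \<phi>: "\<phi> \<in> carrier D"
        then obtain y where y: "y \<in> vecs R q" "\<phi> = p' y" using T.p_onto by blast
        note yR = free_moduleD[OF y(1)]
        have "g \<phi> = nsum R (\<lambda>k. nsum R (\<lambda>j. v j \<otimes> E j k) n \<otimes> y k) q"
          unfolding y(2) gp[OF y(1)] by (rule nsum_cong) (use v in simp)
        also have "\<dots> = nsum R (\<lambda>j. v j \<otimes> rdot R q (E j) y) n"
          by (rule nsum_matrix_assoc[symmetric]) (use v E yR in auto)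
        also have "\<dots> = nsum R (\<lambda>j. rdot R q (E j) y \<otimes> x j) n"
          by (rule nsum_cong) (use v E yR in \<open>auto simp: x_def intro!: m_comm nsum_closed\<close>)
        also have "\<dots> = \<phi> (p x)" unfolding y(2) val[OF y(1) x] ..
        also have "\<dots> = ev (p x) \<phi>" using px \<phi> by (simp add: ev_def)
        finally show "g \<phi> = ev (p x) \<phi>" .
      qed
      then show "g \<in> ev ` carrier M" using px by blast
    qed (use ev in \<open>auto simp: dual_module_simps\<close>)
  qed
  ultimately show ?thesis unfolding reflexive_module_def Let_def D_def ev_def by blast
qed

text \<open>The dual is finitely generated and torsionless, so the vanishing of Ext proved for
  \<open>M\<close> holds for it by the same lemma.\<close>

lemma gdim_zero: "carrier M \<noteq> {\<zero>\<^bsub>M\<^esub>} \<Longrightarrow> gdim_zero R M"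
proof -
  assume nz: "carrier M \<noteq> {\<zero>\<^bsub>M\<^esub>}"
  obtain q E p' where
    T: "torsionless_module R (dual_module R M) q n p' (\<lambda>i. \<lambda>\<phi>\<in>carrier (dual_module R M). \<phi> (p (unit_vec R n i)))"
    by (rule dual_presentation)
  show ?thesis
    unfolding gdim_zero_def
    using nz finitely_presented reflexive_module ext_vanishes torsionless_module.ext_vanishes[OF T] by blast
qed

end

section \<open>Finitely generated ideals\<close>

text \<open>The elements have to be renamed because \<^const>\<open>finite_gdim\<close> only admits modules whose elements are sets of
  vectors.\<close>

definition ideal_copy ::
  "('a, 'x) ring_scheme \<Rightarrow> 'a set \<Rightarrow> ('a \<Rightarrow> 'm) \<Rightarrow> ('m \<Rightarrow> 'a) \<Rightarrow> ('a, 'm) module" where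
  "ideal_copy R I enc dec = \<lparr>carrier = enc ` I, monoid.mult = undefined, one = undefined,
     ring.zero = enc \<zero>\<^bsub>R\<^esub>, add = (\<lambda>u v. enc (dec u \<oplus>\<^bsub>R\<^esub> dec v)),
     module.smult = (\<lambda>a u. enc (a \<otimes>\<^bsub>R\<^esub> dec u))\<rparr>"

lemma ideal_module_eq_copy: "ideal_module R I = ideal_copy R I (\<lambda>x. x) (\<lambda>x. x)"
  by (simp add: ideal_module_def ideal_copy_def ring_module_def)

lemma ideal_copy_simps:
  "carrier (ideal_copy R I enc dec) = enc ` I"
  "\<zero>\<^bsub>ideal_copy R I enc dec\<^esub> = enc \<zero>\<^bsub>R\<^esub>"
  "add (ideal_copy R I enc dec) = (\<lambda>u v. enc (dec u \<oplus>\<^bsub>R\<^esub> dec v))"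
  "module.smult (ideal_copy R I enc dec) = (\<lambda>a u. enc (a \<otimes>\<^bsub>R\<^esub> dec u))"
  by (simp_all add: ideal_copy_def)

context cring
begin

lemma module_ideal_copy:
  assumes I: "ideal I R" and dec: "\<And>a. dec (enc a) = a"
  shows "module R (ideal_copy R I enc dec)"
proof -
  interpret I: ideal I R by (rule I)
  have IR: "a \<in> I \<Longrightarrow> a \<in> carrier R" for a by (rule I.Icarr)
  show ?thesis
  proof (rule moduleI)
    show "abelian_group (ideal_copy R I enc dec)"
    proof (rule abelian_groupI)
      show "\<exists>y\<in>carrier (ideal_copy R I enc dec). y \<oplus>\<^bsub>ideal_copy R I enc dec\<^esub> x = \<zero>\<^bsub>ideal_copy R I enc dec\<^esub>"
        if "x \<in> carrier (ideal_copy R I enc dec)" for x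
      proof -
        from that obtain a where a: "a \<in> I" "x = enc a" by (auto simp: ideal_copy_simps)
        then show ?thesis
          by (intro bexI[of _ "enc (\<ominus> a)"]) (auto simp: ideal_copy_simps dec IR l_neg I.a_inv_closed)
      qed
    qed (auto simp: ideal_copy_simps dec IR I.a_closed I.zero_closed intro!: arg_cong[of _ _ enc] a_assoc a_comm)
  qed (auto simp: ideal_copy_simps dec IR cring_axioms I.I_l_closed intro!: arg_cong[of _ _ enc] l_distr r_distr m_assoc)
qed

definition combination :: "nat \<Rightarrow> (nat \<Rightarrow> 'a) \<Rightarrow> (nat \<Rightarrow> 'a) \<Rightarrow> 'a" where
  "combination n a x = rdot R n x a"

lemma combination_closed:
  assumes "\<And>i. i < n \<Longrightarrow> a i \<in> carrier R" "\<And>i. i < n \<Longrightarrow> x i \<in> carrier R"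
  shows "combination n a x \<in> carrier R"
  unfolding combination_def using assms by auto

lemma combination_add:
  assumes a: "\<And>i. i < n \<Longrightarrow> a i \<in> carrier R"
    and x: "x \<in> vecs R n" and y: "y \<in> vecs R n"
  shows "combination n a (x \<oplus>\<^bsub>free_module R n\<^esub> y) = combination n a x \<oplus> combination n a y"
  unfolding combination_def using a free_moduleD[OF x] free_moduleD[OF y]
  by (subst nsum_add[symmetric]) (auto simp: free_module_simps(3) l_distr intro!: nsum_cong)

lemma combination_smult:
  assumes a: "\<And>i. i < n \<Longrightarrow> a i \<in> carrier R"
    and r: "r \<in> carrier R" and x: "x \<in> vecs R n"
  shows "combination n a (r \<odot>\<^bsub>free_module R n\<^esub> x) = r \<otimes> combination n a x"
  unfolding combination_def using a r free_moduleD[OF x]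
  by (subst nsum_rdistr) (auto simp: free_module_simps(4) m_assoc intro!: nsum_cong)

text \<open>The linear combinations already form an ideal containing the generators, so the
  minimality of the generated ideal yields the nontrivial inclusion.\<close>

lemma fin_gen_ideal_combinations:
  assumes "fin_gen_ideal R I"
  obtains n a where "\<forall>i<n. a i \<in> carrier R" "I = combination n a ` vecs R n" "ideal I R"
proof -
  obtain A where A: "finite A" "A \<subseteq> carrier R" "I = Idl A" using assms by (auto simp: fin_gen_ideal_def)
  obtain a where "bij_betw a {0..<card A} A" using ex_bij_betw_nat_finite[OF A(1)] by blast
  then have aA: "a ` {..<card A} = A" by (simp add: bij_betw_def atLeast0LessThan)
  define n where "n = card A"
  have a: "\<forall>i<n. a i \<in> carrier R" using aA A(2) by (auto simp: n_def)
  have aD: "i < n \<Longrightarrow> a i \<in> carrier R" for i using a by blast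
  have idl: "ideal I R" unfolding A(3) by (rule genideal_ideal[OF A(2)])
  then interpret I: ideal I R .
  have aI: "a i \<in> I" if "i < n" for i
    using genideal_self[OF A(2)] aA that by (auto simp: n_def A(3))
  define L where "L = combination n a ` vecs R n"
  have "L \<subseteq> I"
  proof
    fix t assume "t \<in> L"
    then obtain x where x: "x \<in> vecs R n" "t = combination n a x" by (auto simp: L_def)
    have "k \<le> n \<Longrightarrow> rdot R k x a \<in> I" for k
      by (induction k) (simp_all add: I.zero_closed I.a_closed I.I_l_closed aI free_moduleD[OF x(1)])
    then show "t \<in> I" by (simp add: x(2) combination_def)
  qed
  moreover have "I \<subseteq> L"
    unfolding A(3)
  proof (rule genideal_minimal)
    have smult: "r \<otimes> t \<in> L" if "r \<in> carrier R" "t \<in> L" for r t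
    proof -
      obtain x where x: "x \<in> vecs R n" "t = combination n a x" using \<open>t \<in> L\<close> by (auto simp: L_def)
      have "r \<otimes> t = combination n a (r \<odot>\<^bsub>free_module R n\<^esub> x)"
        unfolding x(2) by (rule combination_smult[symmetric]) (use aD that x in auto)
      then show ?thesis unfolding L_def using free_module_closed(2)[OF \<open>r \<in> carrier R\<close> x(1)] by blast
    qed
    have Lc: "t \<in> carrier R" if "t \<in> L" for t
      using that combination_closed[OF aD free_moduleD] by (auto simp: L_def)
    show "ideal L R"
    proof (rule idealI[OF ring_axioms])
      show "subgroup L (add_monoid R)"
      proof (rule add.subgroupI)
        show "L \<subseteq> carrier R" using Lc by blast
        show "L \<noteq> {}" using free_module_closed(3) by (auto simp: L_def)
        show "\<ominus> t \<in> L" if t: "t \<in> L" for t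
          using smult[OF _ t, of "\<ominus> \<one>"] Lc[OF t] by (simp add: l_minus)
        show "t \<oplus> u \<in> L" if tu: "t \<in> L" "u \<in> L" for t u
        proof -
          obtain x y where xy: "x \<in> vecs R n" "t = combination n a x"
            "y \<in> vecs R n" "u = combination n a y" using tu by (auto simp: L_def)
          have "t \<oplus> u = combination n a (x \<oplus>\<^bsub>free_module R n\<^esub> y)"
            unfolding xy(2,4) by (rule combination_add[symmetric]) (use aD xy in auto)
          then show ?thesis unfolding L_def using free_module_closed(1)[OF xy(1,3)] by blast
        qed
      qed
      show "x \<otimes> t \<in> L" if "t \<in> L" "x \<in> carrier R" for t x using smult that by blast
      show "t \<otimes> x \<in> L" if "t \<in> L" "x \<in> carrier R" for t x
        using smult[OF that(2,1)] m_comm[OF Lc[OF that(1)] that(2)] by simp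
    qed
    show "A \<subseteq> L"
    proof
      fix t assume "t \<in> A"
      then obtain k where k: "k < n" "t = a k" using aA by (auto simp: n_def)
      have "combination n a (unit_vec R n k) = unit_vec R n k k \<otimes> a k"
        unfolding combination_def by (rule nsum_delta[OF k(1)]) (use aD k in \<open>auto simp: unit_vec_def\<close>)
      then have "t = combination n a (unit_vec R n k)" using k aD by (simp add: unit_vec_def)
      then show "t \<in> L" unfolding L_def by blast
    qed
  qed
  ultimately show ?thesis using that[OF a _ idl] by (simp add: L_def)
qed

text \<open>An ideal comes with its inclusion into \<open>R\<close>, and this single functional,
  here the decoding map, is the required embedding; hence the 1.\<close>

lemma torsionless_module_ideal_copy:
  assumes kd: "kernel_duality R" and I: "fin_gen_ideal R I" and dec: "\<And>a. dec (enc a) = a"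
  shows "\<exists>n p. torsionless_module R (ideal_copy R I enc dec) n 1 p (\<lambda>_. restrict dec (enc ` I))"
proof -
  obtain n a where a: "\<forall>i<n. a i \<in> carrier R" and Ia: "I = combination n a ` vecs R n"
    and idl: "ideal I R" by (rule fin_gen_ideal_combinations[OF I])
  have aD: "i < n \<Longrightarrow> a i \<in> carrier R" for i using a by blast
  interpret I: ideal I R by (rule idl)
  define p where "p = (\<lambda>x\<in>vecs R n. enc (combination n a x))"
  note M = module_ideal_copy[where dec = dec and enc = enc, OF idl dec]
  have "torsionless_module R (ideal_copy R I enc dec) n 1 p (\<lambda>_. restrict dec (enc ` I))"
  proof (intro torsionless_module.intro torsionless_module_axioms.intro)
    show "p \<in> mod_hom R (free_module R n) (ideal_copy R I enc dec)"
    proof (rule mod_homI)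
      fix x assume x: "x \<in> vecs R n"
      then show "p x \<in> carrier (ideal_copy R I enc dec)" by (simp add: p_def ideal_copy_simps Ia)
      fix y assume y: "y \<in> vecs R n"
      show "p (x \<oplus>\<^bsub>free_module R n\<^esub> y) = p x \<oplus>\<^bsub>ideal_copy R I enc dec\<^esub> p y"
        using x y combination_add[OF aD x y] free_module_closed(1)[OF x y] by (simp add: p_def ideal_copy_simps dec)
    next
      fix r x assume r: "r \<in> carrier R" and x: "x \<in> vecs R n"
      show "p (r \<odot>\<^bsub>free_module R n\<^esub> x) = r \<odot>\<^bsub>ideal_copy R I enc dec\<^esub> p x"
        using x combination_smult[OF aD r x] free_module_closed(2)[OF r x] by (simp add: p_def ideal_copy_simps dec)
    qed (simp add: p_def)
    show "p ` vecs R n = carrier (ideal_copy R I enc dec)"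
      by (simp add: p_def ideal_copy_simps Ia image_image)
    show "restrict dec (enc ` I) \<in> mod_hom R (ideal_copy R I enc dec) (ring_module R)"
      by (rule mod_homI) (auto simp: ideal_copy_simps dec I.Icarr I.a_closed I.I_l_closed)
    show "x = y" if "x \<in> carrier (ideal_copy R I enc dec)" "y \<in> carrier (ideal_copy R I enc dec)"
      "\<And>i::nat. i < 1 \<Longrightarrow> restrict dec (enc ` I) x = restrict dec (enc ` I) y" for x y
      using that(1,2) that(3)[of 0] by (auto simp: ideal_copy_simps dec)
  qed (use kd M cring_axioms in auto)
  then show ?thesis by blast
qed

lemma coherent_ring_if_kernel_duality:
  assumes "kernel_duality R"
  shows "coherent_ring R"
  unfolding coherent_ring_def ideal_module_eq_copy
  using torsionless_module_ideal_copy[OF assms, of _ "\<lambda>x. x" "\<lambda>x. x"] torsionless_module.finitely_presented cring_axioms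
  by blast

text \<open>The ideal is zero or of Gorenstein dimension zero, so a renamed copy of it is a
  resolution of length 0, with the decoding map as augmentation.\<close>

lemma finite_gdim_ideal:
  assumes kd: "kernel_duality R" and I: "fin_gen_ideal R I"
  shows "finite_gdim R (ideal_module R I)"
proof -
  \<comment> \<open>Any injective renaming into sets of vectors would do: an element becomes the
    singleton of its constant vector and is read back at coordinate 0.\<close>
  define enc :: "'a \<Rightarrow> (nat \<Rightarrow> 'a) set" where "enc a = {\<lambda>_. a}" for a
  define dec :: "(nat \<Rightarrow> 'a) set \<Rightarrow> 'a" where "dec u = the_elem u 0" for u
  have dec: "dec (enc a) = a" for a by (simp add: enc_def dec_def)
  have enc_eq: "enc a = enc b \<longleftrightarrow> a = b" for a b using dec by metis
  \<comment> \<open>The padding modules are copies of the zero ideal, so the results on finitely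
    generated ideals cover them too.\<close>
  have zero: "fin_gen_ideal R {\<zero>}"
    unfolding fin_gen_ideal_def using genideal_zero by (intro exI[of _ "{\<zero>}"]) simp
  obtain n a where idl: "ideal I R"
    using fin_gen_ideal_combinations[OF I] by metis
  interpret I: ideal I R by (rule idl)
  define G where "G k = ideal_copy R (if k = 0 then I else {\<zero>}) enc dec" for k :: nat
  have fg: "fin_gen_ideal R (if k = 0 then I else {\<zero>})" for k :: nat using I zero by simp
  have tl: "\<exists>n p. torsionless_module R (G k) n 1 p (\<lambda>_. restrict dec (enc ` (if k = 0 then I else {\<zero>})))" for k
    unfolding G_def by (rule torsionless_module_ideal_copy[OF kd]) (rule fg, rule dec)
  have fp: "finitely_presented R (G k)" for k
    using tl[of k] torsionless_module.finitely_presented by blast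
  have gz: "carrier (G k) = {\<zero>\<^bsub>G k\<^esub>} \<or> gdim_zero R (G k)" for k
    using tl[of k] torsionless_module.gdim_zero by blast
  have GM: "module R (G k)" for k using fp[of k] by (simp add: finitely_presented_def)
  have Gz: "carrier (G (Suc k)) = {\<zero>\<^bsub>G (Suc k)\<^esub>}" for k by (simp add: G_def ideal_copy_simps)
  define D where "D k = (\<lambda>u\<in>carrier (G (Suc k)). \<zero>\<^bsub>G k\<^esub>)" for k
  have D: "D k \<in> mod_hom R (G (Suc k)) (G k)" for k
  proof -
    interpret A: module R "G (Suc k)" by (rule GM)
    interpret B: module R "G k" by (rule GM)
    show ?thesis by (rule mod_homI) (auto simp: D_def B.smult_r_null)
  qed
  define e where "e = restrict dec (carrier (G 0))"
  have G0: "carrier (G 0) = enc ` I" by (simp add: G_def ideal_copy_simps)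
  have im: "carrier (ideal_module R I) = I" "\<zero>\<^bsub>ideal_module R I\<^esub> = \<zero>" "add (ideal_module R I) = add R"
    "module.smult (ideal_module R I) = monoid.mult R"
    by (simp_all add: ideal_module_def ring_module_def)
  have e: "e \<in> mod_hom R (G 0) (ideal_module R I)"
    by (rule mod_homI) (auto simp: e_def im G_def ideal_copy_simps dec I.a_closed I.I_l_closed)
  show ?thesis
    unfolding finite_gdim_def
  proof (intro exI[of _ 0] exI[of _ G] exI[of _ D] exI[of _ e] conjI allI impI)
    show "carrier (G k) = {\<zero>\<^bsub>G k\<^esub>}" if "0 < k" for k using Gz[of "k - 1"] that by simp
    show "exact_at (G (Suc (Suc k))) (D (Suc k)) (G (Suc k)) (D k) (G k)" for k
      unfolding exact_at_def a_kernel_def' by (auto simp: D_def Gz)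
    show "exact_at (G (Suc 0)) (D 0) (G 0) e (ideal_module R I)"
      unfolding exact_at_def a_kernel_def' by (auto simp: D_def Gz G0 e_def dec im, auto simp: G_def ideal_copy_simps dec enc_eq I.zero_closed)
    show "e ` carrier (G 0) = carrier (ideal_module R I)"
      by (force simp: e_def G0 im dec)
  qed (use fp gz D e in auto)
qed

end

lemma gorenstein_ring_if_kernel_duality:
  assumes "\<And>m. maximalideal m R \<Longrightarrow> cring (localization R (carrier R - m)) \<and>
      kernel_duality (localization R (carrier R - m))"
  shows "gorenstein_ring R"
  unfolding gorenstein_ring_def Let_def using assms cring.finite_gdim_ideal by blast

section \<open>Transfer to quotients and localizations\<close>

text \<open>The map \<open>P \<rightarrow> T\<close> exhibits \<open>T\<close> as a localization of \<open>P / (P \<inter> J)\<close>.\<close>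

locale fraction_map = T?: cring T + ideal_mod J for T (structure) and J :: "'a::comm_ring_1 set" +
  fixes P :: "'a set" and \<rho> :: "'a \<Rightarrow> 'b"
  assumes P: "subring_set P"
    and \<rho>_closed: "a \<in> P \<Longrightarrow> \<rho> a \<in> carrier T"
    and \<rho>_add: "a \<in> P \<Longrightarrow> b \<in> P \<Longrightarrow> \<rho> (a + b) = \<rho> a \<oplus> \<rho> b"
    and \<rho>_mult: "a \<in> P \<Longrightarrow> b \<in> P \<Longrightarrow> \<rho> (a * b) = \<rho> a \<otimes> \<rho> b"
    and \<rho>_one: "\<rho> 1 = \<one>"
    and \<rho>_J: "a \<in> P \<Longrightarrow> a \<in> J \<Longrightarrow> \<rho> a = \<zero>"
    and \<rho>_zero: "a \<in> P \<Longrightarrow> \<rho> a = \<zero> \<Longrightarrow> \<exists>u\<in>P. \<rho> u \<in> Units T \<and> u * a \<in> J"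
    and \<rho>_frac: "t \<in> carrier T \<Longrightarrow> \<exists>a\<in>P. \<exists>s\<in>P. \<rho> s \<in> Units T \<and> t \<otimes> \<rho> s = \<rho> a"
begin

lemmas PD = subring_setD[OF P]

lemma \<rho>_0: "\<rho> 0 = \<zero>"
  using \<rho>_J PD(1) J0 by blast

lemma P_sum: "(\<And>i. i < n \<Longrightarrow> f i \<in> P) \<Longrightarrow> (\<Sum>i<n. f i) \<in> P" for n :: nat
  by (induction n) (auto intro: PD)

lemma \<rho>_sum: "(\<And>i. i < n \<Longrightarrow> f i \<in> P) \<Longrightarrow> \<rho> (\<Sum>i<n. f i) = nsum T (\<lambda>i. \<rho> (f i)) n"
  by (induction n) (simp_all add: \<rho>_0 \<rho>_add P_sum)

lemma \<rho>_sum_mult: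
  assumes "\<And>i. i < n \<Longrightarrow> f i \<in> P" "\<And>i. i < n \<Longrightarrow> g i \<in> P"
  shows "\<rho> (dot n f g) = nsum T (\<lambda>i. \<rho> (f i) \<otimes> \<rho> (g i)) n"
  using assms by (subst \<rho>_sum) (auto intro!: PD(4) nsum_cong simp: \<rho>_mult)

lemma \<rho>_cong:
  assumes "a \<in> P" "b \<in> P" "a \<doteq> b" shows "\<rho> a = \<rho> b"
proof -
  have "\<rho> (a - b) = \<zero>" using assms by (intro \<rho>_J PD(6)) (auto simp: cg_def)
  moreover have "\<rho> a = \<rho> (a - b) \<oplus> \<rho> b" using \<rho>_add[OF PD(6)[OF assms(1,2)] assms(2)] by simp
  ultimately show ?thesis using \<rho>_closed[OF assms(2)] by simp
qed

lemma unit_cancel: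
  assumes "u \<in> Units T" "a \<in> carrier T" "a \<otimes> u = \<zero>" shows "a = \<zero>"
proof -
  have "a = a \<otimes> u \<otimes> inv u" using assms(1,2) Units_closed[OF assms(1)] by (simp add: m_assoc)
  also have "\<dots> = \<zero>" using assms(1) unfolding assms(3) by simp
  finally show ?thesis .
qed

text \<open>Finitely many elements need one denominator, the product of the individual ones. The
  numerators are total functions into \<open>P\<close>, as \<open>exact_mod\<close> expects.\<close>

lemma common_denominator:
  fixes n :: nat
  assumes "\<And>i. i < n \<Longrightarrow> t i \<in> carrier T"
  shows "\<exists>s a. s \<in> P \<and> \<rho> s \<in> Units T \<and> (\<forall>i. a i \<in> P) \<and> (\<forall>i<n. t i \<otimes> \<rho> s = \<rho> (a i))"
  using assms
proof (induction n)
  case 0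
  then show ?case using PD(1,2) \<rho>_one by (intro exI[of _ 1] exI[of _ "\<lambda>_. 0"]) simp
next
  case (Suc n)
  then obtain s a where s: "s \<in> P" "\<rho> s \<in> Units T" "\<forall>i. a i \<in> P" "\<forall>i<n. t i \<otimes> \<rho> s = \<rho> (a i)"
    by (metis less_SucI)
  obtain a' s' where s': "a' \<in> P" "s' \<in> P" "\<rho> s' \<in> Units T" "t n \<otimes> \<rho> s' = \<rho> a'"
    using \<rho>_frac[of "t n"] Suc.prems by blast
  define b where "b i = (if i = n then a' * s else a i * s')" for i
  have b: "b i \<in> P" for i using s s' by (auto simp: b_def intro: PD)
  have c: "\<rho> s \<in> carrier T" "\<rho> s' \<in> carrier T" using s s' by (auto intro: \<rho>_closed)
  have "t i \<otimes> \<rho> (s * s') = \<rho> (b i)" if i: "i < Suc n" for i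
  proof (cases "i = n")
    case True
    have "t n \<otimes> (\<rho> s \<otimes> \<rho> s') = (t n \<otimes> \<rho> s') \<otimes> \<rho> s"
      using c Suc.prems[of n] by (simp add: m_ac)
    then show ?thesis using True s s' by (simp add: b_def \<rho>_mult)
  next
    case False
    with i have "i < n" by simp
    have "t i \<otimes> (\<rho> s \<otimes> \<rho> s') = (t i \<otimes> \<rho> s) \<otimes> \<rho> s'"
      using c Suc.prems[OF i] by (simp add: m_ac)
    then show ?thesis using False \<open>i < n\<close> s s' by (simp add: b_def \<rho>_mult)
  qed
  moreover have "\<rho> (s * s') \<in> Units T" using s s' by (simp add: \<rho>_mult)
  ultimately show ?case using b PD(4)[OF s(1) s'(2)] by blast
qed

text \<open>Vanishing in \<open>T\<close> only means that some denominator multiplies the element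
  into \<open>J\<close>; finitely many such multipliers are combined to one.\<close>

lemma common_annihilator:
  fixes n :: nat
  assumes "\<And>i. i < n \<Longrightarrow> a i \<in> P" "\<And>i. i < n \<Longrightarrow> \<rho> (a i) = \<zero>"
  shows "\<exists>u\<in>P. \<rho> u \<in> Units T \<and> (\<forall>i<n. u * a i \<in> J)"
  using assms
proof (induction n)
  case 0
  then show ?case using PD(2) \<rho>_one by (intro bexI[of _ 1]) auto
next
  case (Suc n)
  then obtain u where u: "u \<in> P" "\<rho> u \<in> Units T" "\<forall>i<n. u * a i \<in> J" by (meson less_SucI)
  obtain v where v: "v \<in> P" "\<rho> v \<in> Units T" "v * a n \<in> J" using \<rho>_zero[of "a n"] Suc.prems by blast
  have "u * v * a i \<in> J" if "i < Suc n" for i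
    using that u(3) v(3) J_mult[of "u * a i" v] J_mult[of "v * a n" u] by (auto simp: less_Suc_eq ac_simps)
  moreover have "\<rho> (u * v) \<in> Units T" using u v by (simp add: \<rho>_mult)
  ultimately show ?case using PD(4)[OF u(1) v(1)] by blast
qed

text \<open>Flatness of localization for matrices. The numerators \<open>x\<close> solve the
  equations modulo \<open>J\<close> after multiplication by some \<open>u\<close> that becomes a
  unit; \<open>u x\<close> is lifted over \<open>P\<close>, and the lift is divided by the image of
  \<open>s u\<close>.\<close>

lemma lift_fractions:
  assumes z: "\<And>i. i < d \<Longrightarrow> \<rho> (dot n (M i) x) = \<zero>"
    and M: "\<forall>i j. M i j \<in> P" and N: "\<forall>i j. N i j \<in> P" and x: "\<forall>j. x j \<in> P"
    and s: "s \<in> P" "\<rho> s \<in> Units T" and t: "\<forall>j<n. t j \<in> carrier T" "\<forall>j<n. t j \<otimes> \<rho> s = \<rho> (x j)"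
    and ex: "exact_mod P J d n m M N"
  shows "\<exists>y. (\<forall>k<m. y k \<in> carrier T) \<and> (\<forall>j<n. t j = nsum T (\<lambda>k. \<rho> (N j k) \<otimes> y k) m)"
proof -
  have "\<exists>u\<in>P. \<rho> u \<in> Units T \<and> (\<forall>i<d. u * dot n (M i) x \<in> J)"
    by (rule common_annihilator) (use z M x in \<open>auto intro!: P_sum PD(4)\<close>)
  then obtain u where u: "u \<in> P" "\<rho> u \<in> Units T" "\<And>i. i < d \<Longrightarrow> u * dot n (M i) x \<in> J" by blast
  have ux: "u * x j \<in> P" for j using u x by (auto intro: PD)
  have zu: "(\<Sum>j<n. M i j * (u * x j)) \<doteq> 0" if "i < d" for i
    using u(3)[OF that] by (simp add: cg_def sum_distrib_left ac_simps)
  obtain y where y: "\<forall>k. y k \<in> P" "\<forall>j<n. u * x j \<doteq> dot m (N j) y"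
    using exact_mod_lift[OF ex, of "\<lambda>j. u * x j", OF ux zu] by blast
  define w where "w = inv (\<rho> (s * u))"
  have su: "\<rho> (s * u) \<in> Units T" using s u by (simp add: \<rho>_mult)
  have w: "w \<in> carrier T" "\<rho> (s * u) \<otimes> w = \<one>" using su by (simp_all add: w_def)
  show ?thesis
  proof (intro exI[of _ "\<lambda>k. \<rho> (y k) \<otimes> w"] conjI allI impI)
    show "\<rho> (y k) \<otimes> w \<in> carrier T" for k using y(1) w by (simp add: \<rho>_closed)
    fix j assume j: "j < n"
    have c: "t j \<in> carrier T" "\<rho> s \<in> carrier T" "\<rho> u \<in> carrier T" using j t s u by (auto intro: \<rho>_closed)
    have "t j \<otimes> \<rho> (s * u) = (t j \<otimes> \<rho> s) \<otimes> \<rho> u" using c s u by (simp add: \<rho>_mult m_assoc)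
    also have "\<dots> = \<rho> (u * x j)" using j t u x c by (simp add: \<rho>_mult \<rho>_closed m_comm)
    also have "\<dots> = \<rho> (dot m (N j) y)"
      by (rule \<rho>_cong) (use ux y j N in \<open>auto intro!: P_sum PD(4)\<close>)
    also have "\<dots> = nsum T (\<lambda>k. \<rho> (N j k) \<otimes> \<rho> (y k)) m" by (rule \<rho>_sum_mult) (use N y in auto)
    finally have "t j \<otimes> \<rho> (s * u) \<otimes> w = nsum T (\<lambda>k. \<rho> (N j k) \<otimes> \<rho> (y k)) m \<otimes> w" by simp
    moreover have "t j \<otimes> \<rho> (s * u) \<otimes> w = t j" using c w Units_closed[OF su] by (simp add: m_assoc)
    moreover have "nsum T (\<lambda>k. \<rho> (N j k) \<otimes> \<rho> (y k)) m \<otimes> w = nsum T (\<lambda>k. \<rho> (N j k) \<otimes> (\<rho> (y k) \<otimes> w)) m"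
      using w y N by (subst nsum_ldistr) (auto intro!: nsum_cong simp: \<rho>_closed m_assoc)
    ultimately show "t j = nsum T (\<lambda>k. \<rho> (N j k) \<otimes> (\<rho> (y k) \<otimes> w)) m" by simp
  qed
qed

text \<open>Clearing denominators in a row scales it by a unit and keeps the kernel. The syzygies of
  the resulting matrix over \<open>P\<close> are mapped to \<open>T\<close>, where
  \<open>lift_fractions\<close> supplies exactness, applied to the transposed pair for the extension
  condition.\<close>

lemma kernel_duality:
  assumes kd: "kernel_duality_mod P J"
  shows "kernel_duality T"
  unfolding kernel_duality_def
proof (intro allI impI)
  fix d n and C :: "nat \<Rightarrow> nat \<Rightarrow> 'b" assume C: "\<forall>i<d. \<forall>j<n. C i j \<in> carrier T"
  have "\<forall>i. \<exists>s a. i < d \<longrightarrow> s \<in> P \<and> \<rho> s \<in> Units T \<and> (\<forall>j. a j \<in> P) \<and> (\<forall>j<n. C i j \<otimes> \<rho> s = \<rho> (a j))"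
    using common_denominator C by metis
  then obtain s C0 where sC: "\<And>i. i < d \<Longrightarrow> s i \<in> P \<and> \<rho> (s i) \<in> Units T \<and> (\<forall>j. C0 i j \<in> P) \<and> (\<forall>j<n. C i j \<otimes> \<rho> (s i) = \<rho> (C0 i j))"
    by metis
  define C' where "C' i j = (if i < d then C0 i j else 0)" for i j
  have C': "\<forall>i j. C' i j \<in> P" using sC PD(1) by (auto simp: C'_def)
  have CC': "C i j \<otimes> \<rho> (s i) = \<rho> (C' i j)" if "i < d" "j < n" for i j using sC that by (simp add: C'_def)
  have s: "\<rho> (s i) \<in> Units T" "s i \<in> P" if "i < d" for i using sC that by blast+
  obtain m K l A where K: "\<forall>j k. K j k \<in> P" and A: "\<forall>j k. A j k \<in> P" and exC: "exact_mod P J d n m C' K"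
    and exK: "exact_mod P J n m l K A" and exA: "exact_mod P J l m n (\<lambda>i j. A j i) (\<lambda>i j. K j i)"
    using kernel_duality_mod_syzygies[OF P kd, of C' d n, OF C'[rule_format]] by (elim exE conjE)
  define Q where "Q j k = \<rho> (K j k)" for j k
  have Q: "Q j k \<in> carrier T" for j k using K by (simp add: Q_def \<rho>_closed)
  have scale: "rdot T n (C i) x \<otimes> \<rho> (s i) = nsum T (\<lambda>j. \<rho> (C' i j) \<otimes> x j) n"
    if i: "i < d" and x: "\<forall>j<n. x j \<in> carrier T" for i x
  proof -
    have si: "\<rho> (s i) \<in> carrier T" using s(2)[OF i] by (rule \<rho>_closed)
    have "rdot T n (C i) x \<otimes> \<rho> (s i) = nsum T (\<lambda>j. C i j \<otimes> x j \<otimes> \<rho> (s i)) n"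
      by (rule nsum_ldistr) (use C i x si in auto)
    also have "\<dots> = nsum T (\<lambda>j. \<rho> (C' i j) \<otimes> x j) n"
    proof (rule nsum_cong)
      fix j assume j: "j < n"
      have "C i j \<otimes> x j \<otimes> \<rho> (s i) = C i j \<otimes> \<rho> (s i) \<otimes> x j"
        using C i j x si by (simp add: m_ac)
      then show "C i j \<otimes> x j \<otimes> \<rho> (s i) = \<rho> (C' i j) \<otimes> x j" using CC'[OF i j] by simp
    qed
    finally show ?thesis .
  qed
  have CQ: "nsum T (\<lambda>j. C i j \<otimes> Q j k) n = \<zero>" if i: "i < d" and k: "k < m" for i k
  proof (rule unit_cancel[OF s(1)[OF i]])
    have "nsum T (\<lambda>j. C i j \<otimes> Q j k) n \<otimes> \<rho> (s i) = nsum T (\<lambda>j. \<rho> (C' i j) \<otimes> Q j k) n"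
      by (rule scale[OF i]) (use Q in blast)
    also have "\<dots> = \<rho> (\<Sum>j<n. C' i j * K j k)"
      unfolding Q_def by (rule \<rho>_sum_mult[symmetric]) (use C' K in auto)
    also have "\<dots> = \<rho> 0"
      by (rule \<rho>_cong[OF _ _ exact_mod_zero[OF exC i k]]) (use C' K in \<open>auto intro!: P_sum PD(4) PD(1)\<close>)
    finally show "nsum T (\<lambda>j. C i j \<otimes> Q j k) n \<otimes> \<rho> (s i) = \<zero>" by (simp add: \<rho>_0)
  qed (use C Q i in auto)
  have "exact_mat T d n m C Q"
    unfolding exact_mat_def
  proof (intro allI impI iffI)
    fix x i assume x: "\<forall>j<n. x j \<in> carrier T" and i: "i < d"
      and "\<exists>y. (\<forall>k<m. y k \<in> carrier T) \<and> (\<forall>j<n. x j = rdot T m (Q j) y)"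
    then obtain y where y: "\<forall>k<m. y k \<in> carrier T" "\<forall>j<n. x j = rdot T m (Q j) y" by blast
    have "rdot T n (C i) x = nsum T (\<lambda>j. C i j \<otimes> rdot T m (Q j) y) n"
      by (rule nsum_cong) (use y in simp)
    also have "\<dots> = nsum T (\<lambda>k. nsum T (\<lambda>j. C i j \<otimes> Q j k) n \<otimes> y k) m"
      by (rule nsum_matrix_assoc) (use C Q i y in auto)
    also have "\<dots> = \<zero>" by (rule nsum_zero) (use CQ[OF i] y in simp)
    finally show "rdot T n (C i) x = \<zero>" .
  next
    fix x assume x: "\<forall>j<n. x j \<in> carrier T" and z: "\<forall>i<d. rdot T n (C i) x = \<zero>"
    obtain r a where r: "r \<in> P" "\<rho> r \<in> Units T" "\<forall>j. a j \<in> P" "\<forall>j<n. x j \<otimes> \<rho> r = \<rho> (a j)"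
      using common_denominator[of n x] x by blast
    have rT: "\<rho> r \<in> carrier T" using r(1) by (rule \<rho>_closed)
    have za: "\<rho> (dot n (C' i) a) = \<zero>" if i: "i < d" for i
    proof -
      have "\<rho> (dot n (C' i) a) = nsum T (\<lambda>j. \<rho> (C' i j) \<otimes> \<rho> (a j)) n"
        by (rule \<rho>_sum_mult) (use C' r in auto)
      also have "\<dots> = nsum T (\<lambda>j. \<rho> (C' i j) \<otimes> x j \<otimes> \<rho> r) n"
      proof (rule nsum_cong)
        fix j assume j: "j < n"
        have "\<rho> (C' i j) \<in> carrier T" using C' by (simp add: \<rho>_closed)
        then show "\<rho> (C' i j) \<otimes> \<rho> (a j) = \<rho> (C' i j) \<otimes> x j \<otimes> \<rho> r"
          using r(4) j x rT by (simp add: m_assoc)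
      qed
      also have "\<dots> = nsum T (\<lambda>j. \<rho> (C' i j) \<otimes> x j) n \<otimes> \<rho> r"
        by (rule nsum_ldistr[symmetric]) (use C' x rT \<rho>_closed in auto)
      also have "\<dots> = \<zero>"
        using scale[OF i x] z i s(2)[OF i] rT by (simp add: \<rho>_closed flip: scale[OF i x])
      finally show ?thesis .
    qed
    show "\<exists>y. (\<forall>k<m. y k \<in> carrier T) \<and> (\<forall>j<n. x j = rdot T m (Q j) y)"
      unfolding Q_def by (rule lift_fractions[OF za C' K r(3,1,2) x r(4) exC])
  qed
  moreover have "extension_mat T n m Q"
    unfolding extension_mat_def
  proof (intro allI impI)
    fix \<phi> assume \<phi>: "\<forall>k<m. \<phi> k \<in> carrier T"
      and van: "\<forall>y. (\<forall>k<m. y k \<in> carrier T) \<longrightarrow> (\<forall>j<n. rdot T m (Q j) y = \<zero>) \<longrightarrow>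
        rdot T m \<phi> y = \<zero>"
    obtain r a where r: "r \<in> P" "\<rho> r \<in> Units T" "\<forall>j. a j \<in> P" "\<forall>k<m. \<phi> k \<otimes> \<rho> r = \<rho> (a k)"
      using common_denominator[of m \<phi>] \<phi> by blast
    have rT: "\<rho> r \<in> carrier T" using r(1) by (rule \<rho>_closed)
    \<comment> \<open>The columns of \<open>A\<close> are relations between those of
      \<open>K\<close>; a functional that vanishes on the kernel of \<open>Q\<close> kills their
      images, so its numerators satisfy the transposed equations.\<close>
    have za: "\<rho> (\<Sum>k<m. A k i * a k) = \<zero>" if i: "i < l" for i
    proof -
      define y where "y k = \<rho> (A k i)" for k
      have y: "\<forall>k<m. y k \<in> carrier T" using A by (simp add: y_def \<rho>_closed)
      have "rdot T m (Q j) y = \<zero>" if j: "j < n" for j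
      proof -
        have "rdot T m (Q j) y = \<rho> (\<Sum>k<m. K j k * A k i)"
          unfolding Q_def y_def by (rule \<rho>_sum_mult[symmetric]) (use A K in auto)
        also have "\<dots> = \<rho> 0"
          by (rule \<rho>_cong[OF _ _ exact_mod_zero[OF exK j i]]) (use A K in \<open>auto intro!: P_sum PD(4) PD(1)\<close>)
        finally show ?thesis by (simp add: \<rho>_0)
      qed
      then have \<phi>y: "rdot T m \<phi> y = \<zero>" using van y by blast
      have "\<rho> (\<Sum>k<m. A k i * a k) = nsum T (\<lambda>k. y k \<otimes> \<rho> (a k)) m"
        unfolding y_def by (rule \<rho>_sum_mult) (use A r in auto)
      also have "\<dots> = nsum T (\<lambda>k. \<phi> k \<otimes> y k \<otimes> \<rho> r) m"
      proof (rule nsum_cong)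
        fix k assume k: "k < m"
        have "y k \<otimes> (\<phi> k \<otimes> \<rho> r) = \<phi> k \<otimes> y k \<otimes> \<rho> r" using k y \<phi> rT by (simp add: m_ac)
        then show "y k \<otimes> \<rho> (a k) = \<phi> k \<otimes> y k \<otimes> \<rho> r" using r(4) k by simp
      qed
      also have "\<dots> = rdot T m \<phi> y \<otimes> \<rho> r"
        by (rule nsum_ldistr[symmetric]) (use \<phi> y rT in auto)
      finally show ?thesis using \<phi>y rT by simp
    qed
    have "\<exists>v. (\<forall>j<n. v j \<in> carrier T) \<and> (\<forall>k<m. \<phi> k = nsum T (\<lambda>j. \<rho> (K j k) \<otimes> v j) n)"
      by (rule lift_fractions[where M = "\<lambda>i j. A j i" and N = "\<lambda>i j. K j i", OF za _ _ r(3,1,2) \<phi> r(4) exA])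
        (use A K in auto)
    then obtain v where v: "\<forall>j<n. v j \<in> carrier T" "\<forall>k<m. \<phi> k = nsum T (\<lambda>j. \<rho> (K j k) \<otimes> v j) n" by blast
    have "\<phi> k = nsum T (\<lambda>j. v j \<otimes> Q j k) n" if k: "k < m" for k
    proof -
      have "nsum T (\<lambda>j. \<rho> (K j k) \<otimes> v j) n = nsum T (\<lambda>j. v j \<otimes> Q j k) n"
        by (rule nsum_cong) (use v Q in \<open>auto simp: Q_def[symmetric] intro!: m_comm\<close>)
      then show ?thesis using v(2) k by simp
    qed
    with v(1) show "\<exists>v. (\<forall>j<n. v j \<in> carrier T) \<and> (\<forall>k<m. \<phi> k = nsum T (\<lambda>j. v j \<otimes> Q j k) n)" by blast
  qed
  ultimately show "\<exists>m K. (\<forall>j<n. \<forall>k<m. K j k \<in> carrier T) \<and> exact_mat T d n m C K \<and> extension_mat T n m K"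
    using Q by blast
qed

end

section \<open>Localization\<close>

text \<open>The operations of \<open>localization\<close> are unions over all pairs of
  representatives; such a union is a single class as soon as the result does not depend on the
  representatives.\<close>

lemma UN_pairs_constant:
  assumes "(a, s) \<in> U" "(b, t) \<in> V" "\<And>a' s' b' t'. (a', s') \<in> U \<Longrightarrow> (b', t') \<in> V \<Longrightarrow> h a' s' b' t' = W"
  shows "(\<Union>(a', s')\<in>U. \<Union>(b', t')\<in>V. h a' s' b' t') = W"
proof (intro equalityI subsetI)
  fix x assume "x \<in> W"
  then have "x \<in> h a s b t" using assms(3)[OF assms(1,2)] by simp
  then show "x \<in> (\<Union>(a', s')\<in>U. \<Union>(b', t')\<in>V. h a' s' b' t')" using assms(1,2) by blast
next
  fix x assume "x \<in> (\<Union>(a', s')\<in>U. \<Union>(b', t')\<in>V. h a' s' b' t')"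
  then obtain a' s' b' t' where "(a', s') \<in> U" "(b', t') \<in> V" "x \<in> h a' s' b' t'" by blast
  then show "x \<in> W" using assms(3) by simp
qed

locale localized_ring = cring R for R (structure) + fixes S :: "'a set"
  assumes S_closed: "S \<subseteq> carrier R" and S_one: "\<one> \<in> S" and S_mult: "s \<in> S \<Longrightarrow> t \<in> S \<Longrightarrow> s \<otimes> t \<in> S"
begin

definition lfrac :: "'a \<Rightarrow> 'a \<Rightarrow> ('a \<times> 'a) set" where
  "lfrac a s = frac_rel R S `` {(a, s)}"

abbreviation "Loc \<equiv> localization R S"

lemma SD [simp]: "s \<in> S \<Longrightarrow> s \<in> carrier R"
  using S_closed by blast

lemma frac_relI:
  "a \<in> carrier R \<Longrightarrow> s \<in> S \<Longrightarrow> b \<in> carrier R \<Longrightarrow> t \<in> S \<Longrightarrow> u \<in> S \<Longrightarrow> u \<otimes> (a \<otimes> t) = u \<otimes> (b \<otimes> s) \<Longrightarrow>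
    ((a, s), (b, t)) \<in> frac_rel R S"
  unfolding frac_rel_def by blast

lemma equiv_frac_rel: "equiv (carrier R \<times> S) (frac_rel R S)"
proof (rule equivI)
  show "frac_rel R S \<subseteq> (carrier R \<times> S) \<times> (carrier R \<times> S)" by (auto simp: frac_rel_def)
  show "refl_on (carrier R \<times> S) (frac_rel R S)"
    by (rule refl_onI) (auto intro: frac_relI S_one)
  show "sym (frac_rel R S)" by (rule symI) (auto simp: frac_rel_def intro: sym)
  show "trans (frac_rel R S)"
  proof (rule transI, clarify)
    fix a s b t c w assume "((a, s), (b, t)) \<in> frac_rel R S" "((b, t), (c, w)) \<in> frac_rel R S"
    then obtain u v where d: "a \<in> carrier R" "s \<in> S" "b \<in> carrier R" "t \<in> S" "c \<in> carrier R" "w \<in> S" "u \<in> S" "v \<in> S"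
      and u: "u \<otimes> (a \<otimes> t) = u \<otimes> (b \<otimes> s)" and v: "v \<otimes> (b \<otimes> w) = v \<otimes> (c \<otimes> t)"
      by (auto simp: frac_rel_def)
    \<comment> \<open>The middle denominator \<open>t\<close> cannot be cancelled, so it enters the
      witness for transitivity.\<close>
    have "(u \<otimes> v \<otimes> t) \<otimes> (a \<otimes> w) = (v \<otimes> w) \<otimes> (u \<otimes> (a \<otimes> t))" using d by (simp add: m_ac)
    also have "\<dots> = (u \<otimes> s) \<otimes> (v \<otimes> (b \<otimes> w))" unfolding u using d by (simp add: m_ac)
    also have "\<dots> = (u \<otimes> v \<otimes> t) \<otimes> (c \<otimes> s)" unfolding v using d by (simp add: m_ac)
    finally show "((a, s), (c, w)) \<in> frac_rel R S"
      by (intro frac_relI[of a s c w "u \<otimes> v \<otimes> t"]) (use d S_mult in auto)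
  qed
qed

lemma lfrac_eq_iff:
  assumes "a \<in> carrier R" "s \<in> S" "b \<in> carrier R" "t \<in> S"
  shows "lfrac a s = lfrac b t \<longleftrightarrow> (\<exists>u\<in>S. u \<otimes> (a \<otimes> t) = u \<otimes> (b \<otimes> s))"
  unfolding lfrac_def using eq_equiv_class_iff[OF equiv_frac_rel, of "(a, s)" "(b, t)"] assms
  by (simp add: frac_rel_def)

lemma lfrac_eqI:
  assumes "a \<in> carrier R" "s \<in> S" "b \<in> carrier R" "t \<in> S" "a \<otimes> t = b \<otimes> s"
  shows "lfrac a s = lfrac b t"
  unfolding lfrac_eq_iff[OF assms(1-4)] using S_one assms(5) by force

lemma lfrac_self: "a \<in> carrier R \<Longrightarrow> s \<in> S \<Longrightarrow> (a, s) \<in> lfrac a s"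
  unfolding lfrac_def using equiv_class_self[OF equiv_frac_rel, of "(a, s)"] by simp

lemma lfrac_memD:
  assumes "(b, t) \<in> lfrac a s"
  shows "a \<in> carrier R" "s \<in> S" "b \<in> carrier R" "t \<in> S" "lfrac b t = lfrac a s"
proof -
  have r: "((a, s), (b, t)) \<in> frac_rel R S" using assms by (simp add: lfrac_def)
  then show "a \<in> carrier R" "s \<in> S" "b \<in> carrier R" "t \<in> S" by (auto simp: frac_rel_def)
  show "lfrac b t = lfrac a s" unfolding lfrac_def using equiv_class_eq[OF equiv_frac_rel r] by simp
qed

lemma carrier_Loc: "carrier Loc = {lfrac a s | a s. a \<in> carrier R \<and> s \<in> S}"
  by (auto simp: localization_def lfrac_def quotient_def)

lemma LocE:
  assumes "x \<in> carrier Loc"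
  obtains a s where "a \<in> carrier R" "s \<in> S" "x = lfrac a s"
  using assms by (auto simp: carrier_Loc)

lemma one_Loc: "\<one>\<^bsub>Loc\<^esub> = lfrac \<one> \<one>" and zero_Loc: "\<zero>\<^bsub>Loc\<^esub> = lfrac \<zero> \<one>"
  by (simp_all add: localization_def lfrac_def)

lemma lfrac_mult:
  assumes "a \<in> carrier R" "s \<in> S" "b \<in> carrier R" "t \<in> S"
  shows "lfrac a s \<otimes>\<^bsub>Loc\<^esub> lfrac b t = lfrac (a \<otimes> b) (s \<otimes> t)"
proof -
  have "lfrac (a' \<otimes> b') (s' \<otimes> t') = lfrac (a \<otimes> b) (s \<otimes> t)"
    if as: "(a', s') \<in> lfrac a s" and bt: "(b', t') \<in> lfrac b t" for a' s' b' t'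
  proof -
    note d = lfrac_memD(1-4)[OF as] lfrac_memD(1-4)[OF bt]
    obtain u v where u: "u \<in> S" "u \<otimes> (a' \<otimes> s) = u \<otimes> (a \<otimes> s')" and v: "v \<in> S" "v \<otimes> (b' \<otimes> t) = v \<otimes> (b \<otimes> t')"
      using lfrac_memD(5)[OF as] lfrac_memD(5)[OF bt] lfrac_eq_iff d by metis
    have "(u \<otimes> v) \<otimes> ((a' \<otimes> b') \<otimes> (s \<otimes> t)) = (u \<otimes> (a' \<otimes> s)) \<otimes> (v \<otimes> (b' \<otimes> t))" using d u(1) v(1) by (simp add: m_ac)
    also have "\<dots> = (u \<otimes> v) \<otimes> ((a \<otimes> b) \<otimes> (s' \<otimes> t'))" unfolding u(2) v(2) using d u(1) v(1) by (simp add: m_ac)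
    finally show ?thesis
      using d u(1) v(1) S_mult by (subst lfrac_eq_iff) auto
  qed
  note key = this
  have "lfrac a s \<otimes>\<^bsub>Loc\<^esub> lfrac b t = (\<Union>(a', s')\<in>lfrac a s. \<Union>(b', t')\<in>lfrac b t. lfrac (a' \<otimes> b') (s' \<otimes> t'))"
    by (simp add: localization_def lfrac_def)
  also have "\<dots> = lfrac (a \<otimes> b) (s \<otimes> t)"
    by (rule UN_pairs_constant[OF lfrac_self[OF assms(1,2)] lfrac_self[OF assms(3,4)] key])
  finally show ?thesis .
qed

lemma lfrac_add:
  assumes "a \<in> carrier R" "s \<in> S" "b \<in> carrier R" "t \<in> S"
  shows "lfrac a s \<oplus>\<^bsub>Loc\<^esub> lfrac b t = lfrac (a \<otimes> t \<oplus> b \<otimes> s) (s \<otimes> t)"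
proof -
  have "lfrac (a' \<otimes> t' \<oplus> b' \<otimes> s') (s' \<otimes> t') = lfrac (a \<otimes> t \<oplus> b \<otimes> s) (s \<otimes> t)"
    if as: "(a', s') \<in> lfrac a s" and bt: "(b', t') \<in> lfrac b t" for a' s' b' t'
  proof -
    note d = lfrac_memD(1-4)[OF as] lfrac_memD(1-4)[OF bt]
    obtain u v where u: "u \<in> S" "u \<otimes> (a' \<otimes> s) = u \<otimes> (a \<otimes> s')" and v: "v \<in> S" "v \<otimes> (b' \<otimes> t) = v \<otimes> (b \<otimes> t')"
      using lfrac_memD(5)[OF as] lfrac_memD(5)[OF bt] lfrac_eq_iff d by metis
    have "(u \<otimes> v) \<otimes> ((a' \<otimes> t' \<oplus> b' \<otimes> s') \<otimes> (s \<otimes> t)) =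
        (u \<otimes> (a' \<otimes> s)) \<otimes> (v \<otimes> t \<otimes> t') \<oplus> (v \<otimes> (b' \<otimes> t)) \<otimes> (u \<otimes> s \<otimes> s')"
      using d u(1) v(1) by (simp add: l_distr r_distr m_ac)
    also have "\<dots> = (u \<otimes> v) \<otimes> ((a \<otimes> t \<oplus> b \<otimes> s) \<otimes> (s' \<otimes> t'))"
      unfolding u(2) v(2) using d u(1) v(1) by (simp add: l_distr r_distr m_ac)
    finally show ?thesis
      using d u(1) v(1) S_mult by (subst lfrac_eq_iff) auto
  qed
  note key = this
  have "lfrac a s \<oplus>\<^bsub>Loc\<^esub> lfrac b t =
      (\<Union>(a', s')\<in>lfrac a s. \<Union>(b', t')\<in>lfrac b t. lfrac (a' \<otimes> t' \<oplus> b' \<otimes> s') (s' \<otimes> t'))"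
    by (simp add: localization_def lfrac_def)
  also have "\<dots> = lfrac (a \<otimes> t \<oplus> b \<otimes> s) (s \<otimes> t)"
    by (rule UN_pairs_constant[OF lfrac_self[OF assms(1,2)] lfrac_self[OF assms(3,4)] key])
  finally show ?thesis .
qed

lemma lfrac_closed [simp]: "a \<in> carrier R \<Longrightarrow> s \<in> S \<Longrightarrow> lfrac a s \<in> carrier Loc"
  by (auto simp: carrier_Loc)

lemma cring_Loc: "cring Loc"
proof (rule cringI)
  show "abelian_group Loc"
  proof (rule abelian_groupI)
    fix x y z assume "x \<in> carrier Loc" "y \<in> carrier Loc" "z \<in> carrier Loc"
    then obtain a s b t c w where d: "a \<in> carrier R" "s \<in> S" "x = lfrac a s" "b \<in> carrier R" "t \<in> S" "y = lfrac b t"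
      "c \<in> carrier R" "w \<in> S" "z = lfrac c w" by (elim LocE)
    show "x \<oplus>\<^bsub>Loc\<^esub> y \<oplus>\<^bsub>Loc\<^esub> z = x \<oplus>\<^bsub>Loc\<^esub> (y \<oplus>\<^bsub>Loc\<^esub> z)"
      using d by (simp add: lfrac_add S_mult, intro lfrac_eqI) (simp_all add: S_mult l_distr r_distr m_ac a_ac)
  next
    fix x y assume "x \<in> carrier Loc" "y \<in> carrier Loc"
    then obtain a s b t where d: "a \<in> carrier R" "s \<in> S" "x = lfrac a s" "b \<in> carrier R" "t \<in> S" "y = lfrac b t"
      by (elim LocE)
    show "x \<oplus>\<^bsub>Loc\<^esub> y \<in> carrier Loc" using d by (simp add: lfrac_add S_mult)
    show "x \<oplus>\<^bsub>Loc\<^esub> y = y \<oplus>\<^bsub>Loc\<^esub> x" using d by (simp add: lfrac_add a_comm m_comm)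
  next
    show "\<zero>\<^bsub>Loc\<^esub> \<in> carrier Loc" by (simp add: zero_Loc S_one)
    fix x assume "x \<in> carrier Loc"
    then obtain a s where d: "a \<in> carrier R" "s \<in> S" "x = lfrac a s" by (elim LocE)
    show "\<zero>\<^bsub>Loc\<^esub> \<oplus>\<^bsub>Loc\<^esub> x = x" using d by (simp add: zero_Loc lfrac_add S_one)
    have "lfrac (\<ominus> a) s \<oplus>\<^bsub>Loc\<^esub> x = \<zero>\<^bsub>Loc\<^esub>"
      using d by (simp add: lfrac_add zero_Loc, intro lfrac_eqI) (simp_all add: S_mult S_one l_minus l_neg)
    then show "\<exists>y\<in>carrier Loc. y \<oplus>\<^bsub>Loc\<^esub> x = \<zero>\<^bsub>Loc\<^esub>" using d by (intro bexI[of _ "lfrac (\<ominus> a) s"]) auto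
  qed
  show "comm_monoid Loc"
  proof (rule comm_monoidI)
    fix x y z assume "x \<in> carrier Loc" "y \<in> carrier Loc" "z \<in> carrier Loc"
    then obtain a s b t c w where d: "a \<in> carrier R" "s \<in> S" "x = lfrac a s" "b \<in> carrier R" "t \<in> S" "y = lfrac b t"
      "c \<in> carrier R" "w \<in> S" "z = lfrac c w" by (elim LocE)
    show "x \<otimes>\<^bsub>Loc\<^esub> y \<otimes>\<^bsub>Loc\<^esub> z = x \<otimes>\<^bsub>Loc\<^esub> (y \<otimes>\<^bsub>Loc\<^esub> z)"
      using d by (simp add: lfrac_mult S_mult m_assoc)
  next
    fix x y assume "x \<in> carrier Loc" "y \<in> carrier Loc"
    then obtain a s b t where d: "a \<in> carrier R" "s \<in> S" "x = lfrac a s" "b \<in> carrier R" "t \<in> S" "y = lfrac b t"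
      by (elim LocE)
    show "x \<otimes>\<^bsub>Loc\<^esub> y \<in> carrier Loc" using d by (simp add: lfrac_mult S_mult)
    show "x \<otimes>\<^bsub>Loc\<^esub> y = y \<otimes>\<^bsub>Loc\<^esub> x" using d by (simp add: lfrac_mult m_comm)
  next
    show "\<one>\<^bsub>Loc\<^esub> \<in> carrier Loc" by (simp add: one_Loc S_one)
    fix x assume "x \<in> carrier Loc"
    then obtain a s where d: "a \<in> carrier R" "s \<in> S" "x = lfrac a s" by (elim LocE)
    show "\<one>\<^bsub>Loc\<^esub> \<otimes>\<^bsub>Loc\<^esub> x = x" using d by (simp add: one_Loc lfrac_mult S_one)
  qed
  fix x y z assume "x \<in> carrier Loc" "y \<in> carrier Loc" "z \<in> carrier Loc"
  then obtain a s b t c w where d: "a \<in> carrier R" "s \<in> S" "x = lfrac a s" "b \<in> carrier R" "t \<in> S" "y = lfrac b t"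
    "c \<in> carrier R" "w \<in> S" "z = lfrac c w" by (elim LocE)
  show "(x \<oplus>\<^bsub>Loc\<^esub> y) \<otimes>\<^bsub>Loc\<^esub> z = x \<otimes>\<^bsub>Loc\<^esub> z \<oplus>\<^bsub>Loc\<^esub> y \<otimes>\<^bsub>Loc\<^esub> z"
    using d by (simp add: lfrac_mult lfrac_add S_mult, intro lfrac_eqI) (simp_all add: S_mult l_distr r_distr m_ac)
qed

lemma lfrac_one_add: "a \<in> carrier R \<Longrightarrow> b \<in> carrier R \<Longrightarrow> lfrac (a \<oplus> b) \<one> = lfrac a \<one> \<oplus>\<^bsub>Loc\<^esub> lfrac b \<one>"
  by (simp add: lfrac_add S_one)

lemma lfrac_one_mult: "a \<in> carrier R \<Longrightarrow> b \<in> carrier R \<Longrightarrow> lfrac (a \<otimes> b) \<one> = lfrac a \<one> \<otimes>\<^bsub>Loc\<^esub> lfrac b \<one>"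
  by (simp add: lfrac_mult S_one)

lemma lfrac_one_unit:
  assumes "s \<in> S" shows "lfrac s \<one> \<in> Units Loc"
proof -
  interpret L: cring Loc by (rule cring_Loc)
  have "lfrac s \<one> \<otimes>\<^bsub>Loc\<^esub> lfrac \<one> s = \<one>\<^bsub>Loc\<^esub>"
    using assms S_one by (simp add: lfrac_mult one_Loc, intro lfrac_eqI) (auto simp: S_mult)
  then show ?thesis using assms S_one L.m_comm
    by (auto simp: Units_def intro!: bexI[of _ "lfrac \<one> s"])
qed

lemma lfrac_mult_denominator:
  "a \<in> carrier R \<Longrightarrow> s \<in> S \<Longrightarrow> lfrac a s \<otimes>\<^bsub>Loc\<^esub> lfrac s \<one> = lfrac a \<one>"
  using S_one by (simp add: lfrac_mult, intro lfrac_eqI) (auto simp: S_mult)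

lemma lfrac_one_zero:
  "a \<in> carrier R \<Longrightarrow> lfrac a \<one> = \<zero>\<^bsub>Loc\<^esub> \<longleftrightarrow> (\<exists>u\<in>S. u \<otimes> a = \<zero>)"
  using S_one by (simp add: zero_Loc lfrac_eq_iff)

end

lemma (in cring) localized_ring_maximalideal:
  assumes m: "maximalideal m R"
  shows "localized_ring R (carrier R - m)"
proof -
  interpret primeideal m R by (rule maximalideal_prime[OF m])
  show ?thesis
  proof (intro localized_ring.intro localized_ring_axioms.intro)
    show "\<one> \<in> carrier R - m" using I_notcarr one_imp_carrier by blast
    show "s \<otimes> t \<in> carrier R - m" if "s \<in> carrier R - m" "t \<in> carrier R - m" for s t
      using that I_prime by blast
  qed (use cring_axioms in auto)
qed

text \<open>The case in which \<open>T\<close> is the quotient itself. Both \<open>T\<close> and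
  each of its localizations are fraction maps from the same \<open>P\<close> and \<open>J\<close>,
  so one verification over \<open>P\<close> settles coherence and the Gorenstein condition.\<close>

locale quotient_map = T?: cring T + ideal_mod J for T (structure) and J :: "'a::comm_ring_1 set" +
  fixes P :: "'a set" and \<rho> :: "'a \<Rightarrow> 'b"
  assumes P: "subring_set P"
    and \<rho>_closed: "a \<in> P \<Longrightarrow> \<rho> a \<in> carrier T"
    and \<rho>_add: "a \<in> P \<Longrightarrow> b \<in> P \<Longrightarrow> \<rho> (a + b) = \<rho> a \<oplus> \<rho> b"
    and \<rho>_mult: "a \<in> P \<Longrightarrow> b \<in> P \<Longrightarrow> \<rho> (a * b) = \<rho> a \<otimes> \<rho> b"
    and \<rho>_one: "\<rho> 1 = \<one>"
    and \<rho>_zero_iff: "a \<in> P \<Longrightarrow> \<rho> a = \<zero> \<longleftrightarrow> a \<in> J"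
    and \<rho>_onto: "t \<in> carrier T \<Longrightarrow> \<exists>a\<in>P. t = \<rho> a"
begin

lemma fraction_map: "fraction_map T J P \<rho>"
proof
  note PD = subring_setD[OF P]
  show "\<exists>u\<in>P. \<rho> u \<in> Units T \<and> u * a \<in> J" if "a \<in> P" "\<rho> a = \<zero>" for a
    using that \<rho>_zero_iff PD(2) \<rho>_one by (intro bexI[of _ 1]) auto
  show "\<exists>a\<in>P. \<exists>s\<in>P. \<rho> s \<in> Units T \<and> t \<otimes> \<rho> s = \<rho> a" if t: "t \<in> carrier T" for t
  proof -
    obtain a where "a \<in> P" "t = \<rho> a" using \<rho>_onto[OF t] by blast
    then show ?thesis using t PD(2) \<rho>_one by (intro bexI[of _ a] bexI[of _ 1]) auto
  qed
qed (use P \<rho>_closed \<rho>_add \<rho>_mult \<rho>_one \<rho>_zero_iff in auto)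

lemma fraction_map_localization:
  assumes "localized_ring T S"
  shows "fraction_map (localization T S) J P (\<lambda>a. localized_ring.lfrac T S (\<rho> a) \<one>)"
proof -
  interpret L: localized_ring T S by (rule assms)
  note PD = subring_setD[OF P]
  show ?thesis
  proof (intro fraction_map.intro fraction_map_axioms.intro)
    show "\<exists>u\<in>P. L.lfrac (\<rho> u) \<one> \<in> Units (localization T S) \<and> u * a \<in> J"
      if a: "a \<in> P" and z: "L.lfrac (\<rho> a) \<one> = \<zero>\<^bsub>localization T S\<^esub>" for a
    proof -
      obtain s where s: "s \<in> S" "s \<otimes> \<rho> a = \<zero>" using L.lfrac_one_zero[OF \<rho>_closed[OF a]] z by blast
      obtain u where u: "u \<in> P" "s = \<rho> u" using \<rho>_onto[OF L.SD[OF s(1)]] by blast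
      have "u * a \<in> J" using \<rho>_zero_iff[OF PD(4)[OF u(1) a]] s(2) u a by (simp add: \<rho>_mult)
      then show ?thesis using u L.lfrac_one_unit[OF s(1)] by blast
    qed
    show "\<exists>a\<in>P. \<exists>s\<in>P. L.lfrac (\<rho> s) \<one> \<in> Units (localization T S) \<and>
        t \<otimes>\<^bsub>localization T S\<^esub> L.lfrac (\<rho> s) \<one> = L.lfrac (\<rho> a) \<one>"
      if "t \<in> carrier (localization T S)" for t
    proof -
      obtain x s where xs: "x \<in> carrier T" "s \<in> S" "t = L.lfrac x s" using \<open>t \<in> _\<close> by (rule L.LocE)
      obtain a where a: "a \<in> P" "x = \<rho> a" using \<rho>_onto[OF xs(1)] by blast
      obtain u where u: "u \<in> P" "s = \<rho> u" using \<rho>_onto[OF L.SD[OF xs(2)]] by blast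
      have "t \<otimes>\<^bsub>localization T S\<^esub> L.lfrac (\<rho> u) \<one> = L.lfrac (\<rho> a) \<one>"
        unfolding xs(3) a(2)[symmetric] u(2)[symmetric] by (rule L.lfrac_mult_denominator[OF xs(1,2)])
      moreover have "L.lfrac (\<rho> u) \<one> \<in> Units (localization T S)"
        unfolding u(2)[symmetric] by (rule L.lfrac_one_unit[OF xs(2)])
      ultimately show ?thesis using a(1) u(1) by blast
    qed
    show "L.lfrac (\<rho> a) \<one> = \<zero>\<^bsub>localization T S\<^esub>" if "a \<in> P" "a \<in> J" for a
      using that \<rho>_zero_iff[OF that(1)] by (simp add: L.zero_Loc)
  qed (use P \<rho>_closed \<rho>_one L.cring_Loc ideal_mod_axioms L.S_one in
      \<open>simp_all add: \<rho>_add \<rho>_mult L.lfrac_one_add L.lfrac_one_mult L.one_Loc\<close>)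
qed

lemma coherent_gorenstein:
  assumes kd: "kernel_duality_mod P J"
  shows "coherent_ring T \<and> gorenstein_ring T"
proof
  show "coherent_ring T"
    by (rule coherent_ring_if_kernel_duality[OF fraction_map.kernel_duality[OF fraction_map kd]])
  show "gorenstein_ring T"
  proof (rule gorenstein_ring_if_kernel_duality)
    fix m assume "maximalideal m T"
    then have loc: "localized_ring T (carrier T - m)" by (rule localized_ring_maximalideal)
    show "cring (localization T (carrier T - m)) \<and> kernel_duality (localization T (carrier T - m))"
      using localized_ring.cring_Loc[OF loc] fraction_map.kernel_duality[OF fraction_map_localization[OF loc] kd]
      by blast
  qed
qed

end

section \<open>The ring \<open>B\<close>\<close>

lemma mpoly_ring_simps:
  "carrier (mpoly_ring V) = polys_in V"
  "monoid.mult (mpoly_ring V) = (*)" "add (mpoly_ring V) = (+)" "\<one>\<^bsub>mpoly_ring V\<^esub> = 1" "\<zero>\<^bsub>mpoly_ring V\<^esub> = 0"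
  by (simp_all add: mpoly_ring_def polys_in_def ring_of_type_algebra_def)

lemma cring_mpoly_ring: "cring (mpoly_ring V :: (('x \<Rightarrow>\<^sub>0 nat) \<Rightarrow>\<^sub>0 'r::comm_ring_1) ring)"
proof (rule cringI)
  note D = subring_setD[OF subring_set_polys_in[of V]]
  show "abelian_group (mpoly_ring V :: (('x \<Rightarrow>\<^sub>0 nat) \<Rightarrow>\<^sub>0 'r) ring)"
    by (rule abelian_groupI)
      (auto simp: mpoly_ring_simps add_ac intro: D intro!: bexI[of _ "- x" for x])
  show "comm_monoid (mpoly_ring V :: (('x \<Rightarrow>\<^sub>0 nat) \<Rightarrow>\<^sub>0 'r) ring)"
    by (rule comm_monoidI) (auto simp: mpoly_ring_simps mult_ac intro: D)
qed (simp add: mpoly_ring_simps distrib_right)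

section \<open>Normal forms and the ideal generated by the relations\<close>

definition squarefree_monomial :: "'x set \<Rightarrow> ('x \<Rightarrow>\<^sub>0 nat)" where
  "squarefree_monomial S = (\<Sum>x\<in>S. Poly_Mapping.single x 1)"

lemma lookup_squarefree_monomial:
  "finite S \<Longrightarrow> Poly_Mapping.lookup (squarefree_monomial S) x = (if x \<in> S then 1 else 0)"
  by (simp add: squarefree_monomial_def lookup_sum lookup_single when_def)

text \<open>As long as some exponent is at least 2, a multiple of a relation trades
  \<open>x^2\<close> for \<open>c x\<close>; the total degree drops by 2 and the normal form data
  stay the same. \<open>I\<close> is only assumed to be closed under sums and to contain these
  multiples.\<close>

lemma monomial_reduction:
  assumes add: "\<And>a b. a \<in> I \<Longrightarrow> b \<in> I \<Longrightarrow> a + b \<in> I" and zero: "0 \<in> I"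
    and rel: "\<And>q x. q \<in> polys_in V \<Longrightarrow> x \<in> V \<Longrightarrow> q * (mpoly_var x ^ 2 - mpoly_const (c x)) \<in> I"
    and m: "Poly_Mapping.keys m \<subseteq> V"
  shows "Poly_Mapping.single m r -
     Poly_Mapping.single (squarefree_monomial (odd_part m)) (r * square_weight c m) \<in> I"
  using m
proof (induction "\<Sum>x\<in>Poly_Mapping.keys m. Poly_Mapping.lookup m x" arbitrary: m r rule: less_induct)
  case less
  show ?case
  proof (cases "\<exists>x. Poly_Mapping.lookup m x \<ge> 2")
    case False
    then have small: "Poly_Mapping.lookup m x = 0 \<or> Poly_Mapping.lookup m x = 1" for x
      by (metis less_2_cases not_le One_nat_def)
    have "squarefree_monomial (odd_part m) = m"
    proof (rule poly_mapping_eqI)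
      fix x show "Poly_Mapping.lookup (squarefree_monomial (odd_part m)) x = Poly_Mapping.lookup m x"
        using small[of x] by (auto simp: lookup_squarefree_monomial odd_part_def[of m] finite_odd_part[unfolded odd_part_def])
    qed
    moreover have "square_weight c m = 1"
      unfolding square_weight_def
    proof (rule prod.neutral, intro ballI)
      fix x show "c x ^ (Poly_Mapping.lookup m x div 2) = 1" using small[of x] by auto
    qed
    ultimately show ?thesis using zero by simp
  next
    case True
    then obtain x where x: "Poly_Mapping.lookup m x \<ge> 2" by blast
    define m' where "m' = m - Poly_Mapping.single x 2"
    have look: "Poly_Mapping.lookup m' y = Poly_Mapping.lookup m y - (if y = x then 2 else 0)" for y
      by (simp add: m'_def lookup_minus lookup_single when_def)
    have mm: "m = m' + Poly_Mapping.single x 2"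
      by (rule poly_mapping_eqI) (use x in \<open>auto simp: lookup_add look lookup_single when_def\<close>)
    have xm: "x \<in> Poly_Mapping.keys m" using x by (simp add: in_keys_iff)
    have sub: "Poly_Mapping.keys m' \<subseteq> Poly_Mapping.keys m"
    proof
      fix y assume "y \<in> Poly_Mapping.keys m'"
      then have "Poly_Mapping.lookup m y \<noteq> 0" by (auto simp: in_keys_iff look)
      then show "y \<in> Poly_Mapping.keys m" by (simp add: in_keys_iff)
    qed
    have "(\<Sum>y\<in>Poly_Mapping.keys m'. Poly_Mapping.lookup m' y) = (\<Sum>y\<in>Poly_Mapping.keys m. Poly_Mapping.lookup m' y)"
      by (rule sum.mono_neutral_left) (use sub in \<open>auto simp: in_keys_iff\<close>)
    also have "\<dots> < (\<Sum>y\<in>Poly_Mapping.keys m. Poly_Mapping.lookup m y)"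
      by (rule sum_strict_mono_ex1) (use xm x in \<open>auto simp: look intro!: bexI[of _ x]\<close>)
    finally have IH: "Poly_Mapping.single m' (r * c x) -
        Poly_Mapping.single (squarefree_monomial (odd_part m')) (r * c x * square_weight c m') \<in> I"
      using less sub by blast
    have "x \<in> V" using xm less.prems by blast
    moreover have "Poly_Mapping.single m' r \<in> polys_in V" using sub less.prems by (intro polys_in_single) auto
    ultimately have "Poly_Mapping.single m' r * (mpoly_var x ^ 2 - mpoly_const (c x)) \<in> I" by (rule rel[rotated])
    also have "Poly_Mapping.single m' r * (mpoly_var x ^ 2 - mpoly_const (c x)) =
        Poly_Mapping.single m r - Poly_Mapping.single m' (r * c x)"
      by (simp add: mpoly_var_power2 mpoly_const_def right_diff_distrib mult_single mm)
    finally have *: "Poly_Mapping.single m r - Poly_Mapping.single m' (r * c x) \<in> I" .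
    have "odd_part m = odd_part m'" "square_weight c m = c x * square_weight c m'"
      by (simp_all add: mm odd_part_add odd_part_single square_weight_add square_weight_single mult.commute)
    then show ?thesis using add[OF * IH] by (simp add: mult.assoc)
  qed
qed

text \<open>Up to \<open>I\<close>, a polynomial equals the sum of the normal forms of its
  monomials. Grouped by odd part, the coefficients of that sum are the \<open>nf_coeff\<close>, all
  of them zero here.\<close>

lemma nf_ideal_subset:
  fixes p :: "('x \<Rightarrow>\<^sub>0 nat) \<Rightarrow>\<^sub>0 'r::comm_ring_1"
  assumes add: "\<And>a b. a \<in> I \<Longrightarrow> b \<in> I \<Longrightarrow> a + b \<in> I" and zero: "0 \<in> I"
    and rel: "\<And>q x. q \<in> polys_in V \<Longrightarrow> x \<in> V \<Longrightarrow> q * (mpoly_var x ^ 2 - mpoly_const (c x)) \<in> I"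
    and p: "p \<in> polys_in V" "p \<in> nf_ideal c"
  shows "p \<in> I"
proof -
  let ?K = "Poly_Mapping.keys p"
  define g where "g m = Poly_Mapping.single (squarefree_monomial (odd_part m))
    (Poly_Mapping.lookup p m * square_weight c m)" for m
  have sum_I: "sum f A \<in> I" if "finite A" "\<And>m. m \<in> A \<Longrightarrow> f m \<in> I" for f :: "('x \<Rightarrow>\<^sub>0 nat) \<Rightarrow> _" and A
    using that by (induction A rule: finite_induct) (auto intro: add zero)
  have "(\<Sum>m\<in>?K. Poly_Mapping.single m (Poly_Mapping.lookup p m) - g m) \<in> I"
  proof (rule sum_I)
    fix m assume "m \<in> ?K"
    then have "Poly_Mapping.keys m \<subseteq> V" using p(1) by (simp add: polys_in_def)
    then show "Poly_Mapping.single m (Poly_Mapping.lookup p m) - g m \<in> I"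
      unfolding g_def using monomial_reduction[where I = I and V = V, OF add zero rel] by blast
  qed simp
  moreover have "(\<Sum>m\<in>?K. g m) = 0"
  proof -
    have "(\<Sum>m\<in>?K. g m) = (\<Sum>S\<in>odd_part ` ?K. \<Sum>m\<in>{m\<in>?K. odd_part m = S}. g m)"
      by (rule sum.image_gen) simp
    also have "\<dots> = (\<Sum>S\<in>odd_part ` ?K. Poly_Mapping.single (squarefree_monomial S) (nf_coeff c p S))"
    proof (rule sum.cong[OF refl])
      fix S
      have "Poly_Mapping.single k (sum f A) = (\<Sum>m\<in>A. Poly_Mapping.single k (f m))"
        for k :: "'x \<Rightarrow>\<^sub>0 nat" and f :: "('x \<Rightarrow>\<^sub>0 nat) \<Rightarrow> 'r" and A
        by (induction A rule: infinite_finite_induct) (simp_all add: single_add)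
      moreover have "nf_coeff c p S = (\<Sum>m\<in>{m\<in>?K. odd_part m = S}. Poly_Mapping.lookup p m * square_weight c m)"
        unfolding nf_coeff_def by (rule sum.inter_filter[symmetric]) simp
      ultimately show "(\<Sum>m\<in>{m\<in>?K. odd_part m = S}. g m) = Poly_Mapping.single (squarefree_monomial S) (nf_coeff c p S)"
        by (simp add: g_def)
    qed
    also have "\<dots> = 0" using p(2) by (simp add: nf_ideal_def)
    finally show ?thesis .
  qed
  ultimately show ?thesis using poly_mapping_sum_single[of p] by (simp add: sum_subtractf)
qed

lemma square_relations_in_polys_in:
  fixes c :: "'x \<Rightarrow> 'r::comm_ring_1"
  shows "{mpoly_var x ^ 2 - mpoly_const (c x) | x. x \<in> V} \<subseteq> polys_in V"
proof clarify
  fix x assume x: "x \<in> V"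
  have "mpoly_var x ^ 2 \<in> (polys_in V :: (('x \<Rightarrow>\<^sub>0 nat) \<Rightarrow>\<^sub>0 'r) set)"
    unfolding mpoly_var_power2 by (rule polys_in_single) (use x in auto)
  moreover have "mpoly_const (c x) \<in> polys_in V"
    unfolding mpoly_const_def by (rule polys_in_single) simp
  ultimately show "mpoly_var x ^ 2 - mpoly_const (c x) \<in> polys_in V"
    by (rule subring_setD(6)[OF subring_set_polys_in])
qed

text \<open>One inclusion holds because the right-hand side is an ideal containing the relations,
  the other by reduction to normal form. It allows congruence modulo the relations to be decided by
  coefficients.\<close>

lemma genideal_square_relations:
  fixes c :: "'x \<Rightarrow> 'r::comm_ring_1"
  shows "Idl\<^bsub>mpoly_ring V\<^esub> {mpoly_var x ^ 2 - mpoly_const (c x) | x. x \<in> V} = polys_in V \<inter> nf_ideal c"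
    (is "Idl\<^bsub>?P\<^esub> ?rels = _")
proof -
  interpret P: cring ?P by (rule cring_mpoly_ring)
  interpret J: ideal_mod "nf_ideal c" by (rule ideal_mod_nf_ideal)
  note D = subring_setD[OF subring_set_polys_in[of V, where 'b = 'r]]
  note rels = square_relations_in_polys_in[of c V]
  interpret I: ideal "Idl\<^bsub>?P\<^esub> ?rels" ?P
    by (rule P.genideal_ideal) (use rels in \<open>simp add: mpoly_ring_simps\<close>)
  show ?thesis
  proof (intro equalityI subsetI)
    have "Idl\<^bsub>?P\<^esub> ?rels \<subseteq> polys_in V \<inter> nf_ideal c"
    proof (rule P.genideal_minimal)
      show "ideal (polys_in V \<inter> nf_ideal c) ?P"
      proof (rule idealI[OF P.ring_axioms])
        show "subgroup (polys_in V \<inter> nf_ideal c) (add_monoid ?P)"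
        proof (rule P.add.subgroupI)
          show "\<ominus>\<^bsub>?P\<^esub> a \<in> polys_in V \<inter> nf_ideal c" if a: "a \<in> polys_in V \<inter> nf_ideal c" for a
          proof -
            have "\<ominus>\<^bsub>?P\<^esub> a = - a"
              by (rule P.minus_equality) (use a D in \<open>auto simp: mpoly_ring_simps\<close>)
            then show ?thesis using a D J.J_uminus by auto
          qed
        qed (use D J.J_add in \<open>auto simp: mpoly_ring_simps intro: J.J0\<close>)
      qed (use D J.J_mult in \<open>auto simp: mpoly_ring_simps mult.commute\<close>)
      have "?rels \<subseteq> nf_ideal c" by (auto simp: square_relation_in_nf_ideal)
      then show "?rels \<subseteq> polys_in V \<inter> nf_ideal c" using rels by (rule Int_greatest[rotated])
    qed
    then show "p \<in> polys_in V \<inter> nf_ideal c" if "p \<in> Idl\<^bsub>?P\<^esub> ?rels" for p using that by blast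
    fix p assume p: "p \<in> polys_in V \<inter> nf_ideal c"
    show "p \<in> Idl\<^bsub>?P\<^esub> ?rels"
    proof (rule nf_ideal_subset[where c = c and V = V])
      show "a + b \<in> Idl\<^bsub>?P\<^esub> ?rels" if "a \<in> Idl\<^bsub>?P\<^esub> ?rels" "b \<in> Idl\<^bsub>?P\<^esub> ?rels" for a b
        using I.a_closed[OF that] by (simp add: mpoly_ring_simps)
      show "0 \<in> Idl\<^bsub>?P\<^esub> ?rels" using I.zero_closed by (simp add: mpoly_ring_simps)
      show "q * (mpoly_var x ^ 2 - mpoly_const (c x)) \<in> Idl\<^bsub>?P\<^esub> ?rels" if "q \<in> polys_in V" "x \<in> V" for q x
      proof -
        have "mpoly_var x ^ 2 - mpoly_const (c x) \<in> Idl\<^bsub>?P\<^esub> ?rels"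
          using P.genideal_self[of ?rels] rels \<open>x \<in> V\<close> by (auto simp: mpoly_ring_simps)
        then show ?thesis using I.I_l_closed[of _ q] \<open>q \<in> polys_in V\<close> by (simp add: mpoly_ring_simps)
      qed
    qed (use p in auto)
  qed
qed

section \<open>Conclusion for rings with square roots adjoined and for \<open>B\<close>\<close>

lemma coherent_gorenstein_square_roots:
  fixes c :: "'x \<Rightarrow> 'r::idom" and V :: "'x set"
  assumes bez: "bezout_families TYPE('r)"
  defines "P \<equiv> mpoly_ring V"
  defines "B \<equiv> P Quot (Idl\<^bsub>P\<^esub> {mpoly_var x ^ 2 - mpoly_const (c x) | x. x \<in> V})"
  shows "coherent_ring B \<and> gorenstein_ring B"
proof -
  define I where "I = polys_in V \<inter> nf_ideal c"
  have B: "B = P Quot I" unfolding B_def P_def I_def genideal_square_relations ..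
  interpret P: cring P unfolding P_def by (rule cring_mpoly_ring)
  have simps: "carrier P = polys_in V" "monoid.mult P = (*)" "add P = (+)" "\<one>\<^bsub>P\<^esub> = 1" "\<zero>\<^bsub>P\<^esub> = 0"
    by (simp_all add: P_def mpoly_ring_simps)
  have rels: "{mpoly_var x ^ 2 - mpoly_const (c x) | x. x \<in> V} \<subseteq> carrier P"
    unfolding simps by (rule square_relations_in_polys_in)
  have "ideal (Idl\<^bsub>P\<^esub> {mpoly_var x ^ 2 - mpoly_const (c x) | x. x \<in> V}) P"
    by (rule P.genideal_ideal[OF rels])
  then have "ideal I P" by (simp add: P_def I_def genideal_square_relations)
  then interpret I: ideal I P .
  have hom: "(+>\<^bsub>P\<^esub>) I \<in> ring_hom P (P Quot I)" by (rule I.rcos_ring_hom)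
  \<comment> \<open>The coset map has kernel \<open>I\<close>, and on \<open>polys_in V\<close>
    membership in \<open>I\<close> is membership in \<open>nf_ideal c\<close>; so the ideal of the
    whole type can replace the ideal of the record.\<close>
  have "quotient_map (P Quot I) (nf_ideal c) (polys_in V) ((+>\<^bsub>P\<^esub>) I)"
  proof (intro quotient_map.intro quotient_map_axioms.intro)
    show "cring (P Quot I)" by (rule I.quotient_is_cring[OF P.cring_axioms])
    show "I +>\<^bsub>P\<^esub> a = \<zero>\<^bsub>P Quot I\<^esub> \<longleftrightarrow> a \<in> nf_ideal c" if a: "a \<in> polys_in V" for a
    proof -
      have "I +>\<^bsub>P\<^esub> a = I \<longleftrightarrow> a \<in> I"
        using I.a_rcos_const[of a] I.a_rcos_self[of a] a by (auto simp: simps)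
      then show ?thesis using a by (simp add: FactRing_def I_def)
    qed
    show "\<exists>a\<in>polys_in V. t = I +>\<^bsub>P\<^esub> a" if "t \<in> carrier (P Quot I)" for t
      using that by (auto simp: FactRing_def A_RCOSETS_def' simps)
  qed (use ring_hom_closed[OF hom] ring_hom_add[OF hom] ring_hom_mult[OF hom] ring_hom_one[OF hom]
      in \<open>simp_all add: simps ideal_mod_nf_ideal subring_set_polys_in\<close>)
  then show ?thesis unfolding B
    by (rule quotient_map.coherent_gorenstein) (rule kernel_duality_mod_polys_in[OF bez])
qed

lemma coherent_gorenstein_B_ring:
  fixes \<sigma> :: "'r::idom \<Rightarrow> 'r"
  assumes bez: "bezout_families TYPE('r)"
  shows "coherent_ring (B_ring r \<sigma> p) \<and> gorenstein_ring (B_ring r \<sigma> p)"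
proof -
  define c where "c = (\<lambda>(i, j). iter_int \<sigma> (- j) (p i))"
  have "{mpoly_var (i, j) ^ 2 - mpoly_const (iter_int \<sigma> (- j) (p i)) | i j. i \<in> {1..r}} =
      {mpoly_var x ^ 2 - mpoly_const (c x) | x. x \<in> {1..r} \<times> UNIV}"
    by (auto simp: c_def)
  then show ?thesis
    using coherent_gorenstein_square_roots[OF bez, of "{1..r} \<times> UNIV" c] by (simp add: B_ring_def Let_def)
qed

theorem proposition5p19:
  fixes f :: "'k::{alg_closed_field, field_char_0} poly"
    and r :: nat and \<alpha> :: "nat \<Rightarrow> 'k" and n :: "nat \<Rightarrow> nat"
  assumes monic: "lead_coeff f = 1"
    and roots: "bij_betw \<alpha> {1..r} {x. poly f x = 0}"
    and mults: "\<And>i. i \<in> {1..r} \<Longrightarrow> n i = Polynomial.order (\<alpha> i) f"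
  shows
    "(distinct_root_orbits (\<lambda>x. x - 1) f \<longrightarrow>
        (let B = B_ring r shift_aut (\<lambda>i. ([:0, 1:] - [:\<alpha> i:]) ^ n i)
         in coherent_ring B \<and> gorenstein_ring B))
     \<and>
     (\<forall>\<xi> :: 'k. \<xi> \<noteq> 0 \<and> (\<forall>m>0. \<xi> ^ m \<noteq> 1) \<and> poly f 0 \<noteq> 0 \<and>
        distinct_root_orbits (\<lambda>x. inverse \<xi> * x) f \<longrightarrow>
        (let B = B_ring r (scale_aut \<xi>) (\<lambda>i. (laurent_z - laurent_const (\<alpha> i)) ^ n i)
         in coherent_ring B \<and> gorenstein_ring B))"
  unfolding Let_def
  using coherent_gorenstein_B_ring[OF bezout_families_euclidean_ring] coherent_gorenstein_B_ring[OF bezout_families_laurent]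
  by blast

end
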